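(* Let $\Phi$ be of type $A_n$ with fundamental weights $\omega_1,\dots,\omega_n$. Let $(a_1,\dots,a_n)\in\mathbb{N}^n$, $\tau=\sum_i a_i\omega_i\in P^+$ and $N=\sum_i a_i$. Let $\mathbf{m}=(m_1,\dots,m_N)\in\{1,\dots,n\}^N$ be any $N$-tuple which contains exactly $a_i$ entries equal to $i$ for every $i$. Then the element $\mathbf{P}(\tau)C_{w_0}$ has the following expression in the Kazhdan–Lusztig basis: $$\mathbf{P}(\tau)C_{w_0}=\sum_{\lambda\in P^-}\mathcal{P}_{\mathbf{m}}(\lambda)\,C_{w_0p_\lambda},$$ where $\mathcal{P}_{\mathbf{m}}(\lambda)$ is the number of paths of type $\mathbf{m}$ in $P^-$ from $0$ to $\lambda$.
   Context: Geometry (type $A_n$, $n\ge1$). $\Phi\subset V$ is the root system of type $A_n$ in a Euclidean space $V$ of dimension $n$, with positive roots $\Phi^+$ and simple roots $\Delta=\{\alpha_1,\dots,\alpha_n\}$. For $\alpha\in\Phi^+,k\in\mathbb{Z}$: $H_{\alpha,k}=\{x\in V:\langle x,\alpha^\vee\rangle=k\}$. Groups act on $V$ on the right (so $x(ww')=(xw)w'$). $W_0$ is the finite Weyl group generated by the reflections in the $H_{\alpha_i,0}$; the affine Weyl group $W_a$, generated by the reflections in all $H_{\alpha,k}$, is a Coxeter group with generating set $S$ consisting of the reflections in the walls of $A_0=\{x:0<\langle x,\alpha^\vee\rangle<1\ \forall\alpha\in\Phi^+\}$. $P$ is the weight lattice, $P^+$ the dominant weights, $P^-=-P^+$, and $\omega_1,\dots,\omega_n$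 the fundamental weights, so $|\langle\omega_i,\alpha^\vee\rangle|\le1$ for all $\alpha\in\Phi$. Extended group. $W_e=W_0\ltimes P$ (acting on $V$ on the right, $P$ by translations); for $\mu\in P$, $p_\mu\in W_e$ is the translation by $\mu$. $W_e=\Pi\ltimes W_a$, where $\Pi$ is the stabilizer of $A_0$, which permutes $S$ by conjugation. Extend the length and Bruhat order by $\ell(\pi w)=\ell(w)$ and $\pi w\le\pi'w'$ iff $\pi=\pi'$, $w\le w'$ ($\pi,\pi'\in\Pi$, $w,w'\in W_a$). $w_0$ is the longest element of $W_0$; $X_0=\{x\in W_e:\ell(xw_0)=\ell(x)+\ell(w_0)\}$. Hecke algebra. $L:W_e\to\mathbb{N}$ is a positive weight function: $L(ww')=L(w)+L(w')$ whenever $\ell(ww')=\ell(w)+\ell(w')$, $L(\pi w)=L(w)$ for $\pi\in\Pi$, and for $w\in W_a$, $L(w)=0$ iff $w=1$ (so $L$ is a positive multiple of $\ell$). $\mathcal{A}=\mathbb{C}[q,q^{-1}]$, $\mathcal{A}_{<0}=q^{-1}\mathbb{Z}[q^{-1}]$. $\mathcal{H}$ has $\mathcal{A}$-basis $\{T_w\}_{w\in W_e}$ with $T_xT_y=T_{xy}$ if $\ell(xy)=\ell(x)+\ell(y)$ and $T_s^2=1+(q^{L(s)}-q^{-L(s)})T_s$ for $s\in S$. The bar involution is the ring involution with $\bar q=q^{-1}$ (identity on $\mathbb{C}$), $\overline{T_w}=T_{w^{-1}}^{-1}$. $\{C_w\}$ is the Kazhdan–Lusztig basis: $\overline{C_w}=C_w$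 and $C_w\in T_w+\bigoplus_y\mathcal{A}_{<0}T_y$. There is a unique family $(\mathsf{p}_{x',x})_{x,x'\in X_0}$ with $\mathsf{p}_{x,x}=1$, $\mathsf{p}_{x',x}\in\mathcal{A}_{<0}$ if $x'<x$, $\mathsf{p}_{x',x}=0$ if $x'\not\le x$, such that $\sum_{x'\in X_0}\mathsf{p}_{x',x}T_{x'}C_{w_0y}$ is bar-invariant for all $x\in X_0$, $y\in X_0^{-1}$. Put $\mathbf{P}(\omega_i)=\sum_{x\in X_0}\mathsf{p}_{x,p_{\omega_i}}T_x$. For $\tau=\sum a_i\omega_i\in P^+$, $\mathbf{P}(\tau)$ is the product of the elements $\mathbf{P}(\omega_i)$, each taken $a_i$ times (in a fixed order; $\mathbf{P}(\tau)C_{w_0}$ does not depend on the order). Paths. $\mathcal{O}(\omega_i)$ is the $W_0$-orbit of $\omega_i$. A path of type $\mathbf{m}=(m_1,\dots,m_N)$ from $x$ to $y$ in $P^-$ is a sequence $x=x_0,x_1,\dots,x_N=y$ of elements of $P^-$ such that $x_{\ell-1}-x_\ell\in\mathcal{O}(\omega_{m_\ell})$ for all $1\le\ell\le N$.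
   Formalization: The step condition of a path of type m is taken as x_ℓ − x_{ℓ-1} ∈ O(ω_{m_ℓ}) instead of x_{ℓ-1} − x_ℓ; with the printed sign the formula fails for n ≥ 2, e.g. n = 2, τ = ω_1 gives C_{w_0 p_{-ω_2}} on the left but C_{w_0 p_{-ω_1}} on the right. *)

theory Defs
  imports "HOL-Analysis.Analysis" "HOL-Library.Poly_Mapping"
begin

section \<open>Root systems of type A\<close>

text \<open>\<open>pairing x a\<close> is \<open>\<langle>x, a\<^sup>\<or>\<rangle>\<close>, with coroots identified with vectors through the inner product.\<close>

definition pairing :: "'v::euclidean_space \<Rightarrow> 'v \<Rightarrow> real" where
  "pairing x a = 2 * (x \<bullet> a) / (a \<bullet> a)"

definition hyperplane :: "'v::euclidean_space \<Rightarrow> int \<Rightarrow> 'v set" where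
  "hyperplane a k = {x. pairing x a = of_int k}"

text \<open>The orthogonal reflection in \<open>hyperplane a k\<close>.\<close>

definition refl_in :: "'v::euclidean_space \<Rightarrow> int \<Rightarrow> 'v \<Rightarrow> 'v" where
  "refl_in a k x = x - (pairing x a - of_int k) *\<^sub>R a"

definition root_system :: "'v::euclidean_space set \<Rightarrow> bool" where
  "root_system \<Phi> \<longleftrightarrow>
     finite \<Phi> \<and> 0 \<notin> \<Phi> \<and> span \<Phi> = UNIV \<and>
     (\<forall>a\<in>\<Phi>. \<forall>b\<in>\<Phi>. refl_in a 0 b \<in> \<Phi>) \<and>
     (\<forall>a\<in>\<Phi>. \<forall>b\<in>\<Phi>. pairing b a \<in> \<int>) \<and>
     (\<forall>a\<in>\<Phi>. \<forall>c. c *\<^sub>R a \<in> \<Phi> \<longrightarrow> c = 1 \<or> c = -1)"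

text \<open>The simple roots are the family \<open>\<alpha> 1, \<dots>, \<alpha> n\<close>; values of \<open>\<alpha>\<close> outside \<open>{1..n}\<close> are irrelevant.\<close>

definition pos_roots :: "nat \<Rightarrow> 'v::euclidean_space set \<Rightarrow> (nat \<Rightarrow> 'v) \<Rightarrow> 'v set" where
  "pos_roots n \<Phi> \<alpha> = {b \<in> \<Phi>. \<exists>c :: nat \<Rightarrow> nat. b = (\<Sum>i = 1..n. real (c i) *\<^sub>R \<alpha> i)}"

definition simple_roots :: "nat \<Rightarrow> 'v::euclidean_space set \<Rightarrow> (nat \<Rightarrow> 'v) \<Rightarrow> bool" where
  "simple_roots n \<Phi> \<alpha> \<longleftrightarrow>
     inj_on \<alpha> {1..n} \<and> \<alpha> ` {1..n} \<subseteq> \<Phi> \<and> independent (\<alpha> ` {1..n}) \<and>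
     (\<forall>b\<in>\<Phi>. b \<in> pos_roots n \<Phi> \<alpha> \<or> - b \<in> pos_roots n \<Phi> \<alpha>)"

text \<open>Type \<open>A\<^sub>n\<close>: the Cartan matrix is that of \<open>A\<^sub>n\<close> for the usual numbering of the diagram.
  As \<open>DIM('v)\<close> is positive, \<open>n \<ge> 1\<close>.\<close>

definition type_A_roots :: "nat \<Rightarrow> 'v::euclidean_space set \<Rightarrow> (nat \<Rightarrow> 'v) \<Rightarrow> bool" where
  "type_A_roots n \<Phi> \<alpha> \<longleftrightarrow>
     DIM('v) = n \<and> root_system \<Phi> \<and> simple_roots n \<Phi> \<alpha> \<and>
     (\<forall>i\<in>{1..n}. \<forall>j\<in>{1..n}. pairing (\<alpha> i) (\<alpha> j) =
        (if i = j then 2 else if i = Suc j \<or> j = Suc i then -1 else 0))"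


section \<open>Finite, affine and extended affine Weyl groups\<close>

text \<open>Groups act on the right on \<open>V\<close>: the product \<open>w \<odot> w'\<close> is the map ``first \<open>w\<close>, then \<open>w'\<close>'',
  which is the library's forward composition \<open>fcomp\<close>; \<open>inv w\<close> is the inverse map.\<close>

notation fcomp (infixl "\<odot>" 70)

definition word_prod :: "('v \<Rightarrow> 'v) list \<Rightarrow> 'v \<Rightarrow> 'v" where
  "word_prod ss = foldr fcomp ss id"

text \<open>This is applied only to sets of reflections, so inverses of generators are not needed.\<close>

definition generated :: "('v \<Rightarrow> 'v) set \<Rightarrow> ('v \<Rightarrow> 'v) set" where
  "generated R = {word_prod ss | ss. set ss \<subseteq> R}"

definition transl :: "'v::euclidean_space \<Rightarrow> 'v \<Rightarrow> 'v" where
  "transl \<mu> x = x + \<mu>"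

context
  fixes n :: nat and \<Phi> :: "'v::euclidean_space set" and \<alpha> :: "nat \<Rightarrow> 'v"
begin

definition W_fin :: "('v \<Rightarrow> 'v) set" where
  "W_fin = generated {refl_in (\<alpha> i) 0 | i. i \<in> {1..n}}"

definition W_aff :: "('v \<Rightarrow> 'v) set" where
  "W_aff = generated {refl_in a k | a k. a \<in> pos_roots n \<Phi> \<alpha>}"

definition alcove0 :: "'v set" where
  "alcove0 = {x. \<forall>a \<in> pos_roots n \<Phi> \<alpha>. 0 < pairing x a \<and> pairing x a < 1}"

text \<open>The walls of the fundamental alcove are the hyperplanes supporting a facet of its closure.\<close>

definition S_aff :: "('v \<Rightarrow> 'v) set" where
  "S_aff = {refl_in a k | a k. a \<in> pos_roots n \<Phi> \<alpha> \<and>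
     (hyperplane a k \<inter> closure alcove0) facet_of closure alcove0}"

definition weights :: "'v set" where
  "weights = {x. \<forall>a\<in>\<Phi>. pairing x a \<in> \<int>}"

definition dominant_weights :: "'v set" where
  "dominant_weights = {x \<in> weights. \<forall>a \<in> pos_roots n \<Phi> \<alpha>. 0 \<le> pairing x a}"

definition antidominant_weights :: "'v set" where
  "antidominant_weights = uminus ` dominant_weights"

definition fund_weight :: "nat \<Rightarrow> 'v" where
  "fund_weight i = (THE x. \<forall>j\<in>{1..n}. pairing x (\<alpha> j) = (if i = j then 1 else 0))"

definition W_ext :: "('v \<Rightarrow> 'v) set" where
  "W_ext = {w \<odot> transl \<mu> | w \<mu>. w \<in> W_fin \<and> \<mu> \<in> weights}"

definition Pi_stab :: "('v \<Rightarrow> 'v) set" where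
  "Pi_stab = {\<pi> \<in> W_ext. \<pi> ` alcove0 = alcove0}"

definition len_aff :: "('v \<Rightarrow> 'v) \<Rightarrow> nat" where
  "len_aff w = (LEAST k. \<exists>ss. set ss \<subseteq> S_aff \<and> length ss = k \<and> w = word_prod ss)"

definition len :: "('v \<Rightarrow> 'v) \<Rightarrow> nat" where
  "len w = (THE k. \<exists>\<pi>\<in>Pi_stab. \<exists>u\<in>W_aff. w = \<pi> \<odot> u \<and> k = len_aff u)"

definition bruhat_step :: "('v \<Rightarrow> 'v) \<Rightarrow> ('v \<Rightarrow> 'v) \<Rightarrow> bool" where
  "bruhat_step u v \<longleftrightarrow> u \<in> W_aff \<and> len_aff u < len_aff v \<and>
     (\<exists>g\<in>W_aff. \<exists>s\<in>S_aff. v = u \<odot> (inv g \<odot> s \<odot> g))"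

definition bruhat_le :: "('v \<Rightarrow> 'v) \<Rightarrow> ('v \<Rightarrow> 'v) \<Rightarrow> bool" where
  "bruhat_le x y \<longleftrightarrow> (\<exists>\<pi>\<in>Pi_stab. \<exists>u\<in>W_aff. \<exists>v\<in>W_aff.
     x = \<pi> \<odot> u \<and> y = \<pi> \<odot> v \<and> bruhat_step\<^sup>*\<^sup>* u v)"

definition longest :: "'v \<Rightarrow> 'v" where
  "longest = (THE w. w \<in> W_fin \<and> (\<forall>u\<in>W_fin. len u \<le> len w))"

definition X0 :: "('v \<Rightarrow> 'v) set" where
  "X0 = {x \<in> W_ext. len (x \<odot> longest) = len x + len longest}"

definition weight_orbit :: "'v \<Rightarrow> 'v set" where
  "weight_orbit \<mu> = {w \<mu> | w. w \<in> W_fin}"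

definition positive_weight_function :: "(('v \<Rightarrow> 'v) \<Rightarrow> nat) \<Rightarrow> bool" where
  "positive_weight_function L \<longleftrightarrow>
     (\<forall>w\<in>W_ext. \<forall>w'\<in>W_ext. len (w \<odot> w') = len w + len w' \<longrightarrow> L (w \<odot> w') = L w + L w') \<and>
     (\<forall>\<pi>\<in>Pi_stab. \<forall>w\<in>W_ext. L (\<pi> \<odot> w) = L w) \<and>
     (\<forall>w\<in>W_aff. L w = 0 \<longleftrightarrow> w = id)"

end


section \<open>Laurent polynomials\<close>

text \<open>Finitely supported functions from the integers to the complex numbers with the convolution
  product, that is, Laurent polynomials in \<open>q\<close>.\<close>

type_synonym laurent = "int \<Rightarrow>\<^sub>0 complex"

definition qpow :: "int \<Rightarrow> laurent" where
  "qpow k = Poly_Mapping.single k 1"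

definition bar_laurent :: "laurent \<Rightarrow> laurent" where
  "bar_laurent a = Poly_Mapping.map_key uminus a"

text \<open>The set \<open>q\<inverse> \<int>[q\<inverse>]\<close>; its coefficients are integers although the ring is complex.\<close>

definition laurent_neg :: "laurent set" where
  "laurent_neg = {a. \<forall>k. Poly_Mapping.lookup a k \<in> \<int> \<and> (0 \<le> k \<longrightarrow> Poly_Mapping.lookup a k = 0)}"


section \<open>The Hecke algebra and its Kazhdan--Lusztig basis\<close>

text \<open>The Hecke algebra, its bar involution, its Kazhdan--Lusztig basis and the family \<open>p\<close> are each
  determined uniquely (the algebra up to unique isomorphism) by the properties below, so they enter
  as arbitrary data having these properties.\<close>

context
  fixes n :: nat and \<Phi> :: "'v::euclidean_space set" and \<alpha> :: "nat \<Rightarrow> 'v"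
    and L :: "('v \<Rightarrow> 'v) \<Rightarrow> nat"
    and scale :: "laurent \<Rightarrow> 'h::ring_1 \<Rightarrow> 'h" and T :: "('v \<Rightarrow> 'v) \<Rightarrow> 'h"
begin

definition hecke_algebra :: bool where
  "hecke_algebra \<longleftrightarrow>
     Modules.module scale \<and>
     (\<forall>a x y. scale a (x * y) = scale a x * y \<and> scale a (x * y) = x * scale a y) \<and>
     inj_on T (W_ext n \<Phi> \<alpha>) \<and>
     \<not> module.dependent scale (T ` W_ext n \<Phi> \<alpha>) \<and>
     module.span scale (T ` W_ext n \<Phi> \<alpha>) = UNIV \<and>
     (\<forall>x\<in>W_ext n \<Phi> \<alpha>. \<forall>y\<in>W_ext n \<Phi> \<alpha>.
        len n \<Phi> \<alpha> (x \<odot> y) = len n \<Phi> \<alpha> x + len n \<Phi> \<alpha> y \<longrightarrow> T x * T y = T (x \<odot> y)) \<and>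
     (\<forall>s\<in>S_aff n \<Phi> \<alpha>. T s * T s = 1 + scale (qpow (int (L s)) - qpow (- int (L s))) (T s))"

definition bar_involution :: "('h \<Rightarrow> 'h) \<Rightarrow> bool" where
  "bar_involution br \<longleftrightarrow>
     br 1 = 1 \<and> (\<forall>x y. br (x + y) = br x + br y) \<and> (\<forall>x y. br (x * y) = br x * br y) \<and>
     (\<forall>x. br (br x) = x) \<and>
     (\<forall>a x. br (scale a x) = scale (bar_laurent a) (br x)) \<and>
     (\<forall>w\<in>W_ext n \<Phi> \<alpha>. br (T w) * T (inv w) = 1 \<and> T (inv w) * br (T w) = 1)"

definition neg_span :: "'h set" where
  "neg_span = {\<Sum>y\<in>F. scale (c y) (T y) | F c.
     finite F \<and> F \<subseteq> W_ext n \<Phi> \<alpha> \<and> c ` F \<subseteq> laurent_neg}"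

definition kl_basis :: "('h \<Rightarrow> 'h) \<Rightarrow> (('v \<Rightarrow> 'v) \<Rightarrow> 'h) \<Rightarrow> bool" where
  "kl_basis br C \<longleftrightarrow>
     (\<forall>w\<in>W_ext n \<Phi> \<alpha>. br (C w) = C w \<and> (\<exists>h\<in>neg_span. C w = T w + h))"

text \<open>The sum over \<open>X0\<close> is restricted to its support, which is finite for a family as in
  \<open>relative_kl_family\<close> because Bruhat intervals below an element are finite.\<close>

definition rel_elem :: "(('v \<Rightarrow> 'v) \<Rightarrow> ('v \<Rightarrow> 'v) \<Rightarrow> laurent) \<Rightarrow> ('v \<Rightarrow> 'v) \<Rightarrow> 'h" where
  "rel_elem p x = (\<Sum>x' \<in> {x' \<in> X0 n \<Phi> \<alpha>. p x' x \<noteq> 0}. scale (p x' x) (T x'))"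

definition relative_kl_family ::
    "('h \<Rightarrow> 'h) \<Rightarrow> (('v \<Rightarrow> 'v) \<Rightarrow> 'h) \<Rightarrow> (('v \<Rightarrow> 'v) \<Rightarrow> ('v \<Rightarrow> 'v) \<Rightarrow> laurent) \<Rightarrow> bool" where
  "relative_kl_family br C p \<longleftrightarrow>
     (\<forall>x \<in> X0 n \<Phi> \<alpha>. p x x = 1) \<and>
     (\<forall>x \<in> X0 n \<Phi> \<alpha>. \<forall>x' \<in> X0 n \<Phi> \<alpha>.
        (bruhat_le n \<Phi> \<alpha> x' x \<and> x' \<noteq> x \<longrightarrow> p x' x \<in> laurent_neg) \<and>
        (\<not> bruhat_le n \<Phi> \<alpha> x' x \<longrightarrow> p x' x = 0)) \<and>
     (\<forall>x \<in> X0 n \<Phi> \<alpha>. \<forall>y \<in> inv ` X0 n \<Phi> \<alpha>.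
        br (rel_elem p x * C (longest n \<Phi> \<alpha> \<odot> y)) = rel_elem p x * C (longest n \<Phi> \<alpha> \<odot> y))"

definition P_fund :: "(('v \<Rightarrow> 'v) \<Rightarrow> ('v \<Rightarrow> 'v) \<Rightarrow> laurent) \<Rightarrow> nat \<Rightarrow> 'h" where
  "P_fund p i = rel_elem p (transl (fund_weight n \<alpha> i))"

text \<open>The product of the \<open>P_fund p i\<close> in the order prescribed by the list \<open>r\<close>. For a weight \<open>\<tau>\<close>,
  the element \<open>\<^bold>P(\<tau>)\<close> is \<open>P_word p r\<close> for a fixed \<open>r\<close> with \<open>factor_order n \<alpha> \<tau> r\<close>.\<close>

definition P_word :: "(('v \<Rightarrow> 'v) \<Rightarrow> ('v \<Rightarrow> 'v) \<Rightarrow> laurent) \<Rightarrow> nat list \<Rightarrow> 'h" where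
  "P_word p r = prod_list (map (P_fund p) r)"

end

text \<open>The fundamental weights are linearly independent, so the multiplicities in \<open>r\<close> are determined
  by \<open>\<tau>\<close>, and only the order of the factors is left open.\<close>

definition factor_order :: "nat \<Rightarrow> (nat \<Rightarrow> 'v::euclidean_space) \<Rightarrow> 'v \<Rightarrow> nat list \<Rightarrow> bool" where
  "factor_order n \<alpha> \<tau> r \<longleftrightarrow> set r \<subseteq> {1..n} \<and>
     \<tau> = (\<Sum>i = 1..n. real (count_list r i) *\<^sub>R fund_weight n \<alpha> i)"


section \<open>Paths\<close>

text \<open>A path of type \<open>m = (m\<^sub>1, \<dots>, m\<^sub>N)\<close> is a list \<open>x\<^sub>0, \<dots>, x\<^sub>N\<close> of antidominant weights with
  \<open>x\<^sub>l - x\<^sub>l\<^sub>-\<^sub>1\<close> in the orbit of \<open>\<omega>\<close> with index \<open>m\<^sub>l\<close> (lists count from 0, so \<open>m ! l\<close> is \<open>m\<^sub>l\<^sub>+\<^sub>1\<close>).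

  Pitfall: the source puts \<open>x\<^sub>l\<^sub>-\<^sub>1 - x\<^sub>l\<close> in this orbit. With that sign the path formula is false for
  every \<open>n \<ge> 2\<close>. Take \<open>\<tau> = \<omega>\<^sub>1\<close>. The left side is supported on the \<open>T\<^sub>w\<close> with \<open>w\<close> in the
  \<open>W_aff\<close>-coset of the translation by \<open>\<omega>\<^sub>1\<close>, while the opposite sign makes the right side the
  single element \<open>C\<^sub>w\<close> with \<open>w\<close> the product of \<open>w\<^sub>0\<close> and the translation by \<open>-\<omega>\<^sub>1\<close>, supported on the
  coset of the latter; and \<open>\<omega>\<^sub>1\<close>, \<open>-\<omega>\<^sub>1\<close> are not congruent modulo the root lattice. With the sign
  used here, the right side for \<open>\<tau> = \<omega>\<^sub>i\<close> is \<open>C\<^sub>w\<close> with \<open>w\<close> the product of \<open>w\<^sub>0\<close> and the translation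
  by \<open>w\<^sub>0(\<omega>\<^sub>i)\<close>, which equals the translation by \<open>\<omega>\<^sub>i\<close> times \<open>w\<^sub>0\<close>, as it must be. The two
  conventions differ by the diagram automorphism: the orbit of \<open>\<omega>\<^sub>i\<close> is minus that of \<open>\<omega>\<close> with
  index \<open>n + 1 - i\<close>.\<close>

definition weight_paths ::
    "nat \<Rightarrow> 'v::euclidean_space set \<Rightarrow> (nat \<Rightarrow> 'v) \<Rightarrow> nat list \<Rightarrow> 'v \<Rightarrow> 'v \<Rightarrow> 'v list set" where
  "weight_paths n \<Phi> \<alpha> m x y = {xs. length xs = Suc (length m) \<and>
     xs ! 0 = x \<and> xs ! length m = y \<and> set xs \<subseteq> antidominant_weights n \<Phi> \<alpha> \<and>
     (\<forall>l < length m. xs ! Suc l - xs ! l \<in> weight_orbit n \<alpha> (fund_weight n \<alpha> (m ! l)))}"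

definition path_count ::
    "nat \<Rightarrow> 'v::euclidean_space set \<Rightarrow> (nat \<Rightarrow> 'v) \<Rightarrow> nat list \<Rightarrow> 'v \<Rightarrow> nat" where
  "path_count n \<Phi> \<alpha> m \<nu> = card (weight_paths n \<Phi> \<alpha> m 0 \<nu>)"

end

theory Submission
  imports Defs
begin

text \<open>Write \<open>e\<close> for \<open>C\<close> at the longest element of the finite group, \<open>v\<close> for the parameter and \<open>\<ell>\<close> for the
  length. All pairings of a fundamental weight \<open>\<omega>\<close> with roots are \<open>-1\<close>, \<open>0\<close> or \<open>1\<close>. For \<open>\<mu>\<close> in its orbit let
  \<open>b\<^sub>\<mu>\<close> be the minimal representative of the coset of the translation by \<open>\<mu>\<close>. The sum of the
  \<open>v ^ (\<ell> b\<^sub>\<mu> - \<ell> p\<^sub>\<omega>) e T(b\<^sub>\<mu>)\<close> is proportional to \<open>e T(\<pi>) e\<close>, where \<open>\<pi> = b\<^sub>\<omega>\<close> has length zero; so it is bar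
  invariant and equals \<open>\<^bold>P(\<omega>) e\<close>.

  Because \<open>\<omega>\<close> is minuscule, \<open>b\<^sub>\<mu> y\<close> has length \<open>\<ell> b\<^sub>\<mu> + \<ell> y\<close> for every minimal representative \<open>y\<close>, and
  if \<open>b\<^sub>\<mu> y = w y'\<close> with \<open>w\<close> in the finite group and \<open>y'\<close> minimal, then \<open>\<ell> w + \<ell> b\<^sub>\<mu> \<le> \<ell> p\<^sub>\<omega>\<close>, as one sees
  root by root. Hence \<open>\<^bold>P(\<omega>)\<close> maps \<open>e T(y)\<close> to an element without terms of positive degree, and up
  to terms of negative degree it maps the Kazhdan--Lusztig element attached to an antidominant weight
  \<open>\<nu>\<close> to the sum of the standard basis elements attached to those \<open>\<nu> + \<mu>\<close> for which equality holds,
  which are the antidominant ones. Bar invariance upgrades this congruence to an identity between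
  Kazhdan--Lusztig elements, and iterating it counts paths. Their number does not depend on the order of
  the steps, by the reflection principle.\<close>


section \<open>The root system\<close>

text \<open>Lengths are defined by shortest words, yet words are hardly ever handled. An element is
  represented by the image of one interior point of the fundamental alcove, and its length is
  recovered from the hyperplanes crossed on the way there. Additivity of lengths thereby becomes a
  sign condition at each root, which is what makes the estimates for minuscule weights local. The
  bar involution is treated as triangular with respect to the length; the Bruhat order enters only
  through the support of the relative family, which it makes finite.

  The element attached to a fundamental weight is never computed by itself. The Kazhdan--Lusztig
  elements in question are left eigenvectors of the finite generators and hence lie in the right
  ideal generated by \<open>e\<close>, so the product with \<open>e\<close> determines the action on
  all of them.

  The obstacle in the last step is that permuting the steps of a path may push it out of the
  antidominant cone, so permutations do not act on paths directly. Alternating functions remove the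
  boundary, after which the steps commute.\<close>

lemma pairing_add: "pairing (x + y) a = pairing x a + pairing y a"
  by (simp add: pairing_def inner_add_left add_divide_distrib distrib_left)

lemma pairing_scaleR: "pairing (c *\<^sub>R x) a = c * pairing x a"
  by (simp add: pairing_def)

locale type_A =
  fixes n :: nat and \<Phi> :: "'v::euclidean_space set" and \<alpha> :: "nat \<Rightarrow> 'v"
  assumes type_A: "type_A_roots n \<Phi> \<alpha>"
begin

lemma n_pos: "n \<ge> 1"
  using type_A DIM_positive[where 'a='v] unfolding type_A_roots_def by simp

lemma root_system: "root_system \<Phi>" and simple_roots: "simple_roots n \<Phi> \<alpha>"
  and dim_eq: "DIM('v) = n"
  using type_A unfolding type_A_roots_def by auto

lemma finite_roots: "finite \<Phi>"
  using root_system unfolding root_system_def by auto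

lemma zero_not_root: "0 \<notin> \<Phi>"
  using root_system unfolding root_system_def by auto

lemma simple_in: "i \<in> {1..n} \<Longrightarrow> \<alpha> i \<in> \<Phi>"
  using simple_roots unfolding simple_roots_def by auto

lemma cartan: "i \<in> {1..n} \<Longrightarrow> j \<in> {1..n} \<Longrightarrow> pairing (\<alpha> i) (\<alpha> j) =
    (if i = j then 2 else if i = Suc j \<or> j = Suc i then -1 else 0)"
  using type_A unfolding type_A_roots_def by auto

lemma simple_norm_pos: "i \<in> {1..n} \<Longrightarrow> \<alpha> i \<bullet> \<alpha> i > 0"
  using simple_in zero_not_root by (metis inner_gt_zero_iff)

text \<open>Neighbours in the diagram have Cartan integer -1 in both directions, hence equal norms,
  and the diagram is connected. So one bilinear form can serve for all roots.\<close>

lemma simple_norm: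
  assumes "i \<in> {1..n}" shows "\<alpha> i \<bullet> \<alpha> i = \<alpha> 1 \<bullet> \<alpha> 1"
proof -
  have "1 \<le> i" using assms by simp
  then have "i \<le> n \<longrightarrow> \<alpha> i \<bullet> \<alpha> i = \<alpha> 1 \<bullet> \<alpha> 1"
  proof (induction i rule: dec_induct)
    case (step i)
    show ?case
    proof
      assume le: "Suc i \<le> n"
      then have i: "i \<in> {1..n}" "Suc i \<in> {1..n}" using step by auto
      have "pairing (\<alpha> i) (\<alpha> (Suc i)) = -1" "pairing (\<alpha> (Suc i)) (\<alpha> i) = -1"
        using cartan[OF i] cartan[OF i(2,1)] by auto
      then have "2 * (\<alpha> i \<bullet> \<alpha> (Suc i)) = - (\<alpha> (Suc i) \<bullet> \<alpha> (Suc i))"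
        "2 * (\<alpha> i \<bullet> \<alpha> (Suc i)) = - (\<alpha> i \<bullet> \<alpha> i)"
        using simple_norm_pos[OF i(1)] simple_norm_pos[OF i(2)]
        by (auto simp: pairing_def field_simps inner_commute)
      then show "\<alpha> (Suc i) \<bullet> \<alpha> (Suc i) = \<alpha> 1 \<bullet> \<alpha> 1" using step le by auto
    qed
  qed auto
  then show ?thesis using assms by simp
qed

text \<open>Normalised so that every root has square 2 (\<open>pr_root_self\<close>). It agrees with
  \<open>pairing\<close> on roots, but is symmetric and linear in both arguments.\<close>

definition pr :: "'v \<Rightarrow> 'v \<Rightarrow> real" where
  "pr x y = 2 * (x \<bullet> y) / (\<alpha> 1 \<bullet> \<alpha> 1)"

lemma norm1: "\<alpha> 1 \<bullet> \<alpha> 1 > 0"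
  using simple_norm_pos[of 1] n_pos by simp

lemma pr_simps [simp]:
  "pr (x + y) z = pr x z + pr y z" "pr x (y + z) = pr x y + pr x z"
  "pr (x - y) z = pr x z - pr y z" "pr x (y - z) = pr x y - pr x z"
  "pr (- x) z = - pr x z" "pr x (- z) = - pr x z"
  "pr (c *\<^sub>R x) z = c * pr x z" "pr x (c *\<^sub>R z) = c * pr x z"
  "pr 0 z = 0" "pr x 0 = 0"
  by (simp_all add: pr_def inner_add_left inner_add_right inner_diff_left inner_diff_right
      add_divide_distrib diff_divide_distrib distrib_left right_diff_distrib)

lemma pr_sum: "pr (\<Sum>i\<in>A. f i) z = (\<Sum>i\<in>A. pr (f i) z)" "pr z (\<Sum>i\<in>A. f i) = (\<Sum>i\<in>A. pr z (f i))"
  by (induction A rule: infinite_finite_induct) auto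

lemma pr_commute: "pr x y = pr y x"
  by (simp add: pr_def inner_commute)

lemma pr_self_pos: "x \<noteq> 0 \<Longrightarrow> pr x x > 0"
  using norm1 by (simp add: pr_def)

lemma pairing_simple: "i \<in> {1..n} \<Longrightarrow> pairing x (\<alpha> i) = pr x (\<alpha> i)"
  using simple_norm[of i] by (simp add: pairing_def pr_def)

lemma pr_simple: "i \<in> {1..n} \<Longrightarrow> j \<in> {1..n} \<Longrightarrow> pr (\<alpha> i) (\<alpha> j) =
    (if i = j then 2 else if i = Suc j \<or> j = Suc i then -1 else 0)"
  using cartan pairing_simple by metis

lemma independent_simple: "independent (\<alpha> ` {1..n})" and inj_simple: "inj_on \<alpha> {1..n}"
  using simple_roots unfolding simple_roots_def by auto

lemma span_simple: "span (\<alpha> ` {1..n}) = UNIV"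
proof -
  have "card (\<alpha> ` {1..n}) = DIM('v)" using inj_simple dim_eq by (simp add: card_image)
  then have "UNIV \<subseteq> span (\<alpha> ` {1..n})" using independent_simple
    by (intro card_ge_dim_independent) auto
  then show ?thesis by blast
qed

lemma pr_eqI:
  assumes "\<And>j. j \<in> {1..n} \<Longrightarrow> pr x (\<alpha> j) = pr y (\<alpha> j)" shows "x = y"
proof -
  have "pr (x - y) z = 0" for z
  proof -
    have "z \<in> span (\<alpha> ` {1..n})" using span_simple by simp
    then show ?thesis
    proof (induction rule: span_induct_alt)
      case (step c u v)
      then obtain j where "j \<in> {1..n}" "u = \<alpha> j" by blast
      then show ?case using assms[of j] step by simp
    qed simp
  qed
  then have "\<not> pr (x - y) (x - y) > 0" by (simp only: less_irrefl not_False_eq_True)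
  then show ?thesis using pr_self_pos[of "x - y"] by (metis eq_iff_diff_eq_0)
qed

lemma exists_coweight: "\<exists>x. \<forall>j\<in>{1..n}. pr x (\<alpha> j) = f j"
proof -
  obtain g :: "'v \<Rightarrow> real" where g: "linear g" "\<forall>x \<in> \<alpha> ` {1..n}. g x = f (the_inv_into {1..n} \<alpha> x)"
    using linear_independent_extend[OF independent_simple, of "\<lambda>x. f (the_inv_into {1..n} \<alpha> x)"] by auto
  \<comment> \<open>The vector that represents the functional \<open>g\<close> under the inner
    product; the factor undoes the normalisation of \<open>pr\<close>.\<close>
  define x where "x = ((\<alpha> 1 \<bullet> \<alpha> 1) / 2) *\<^sub>R adjoint g 1"
  have "pr x (\<alpha> j) = f j" if "j \<in> {1..n}" for j
  proof -
    have "\<alpha> j \<bullet> adjoint g 1 = g (\<alpha> j)" using adjoint_works[OF g(1), of "\<alpha> j" 1] by simp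
    moreover have "g (\<alpha> j) = f j" using g(2) that inj_simple by (simp add: the_inv_into_f_f)
    ultimately show ?thesis using norm1 by (simp add: x_def pr_def inner_commute)
  qed
  then show ?thesis by blast
qed

lemma pr_fund_weight: "j \<in> {1..n} \<Longrightarrow> pr (fund_weight n \<alpha> i) (\<alpha> j) = (if i = j then 1 else 0)"
proof -
  let ?P = "\<lambda>x. \<forall>j\<in>{1..n}. pairing x (\<alpha> j) = (if i = j then 1 else 0)"
  obtain x where "\<forall>j\<in>{1..n}. pr x (\<alpha> j) = (if i = j then 1 else 0)"
    using exists_coweight[of "\<lambda>j. if i = j then 1 else 0"] by auto
  then have "?P x" using pairing_simple by simp
  moreover have "y = x" if "?P y" for y
  proof (rule pr_eqI)
    fix j assume j: "j \<in> {1..n}"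
    then have "pairing y (\<alpha> j) = pairing x (\<alpha> j)" using that \<open>?P x\<close> by simp
    then show "pr y (\<alpha> j) = pr x (\<alpha> j)" by (simp only: pairing_simple[OF j])
  qed
  ultimately have "?P (fund_weight n \<alpha> i)"
    unfolding fund_weight_def by (rule theI)
  then show "j \<in> {1..n} \<Longrightarrow> pr (fund_weight n \<alpha> i) (\<alpha> j) = (if i = j then 1 else 0)"
    using pairing_simple by simp
qed

text \<open>Half the sum of the positive roots. Pairing with it is the height, and positivity of a
  root is used below in the form \<open>pr \<rho> a > 0\<close>; \<open>pos_root_iff\<close>
  reconciles this with the definition by coefficients.\<close>

definition \<rho> :: 'v where "\<rho> = (\<Sum>i = 1..n. fund_weight n \<alpha> i)"

lemma pr_rho: "j \<in> {1..n} \<Longrightarrow> pr \<rho> (\<alpha> j) = 1"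
  by (simp add: \<rho>_def pr_sum pr_fund_weight)

text \<open>The weights of the standard representation of the special linear group.\<close>

definition eps :: "nat \<Rightarrow> 'v" where
  "eps j = fund_weight n \<alpha> 1 - (\<Sum>k = 1..<j. \<alpha> k)"

lemma eps_Suc: "j \<ge> 1 \<Longrightarrow> eps (Suc j) = eps j - \<alpha> j"
  by (simp add: eps_def)

lemma pr_eps_simple:
  assumes "j \<in> {1..Suc n}" "k \<in> {1..n}"
  shows "pr (eps j) (\<alpha> k) = (if j = k then 1 else if j = Suc k then -1 else 0)"
proof -
  have "1 \<le> j" using assms by simp
  then have "j \<le> Suc n \<longrightarrow> ?thesis"
  proof (induction j rule: dec_induct)
    case base
    then show ?case using assms(2) by (auto simp: eps_def pr_fund_weight)
  next
    case (step j)
    then show ?case using assms(2) by (auto simp: eps_Suc pr_simple)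
  qed
  then show ?thesis using assms by simp
qed

lemma simple_eps: "k \<ge> 1 \<Longrightarrow> \<alpha> k = eps k - eps (Suc k)"
  by (simp add: eps_Suc)

lemma refl_simple: "k \<in> {1..n} \<Longrightarrow> refl_in (\<alpha> k) 0 x = x - pr x (\<alpha> k) *\<^sub>R \<alpha> k"
  by (simp add: refl_in_def pairing_simple)

lemma refl_eps:
  assumes "j \<in> {1..Suc n}" "k \<in> {1..n}"
  shows "refl_in (\<alpha> k) 0 (eps j) = eps (if j = k then Suc k else if j = Suc k then k else j)"
  using assms by (auto simp: refl_simple pr_eps_simple eps_Suc)

lemma refl_linear: "linear (refl_in (a::'v) 0)"
  by (rule linearI) (auto simp: refl_in_def pairing_add pairing_scaleR algebra_simps)

lemma refl_root: "a \<in> \<Phi> \<Longrightarrow> b \<in> \<Phi> \<Longrightarrow> refl_in a 0 b \<in> \<Phi>"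
  using root_system unfolding root_system_def by auto

lemma minus_root: "a \<in> \<Phi> \<Longrightarrow> - a \<in> \<Phi>"
proof -
  assume a: "a \<in> \<Phi>"
  then have "pairing a a = 2" using zero_not_root by (auto simp: pairing_def)
  then have "refl_in a 0 a = - a" by (simp add: refl_in_def scaleR_2)
  then show ?thesis using refl_root[OF a a] by simp
qed

definition eps_roots :: "'v set" where
  "eps_roots = {eps i - eps j | i j. i \<in> {1..Suc n} \<and> j \<in> {1..Suc n} \<and> i \<noteq> j}"

lemma eps_rootsI: "i \<in> {1..Suc n} \<Longrightarrow> j \<in> {1..Suc n} \<Longrightarrow> i \<noteq> j \<Longrightarrow> eps i - eps j \<in> eps_roots"
  unfolding eps_roots_def by blast

lemma refl_eps_roots:
  assumes "b \<in> eps_roots" "k \<in> {1..n}" shows "refl_in (\<alpha> k) 0 b \<in> eps_roots"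
proof -
  obtain i j where b: "b = eps i - eps j" "i \<in> {1..Suc n}" "j \<in> {1..Suc n}" "i \<noteq> j"
    using assms(1) unfolding eps_roots_def by blast
  have "refl_in (\<alpha> k) 0 b = refl_in (\<alpha> k) 0 (eps i) - refl_in (\<alpha> k) 0 (eps j)"
    using b linear_diff[OF refl_linear] by simp
  also have "\<dots> = eps (if i = k then Suc k else if i = Suc k then k else i)
      - eps (if j = k then Suc k else if j = Suc k then k else j)"
    using refl_eps b assms(2) by presburger
  also have "\<dots> \<in> eps_roots" using b assms(2) by (intro eps_rootsI) auto
  finally show ?thesis .
qed

lemma uminus_eps_roots: "b \<in> eps_roots \<Longrightarrow> - b \<in> eps_roots"
  unfolding eps_roots_def by force

lemma eps_diff_sum:
  assumes "1 \<le> i" "i \<le> j" shows "eps i - eps j = (\<Sum>k = i..<j. \<alpha> k)"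
  using assms(2,1) by (induction j rule: dec_induct) (auto simp: eps_Suc)

lemma eps_roots_pos: 
  assumes "1 \<le> i" "i < j" "j \<le> Suc n" shows "eps i - eps j \<in> \<Phi>"
proof -
  have "Suc i \<le> j" using assms by simp
  then have "j \<le> Suc n \<longrightarrow> eps i - eps j \<in> \<Phi>"
  proof (induction j rule: dec_induct)
    case base
    then show ?case using simple_in[of i] assms(1) by (simp add: simple_eps)
  next
    case (step j)
    show ?case
    proof
      assume "Suc j \<le> Suc n"
      then have *: "eps i - eps j \<in> \<Phi>" "j \<in> {1..n}" using step by auto
      have "refl_in (\<alpha> j) 0 (eps i - eps j) = eps i - eps (Suc j)"
        using step * assms(1) refl_eps[of i j] refl_eps[of j j] linear_diff[OF refl_linear] by auto
      then show "eps i - eps (Suc j) \<in> \<Phi>" using refl_root[OF simple_in[OF *(2)] *(1)] by simp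
    qed
  qed
  then show ?thesis using assms by simp
qed

lemma eps_roots_subset: "eps_roots \<subseteq> \<Phi>"
proof
  fix b assume "b \<in> eps_roots"
  then obtain i j where b: "b = eps i - eps j" "i \<in> {1..Suc n}" "j \<in> {1..Suc n}" "i \<noteq> j"
    unfolding eps_roots_def by blast
  show "b \<in> \<Phi>"
  proof (cases "i < j")
    case True then show ?thesis using b eps_roots_pos[of i j] by auto
  next
    case False
    then have "eps j - eps i \<in> \<Phi>" using b eps_roots_pos[of j i] by auto
    then show ?thesis using minus_root[of "eps j - eps i"] b by simp
  qed
qed

text \<open>Descent on the height: a positive root that is not simple is lowered by some simple reflection.\<close>

lemma pos_roots_subset_eps:
  assumes "b \<in> pos_roots n \<Phi> \<alpha>" shows "b \<in> eps_roots"
proof -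
  have "\<forall>b. b \<in> pos_roots n \<Phi> \<alpha> \<longrightarrow> nat \<lfloor>pr \<rho> b\<rfloor> = N \<longrightarrow> b \<in> eps_roots" for N
  proof (induction N rule: less_induct)
    case (less N)
    show ?case
    proof (intro allI impI)
      fix b assume b: "b \<in> pos_roots n \<Phi> \<alpha>" and N: "nat \<lfloor>pr \<rho> b\<rfloor> = N"
      then obtain c :: "nat \<Rightarrow> nat" where c: "b = (\<Sum>i = 1..n. real (c i) *\<^sub>R \<alpha> i)" and b\<Phi>: "b \<in> \<Phi>"
        unfolding pos_roots_def by blast
      have ht: "pr \<rho> b = real (\<Sum>i = 1..n. c i)" unfolding c by (simp add: pr_sum pr_rho)
      \<comment> \<open>Positivity of the form forces some simple root to occur in \<open>b\<close>
        and to pair positively with it, so that reflecting in it lowers the height.\<close>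
      have "0 < pr b b" using b\<Phi> zero_not_root pr_self_pos by metis
      also have "pr b b = (\<Sum>i = 1..n. real (c i) * pr b (\<alpha> i))"
        by (subst (2) c) (simp add: pr_sum)
      finally have "\<exists>k\<in>{1..n}. 0 < real (c k) * pr b (\<alpha> k)"
        by (meson not_le sum_nonpos)
      then obtain k where k: "k \<in> {1..n}" "0 < real (c k) * pr b (\<alpha> k)" by blast
      then have prk: "pr b (\<alpha> k) > 0" by (simp add: zero_less_mult_iff)
      show "b \<in> eps_roots"
      proof (cases "b = \<alpha> k")
        case True
        then show ?thesis using k(1) eps_rootsI[of k "Suc k"] by (simp add: simple_eps)
      next
        case False
        define b' where "b' = refl_in (\<alpha> k) 0 b"
        have b': "b' \<in> \<Phi>" unfolding b'_def by (rule refl_root[OF simple_in[OF k(1)] b\<Phi>])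
        have b'_eq: "b' = b - pr b (\<alpha> k) *\<^sub>R \<alpha> k" using refl_simple[OF k(1)] by (simp add: b'_def)
        have invol: "refl_in (\<alpha> k) 0 b' = b"
          using refl_simple[OF k(1)] b'_eq k(1) by (simp add: pr_simple)
        \<comment> \<open>The reflection changes only the coefficient of \<open>\<alpha> k\<close>.
          If \<open>b'\<close> were negative, all other coefficients of \<open>b\<close> would
          vanish, and a root that is a multiple of a simple root equals it up to sign.\<close>
        have "- b' \<notin> pos_roots n \<Phi> \<alpha>"
        proof
          assume "- b' \<in> pos_roots n \<Phi> \<alpha>"
          then obtain d :: "nat \<Rightarrow> nat" where d: "- b' = (\<Sum>i = 1..n. real (d i) *\<^sub>R \<alpha> i)"
            unfolding pos_roots_def by blast
          have "c j = 0" if j: "j \<in> {1..n}" "j \<noteq> k" for j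
          proof -
            have coeff: "pr (fund_weight n \<alpha> j) (\<Sum>i = 1..n. real (f i) *\<^sub>R \<alpha> i) = f j" for f :: "nat \<Rightarrow> nat"
              using j by (simp add: pr_sum pr_fund_weight if_distrib cong: if_cong)
            have "real (c j) + real (d j) = pr (fund_weight n \<alpha> j) b + pr (fund_weight n \<alpha> j) (- b')"
              unfolding d using coeff[of c] coeff[of d] c by simp
            also have "\<dots> = 0" unfolding b'_eq using j k(1) by (simp add: pr_fund_weight)
            finally show "c j = 0" by simp
          qed
          then have "b = (\<Sum>i\<in>{k}. real (c i) *\<^sub>R \<alpha> i)"
            unfolding c using k(1) by (intro sum.mono_neutral_right) auto
          then have bk: "b = real (c k) *\<^sub>R \<alpha> k" by simp
          then have "real (c k) = 1 \<or> real (c k) = -1"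
            using root_system b\<Phi> simple_in[OF k(1)] unfolding root_system_def by blast
          then show False using bk False by auto
        qed
        then have pos': "b' \<in> pos_roots n \<Phi> \<alpha>"
          using simple_roots b' unfolding simple_roots_def by blast
        then obtain c' :: "nat \<Rightarrow> nat" where c': "b' = (\<Sum>i = 1..n. real (c' i) *\<^sub>R \<alpha> i)"
          unfolding pos_roots_def by blast
        have ht': "pr \<rho> b' = real (\<Sum>i = 1..n. c' i)" unfolding c' by (simp add: pr_sum pr_rho)
        have "pr \<rho> b' < pr \<rho> b" unfolding b'_eq using prk k(1) by (simp add: pr_rho)
        then have "nat \<lfloor>pr \<rho> b'\<rfloor> < N" using N ht ht' by (metis floor_of_nat nat_int of_nat_less_iff)
        then have "b' \<in> eps_roots" using less pos' by blast
        then show ?thesis using refl_eps_roots[OF _ k(1)] invol by metis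
      qed
    qed
  qed
  then show ?thesis using assms by blast
qed

lemma roots_eq: "\<Phi> = eps_roots"
proof
  show "\<Phi> \<subseteq> eps_roots"
  proof
    fix b assume "b \<in> \<Phi>"
    then have "b \<in> pos_roots n \<Phi> \<alpha> \<or> - b \<in> pos_roots n \<Phi> \<alpha>"
      using simple_roots unfolding simple_roots_def by blast
    then show "b \<in> eps_roots"
      using pos_roots_subset_eps uminus_eps_roots by fastforce
  qed
qed (rule eps_roots_subset)

lemma root_cases:
  assumes "a \<in> \<Phi>"
  obtains i j where "i \<in> {1..Suc n}" "j \<in> {1..Suc n}" "i \<noteq> j" "a = eps i - eps j"
  using assms roots_eq unfolding eps_roots_def by blast

lemma eps_diff_root: "i \<in> {1..Suc n} \<Longrightarrow> j \<in> {1..Suc n} \<Longrightarrow> i \<noteq> j \<Longrightarrow> eps i - eps j \<in> \<Phi>"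
  using roots_eq unfolding eps_roots_def by blast

lemma pr_rho_eps: "j \<ge> 1 \<Longrightarrow> j \<le> Suc n \<Longrightarrow> pr \<rho> (eps j) = pr \<rho> (eps 1) - real j + 1"
  by (induction j rule: dec_induct) (auto simp: eps_Suc pr_rho)

lemma pr_rho_eps_diff:
  "i \<in> {1..Suc n} \<Longrightarrow> j \<in> {1..Suc n} \<Longrightarrow> pr \<rho> (eps i - eps j) = real j - real i"
  using pr_rho_eps[of i] pr_rho_eps[of j] by simp

text \<open>The \<open>eps\<close> behave like an orthonormal basis projected along the sum of its
  vectors, so their products carry a common offset. It is left unevaluated, because it cancels in
  the differences \<open>pr_eps_diff\<close>.\<close>

lemma pr_eps_eps:
  assumes "i \<in> {1..Suc n}" "j \<in> {1..Suc n}"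
  shows "pr (eps i) (eps j) = pr (eps i) (eps 1) - (if i = 1 then 1 else 0) + (if i = j then 1 else 0)"
proof -
  have "1 \<le> j" using assms by simp
  then have "j \<le> Suc n \<longrightarrow> ?thesis"
  proof (induction j rule: dec_induct)
    case (step j)
    then show ?case using assms(1) by (auto simp: eps_Suc pr_eps_simple)
  qed auto
  then show ?thesis using assms by simp
qed

lemma pr_eps_diff:
  assumes "i \<in> {1..Suc n}" "j \<in> {1..Suc n}" "k \<in> {1..Suc n}"
  shows "pr (eps i) (eps j - eps k) = (if i = j then 1 else 0) - (if i = k then 1 else 0)"
  using pr_eps_eps[OF assms(1,2)] pr_eps_eps[OF assms(1,3)] by simp

lemma pr_root_self: "a \<in> \<Phi> \<Longrightarrow> pr a a = 2"
proof (elim root_cases)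
  fix i j assume *: "i \<in> {1..Suc n}" "j \<in> {1..Suc n}" "i \<noteq> j" "a = eps i - eps j"
  have "pr a a = pr (eps i) (eps i - eps j) - pr (eps j) (eps i - eps j)" using * by simp
  also have "\<dots> = 2" using pr_eps_diff * by auto
  finally show ?thesis .
qed

lemma pairing_root: "a \<in> \<Phi> \<Longrightarrow> pairing x a = pr x a"
  using pr_root_self[of a] by (auto simp: pairing_def pr_def divide_simps split: if_splits)

lemma pr_root_root_int: "a \<in> \<Phi> \<Longrightarrow> b \<in> \<Phi> \<Longrightarrow> pr a b \<in> \<int>"
  using root_system pairing_root unfolding root_system_def by metis

lemma root_height_nonzero: "a \<in> \<Phi> \<Longrightarrow> pr \<rho> a \<noteq> 0"
proof (elim root_cases)
  fix i j assume "i \<in> {1..Suc n}" "j \<in> {1..Suc n}" "i \<noteq> j" "a = eps i - eps j"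
  then show ?thesis using pr_rho_eps_diff[of i j] by simp
qed

lemma pos_root_height: 
  assumes "a \<in> pos_roots n \<Phi> \<alpha>" shows "a \<in> \<Phi>" "pr \<rho> a > 0"
proof -
  obtain c :: "nat \<Rightarrow> nat" where c: "a = (\<Sum>i = 1..n. real (c i) *\<^sub>R \<alpha> i)" and a\<Phi>: "a \<in> \<Phi>"
    using assms unfolding pos_roots_def by blast
  have "pr \<rho> a = real (\<Sum>i = 1..n. c i)" unfolding c by (simp add: pr_sum pr_rho)
  then have "pr \<rho> a \<ge> 0" by linarith
  then show "pr \<rho> a > 0" using root_height_nonzero[OF a\<Phi>] by simp
  show "a \<in> \<Phi>" by fact
qed

lemma pos_root_iff: "a \<in> pos_roots n \<Phi> \<alpha> \<longleftrightarrow> a \<in> \<Phi> \<and> pr \<rho> a > 0"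
proof
  assume a: "a \<in> \<Phi> \<and> pr \<rho> a > 0"
  then have "a \<in> pos_roots n \<Phi> \<alpha> \<or> - a \<in> pos_roots n \<Phi> \<alpha>"
    using simple_roots unfolding simple_roots_def by blast
  moreover have "- a \<notin> pos_roots n \<Phi> \<alpha>" using pos_root_height(2)[of "- a"] a by auto
  ultimately show "a \<in> pos_roots n \<Phi> \<alpha>" by blast
qed (use pos_root_height in blast)

end


section \<open>Weyl groups\<close>

text \<open>As rewrite rules these two, being eta-contracted, would unfold \<open>\<odot>\<close> and \<open>id\<close> even where they are not applied.\<close>

declare fcomp_apply [simp del] id_apply [simp del]

lemma word_prod_simps: "word_prod [] = id" "word_prod (s # ss) = s \<odot> word_prod ss"
  by (simp_all add: word_prod_def id_apply)

lemma word_prod_append: "word_prod (xs @ ys) = word_prod xs \<odot> word_prod ys"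
proof (induction xs)
  case (Cons s xs)
  then show ?case by (simp only: append_Cons word_prod_simps fcomp_assoc)
qed (simp add: word_prod_simps)

lemma generated_id: "id \<in> generated R"
  unfolding generated_def by (rule CollectI, rule exI[of _ "[]"]) (simp add: word_prod_simps)

lemma generated_base: "r \<in> R \<Longrightarrow> r \<in> generated R"
  unfolding generated_def by (rule CollectI, rule exI[of _ "[r]"]) (simp add: word_prod_simps)

lemma generated_fcomp: "g \<in> generated R \<Longrightarrow> h \<in> generated R \<Longrightarrow> g \<odot> h \<in> generated R"
  unfolding generated_def using word_prod_append
  by (smt (verit, ccfv_threshold) Un_least mem_Collect_eq set_append)

lemma generated_induct [consumes 1, case_names id step]:
  assumes "g \<in> generated R" "P id" "\<And>r h. r \<in> R \<Longrightarrow> h \<in> generated R \<Longrightarrow> P h \<Longrightarrow> P (r \<odot> h)"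
  shows "P g"
proof -
  have "set ss \<subseteq> R \<Longrightarrow> P (word_prod ss)" for ss
  proof (induction ss)
    case (Cons r ss)
    then have "word_prod ss \<in> generated R" unfolding generated_def by auto
    then show ?case using Cons assms(3)[of r "word_prod ss"] by (simp add: word_prod_simps)
  qed (simp add: assms(2) word_prod_simps)
  then show ?thesis using assms(1) unfolding generated_def by blast
qed

lemma generated_inv:
  assumes "g \<in> generated R" "\<And>r. r \<in> R \<Longrightarrow> r \<odot> r = id"
  shows "bij g \<and> inv g \<in> generated R"
  using assms(1)
proof (induction rule: generated_induct)
  case (step r h)
  have r: "r (r x) = x" for x using fun_cong[OF assms(2)[OF step(1)], of x] by (simp add: fcomp_apply id_apply)
  then have br: "bij r" and ir: "inv r = r" by (auto intro: involuntory_imp_bij inv_equality)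
  have comp: "r \<odot> h = h \<circ> r" by (simp add: fcomp_def comp_def)
  have bij: "bij (r \<odot> h)" unfolding comp using step(3) br by (blast intro: bij_comp)
  have "inv h (h x) = x" "h (inv h x) = x" for x
    using step(3) by (simp_all add: bij_is_inj bij_is_surj surj_f_inv_f)
  then have "inv (r \<odot> h) = inv h \<odot> r" using r by (intro inv_equality) (simp_all add: fcomp_apply)
  then show ?case using bij step generated_fcomp[OF _ generated_base] by metis
qed (auto simp: generated_id)

lemma transl_apply [simp]: "transl \<mu> x = x + \<mu>"
  by (simp add: transl_def)

lemma transl_0: "transl 0 = id"
  by (simp add: fun_eq_iff id_apply)

context type_A begin

abbreviation "W0 \<equiv> W_fin n \<alpha>"
abbreviation "WE \<equiv> W_ext n \<Phi> \<alpha>"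
abbreviation "P \<equiv> weights \<Phi>"

lemma refl_pr: "a \<in> \<Phi> \<Longrightarrow> refl_in a k x = x - (pr x a - of_int k) *\<^sub>R a"
  by (simp add: refl_in_def pairing_root)

lemma refl_refl: "a \<in> \<Phi> \<Longrightarrow> refl_in a k (refl_in a k x) = x"
  by (simp add: refl_pr pr_root_self algebra_simps scaleR_2)

lemma refl_fcomp_refl: "a \<in> \<Phi> \<Longrightarrow> refl_in a k \<odot> refl_in a k = id"
  by (simp add: fun_eq_iff fcomp_apply id_apply refl_refl)

lemma W0_induct [consumes 1, case_names id step]:
  assumes "w \<in> W0" "Q id"
    "\<And>i h. i \<in> {1..n} \<Longrightarrow> h \<in> W0 \<Longrightarrow> Q h \<Longrightarrow> Q (refl_in (\<alpha> i) 0 \<odot> h)"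
  shows "Q w"
  using assms(1) unfolding W_fin_def
proof (induction rule: generated_induct)
  case (step r h)
  then show ?case using assms(3) unfolding W_fin_def by blast
qed (rule assms(2))

lemma W0_id: "id \<in> W0" unfolding W_fin_def by (rule generated_id)

lemma W0_refl: "i \<in> {1..n} \<Longrightarrow> refl_in (\<alpha> i) 0 \<in> W0"
  unfolding W_fin_def by (rule generated_base) auto

lemma W0_fcomp: "v \<in> W0 \<Longrightarrow> w \<in> W0 \<Longrightarrow> v \<odot> w \<in> W0"
  unfolding W_fin_def by (rule generated_fcomp)

lemma W0_inv: "w \<in> W0 \<Longrightarrow> inv w \<in> W0" and W0_bij: "w \<in> W0 \<Longrightarrow> bij w"
  using generated_inv[of w "{refl_in (\<alpha> i) 0 |i. i \<in> {1..n}}"] refl_fcomp_refl[OF simple_in]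
  unfolding W_fin_def by auto

lemma W0_linear: "w \<in> W0 \<Longrightarrow> linear w"
proof (induction rule: W0_induct)
  case (step i h)
  then show ?case using linear_compose[OF refl_linear, of h "\<alpha> i"] by (simp add: comp_def fcomp_def)
qed (simp add: id_def linear_ident)

lemma pr_refl: "a \<in> \<Phi> \<Longrightarrow> pr (refl_in a 0 x) (refl_in a 0 y) = pr x y"
  by (simp add: refl_pr pr_root_self pr_commute[of a y] algebra_simps)

lemma W0_pr: "w \<in> W0 \<Longrightarrow> pr (w x) (w y) = pr x y"
proof (induction arbitrary: x y rule: W0_induct)
  case (step i h)
  then show ?case using pr_refl[OF simple_in] by (simp add: fcomp_apply)
qed (simp add: id_apply)

lemma W0_root: "w \<in> W0 \<Longrightarrow> a \<in> \<Phi> \<Longrightarrow> w a \<in> \<Phi>"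
proof (induction arbitrary: a rule: W0_induct)
  case (step i h)
  then show ?case using refl_root[OF simple_in] by (simp add: fcomp_apply)
qed (simp add: id_apply)

lemma W0_inv_simps [simp]: "w \<in> W0 \<Longrightarrow> w (inv w x) = x" "w \<in> W0 \<Longrightarrow> inv w (w x) = x"
  using W0_bij by (simp_all add: bij_is_surj surj_f_inv_f bij_is_inj inv_f_f)

lemma W0_linear_simps:
  assumes "w \<in> W0"
  shows "w (x + y) = w x + w y" "w (x - y) = w x - w y" "w (- x) = - w x" "w 0 = 0"
    "w (c *\<^sub>R x) = c *\<^sub>R w x"
  using W0_linear[OF assms] by (simp_all add: linear_add linear_diff linear_neg linear_0 linear_cmul)

lemma W0_pr_inv: "w \<in> W0 \<Longrightarrow> pr (w x) y = pr x (inv w y)"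
  using W0_pr[of w x "inv w y"] by simp

lemma W0_bij_roots: assumes "w \<in> W0" shows "bij_betw w \<Phi> \<Phi>"
  by (rule bij_betw_byWitness[where f' = "inv w"])
    (use assms W0_root W0_inv in \<open>auto\<close>)

lemma sum_W0: "w \<in> W0 \<Longrightarrow> (\<Sum>a\<in>\<Phi>. f (w a)) = (\<Sum>a\<in>\<Phi>. f a)"
  by (rule sum.reindex_bij_betw[OF W0_bij_roots])

lemma weights_pr: "\<mu> \<in> P \<longleftrightarrow> (\<forall>a\<in>\<Phi>. pr \<mu> a \<in> \<int>)"
  by (simp add: weights_def pairing_root)

lemma weights_add: "\<mu> \<in> P \<Longrightarrow> \<nu> \<in> P \<Longrightarrow> \<mu> + \<nu> \<in> P"
  and weights_diff: "\<mu> \<in> P \<Longrightarrow> \<nu> \<in> P \<Longrightarrow> \<mu> - \<nu> \<in> P"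
  and weights_minus: "\<mu> \<in> P \<Longrightarrow> - \<mu> \<in> P" and weights_0: "0 \<in> P"
  by (auto simp: weights_pr)

lemma weights_W0: "\<mu> \<in> P \<Longrightarrow> w \<in> W0 \<Longrightarrow> w \<mu> \<in> P"
  using W0_pr_inv W0_root[OF W0_inv] by (simp add: weights_pr)

lemma root_weight: "a \<in> \<Phi> \<Longrightarrow> a \<in> P"
  by (simp add: weights_pr pr_root_root_int)

text \<open>For \<open>g\<close> in the extended group, \<open>lin g\<close> is its component in the
  finite group and \<open>g 0\<close> its translation part.\<close>

definition lin :: "('v \<Rightarrow> 'v) \<Rightarrow> 'v \<Rightarrow> 'v" where "lin g x = g x - g 0"

lemma WE_E:
  assumes "g \<in> WE"
  shows "lin g \<in> W0" "g 0 \<in> P" "g x = lin g x + g 0"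
proof -
  obtain w \<mu> where g: "g = w \<odot> transl \<mu>" "w \<in> W0" "\<mu> \<in> P"
    using assms unfolding W_ext_def by blast
  then have "lin g = w" by (simp add: lin_def fun_eq_iff fcomp_apply id_apply W0_linear_simps)
  then show "lin g \<in> W0" "g 0 \<in> P" "g x = lin g x + g 0"
    using g by (auto simp: W0_linear_simps fcomp_apply)
qed

lemma WE_I: "w \<in> W0 \<Longrightarrow> \<mu> \<in> P \<Longrightarrow> w \<odot> transl \<mu> \<in> WE"
  unfolding W_ext_def by blast

lemma WE_I': "w \<in> W0 \<Longrightarrow> \<mu> \<in> P \<Longrightarrow> (\<And>x. g x = w x + \<mu>) \<Longrightarrow> g \<in> WE"
proof -
  assume "w \<in> W0" "\<mu> \<in> P" "\<And>x. g x = w x + \<mu>"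
  then have "g = w \<odot> transl \<mu>" by (simp add: fun_eq_iff fcomp_apply id_apply)
  then show ?thesis using \<open>w \<in> W0\<close> \<open>\<mu> \<in> P\<close> WE_I by simp
qed

lemma W0_WE: "w \<in> W0 \<Longrightarrow> w \<in> WE"
  using WE_I'[of w 0 w] weights_0 by simp

lemma transl_WE: "\<mu> \<in> P \<Longrightarrow> transl \<mu> \<in> WE"
  using WE_I'[of id \<mu> "transl \<mu>"] W0_id by (simp add: id_apply)

lemma lin_W0 [simp]: "w \<in> W0 \<Longrightarrow> lin w = w"
  by (simp add: lin_def fun_eq_iff fcomp_apply id_apply W0_linear_simps)

lemma lin_transl [simp]: "lin (transl \<mu>) = id"
  by (simp add: lin_def fun_eq_iff fcomp_apply id_apply)

lemma lin_fcomp: "g \<in> WE \<Longrightarrow> h \<in> WE \<Longrightarrow> lin (g \<odot> h) = lin g \<odot> lin h"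
proof -
  assume g: "g \<in> WE" and h: "h \<in> WE"
  have "lin (g \<odot> h) x = lin h (g x) - lin h (g 0)" for x by (simp add: lin_def fcomp_apply)
  then have "lin (g \<odot> h) x = lin h (lin g x)" for x
    using W0_linear_simps(2)[OF WE_E(1)[OF h], of "g x" "g 0"] by (simp add: lin_def[of g])
  then show ?thesis by (simp add: fun_eq_iff fcomp_apply)
qed

lemma WE_fcomp: "g \<in> WE \<Longrightarrow> h \<in> WE \<Longrightarrow> g \<odot> h \<in> WE"
proof (rule WE_I'[of "lin g \<odot> lin h" "h (g 0)"])
  assume g: "g \<in> WE" and h: "h \<in> WE"
  show "lin g \<odot> lin h \<in> W0" using WE_E(1) g h W0_fcomp by blast
  show "h (g 0) \<in> P" unfolding WE_E(3)[OF h, of "g 0"]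
    using WE_E(1,2)[OF h] WE_E(2)[OF g] weights_add weights_W0 by blast
  have "lin (g \<odot> h) x = (lin g \<odot> lin h) x" for x using lin_fcomp[OF g h] by simp
  then have "(lin g \<odot> lin h) x = h (g x) - h (g 0)" for x
    by (simp add: lin_def[of "g \<odot> h"] fcomp_apply[of g h])
  then show "(g \<odot> h) x = (lin g \<odot> lin h) x + h (g 0)" for x by (simp add: fcomp_apply[of g h])
qed

lemma WE_inverse:
  assumes "g \<in> WE" shows "bij g" "inv g \<in> WE" "lin (inv g) = inv (lin g)"
proof -
  let ?h = "\<lambda>x. inv (lin g) (x - g 0)"
  have w: "lin g \<in> W0" "inv (lin g) \<in> W0" using WE_E(1) assms W0_inv by auto
  have hg: "?h (g x) = x" for x using WE_E(3)[OF assms, of x] w by simp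
  have gh: "g (?h x) = x" for x using WE_E(3)[OF assms, of "?h x"] w by simp
  show "bij g" by (rule bij_betw_byWitness[where f' = ?h]) (use hg gh in blast)+
  have inv: "inv g = ?h" using hg gh by (intro inv_equality) auto
  show "inv g \<in> WE" unfolding inv
    by (rule WE_I'[OF w(2), of "- inv (lin g) (g 0)"])
      (use w weights_W0[OF weights_minus[OF WE_E(2)[OF assms]] w(2)] in \<open>auto simp: W0_linear_simps\<close>)
  show "lin (inv g) = inv (lin g)" unfolding inv using w(2)
    by (simp add: lin_def fun_eq_iff W0_linear_simps)
qed

lemma WE_inv_simps [simp]:
  "g \<in> WE \<Longrightarrow> g \<odot> inv g = id" "g \<in> WE \<Longrightarrow> inv g \<odot> g = id"
  "g \<in> WE \<Longrightarrow> g \<odot> (inv g \<odot> h) = h" "g \<in> WE \<Longrightarrow> inv g \<odot> (g \<odot> h) = h"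
  "g \<in> WE \<Longrightarrow> inv g (g x) = x" "g \<in> WE \<Longrightarrow> g (inv g x) = x"
  using WE_inverse(1)
  by (simp_all add: fun_eq_iff fcomp_apply id_apply bij_is_surj surj_f_inv_f bij_is_inj inv_f_f)

lemma WE_inv_inv [simp]: "g \<in> WE \<Longrightarrow> inv (inv g) = g"
  using WE_inverse(1) by (simp add: inv_inv_eq)

lemma inv_fcomp: "g \<in> WE \<Longrightarrow> h \<in> WE \<Longrightarrow> inv (g \<odot> h) = inv h \<odot> inv g"
  by (rule inv_equality) (simp_all add: fcomp_apply)

section \<open>Crossed hyperplanes\<close>

text \<open>Positive roots have heights between 1 and n, so dividing by the Coxeter number n + 1
  puts \<open>\<rho>\<close> inside the fundamental alcove.\<close>

definition base_pt :: 'v where "base_pt = (1 / real (Suc n)) *\<^sub>R \<rho>"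

lemma pr_rho_bounds:
  assumes "a \<in> \<Phi>" shows "\<bar>pr \<rho> a\<bar> \<le> real n" "\<bar>pr \<rho> a\<bar> \<ge> 1"
proof -
  obtain i j where *: "i \<in> {1..Suc n}" "j \<in> {1..Suc n}" "i \<noteq> j" "a = eps i - eps j"
    using assms root_cases by metis
  have "pr \<rho> a = real j - real i" unfolding *(4) by (rule pr_rho_eps_diff[OF *(1,2)])
  then show "\<bar>pr \<rho> a\<bar> \<le> real n" "\<bar>pr \<rho> a\<bar> \<ge> 1" using * by auto
qed

lemma base_pt_bounds:
  assumes "a \<in> \<Phi>"
  shows "\<bar>pr base_pt a\<bar> < 1" "pr base_pt a > 0 \<longleftrightarrow> pr \<rho> a > 0" "pr base_pt a < 0 \<longleftrightarrow> pr \<rho> a < 0"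
    "pr base_pt a \<noteq> 0"
proof -
  have eq: "pr base_pt a = pr \<rho> a / real (Suc n)" by (simp add: base_pt_def)
  show "\<bar>pr base_pt a\<bar> < 1" using pr_rho_bounds[OF assms] by (simp add: eq)
  show "pr base_pt a > 0 \<longleftrightarrow> pr \<rho> a > 0" "pr base_pt a < 0 \<longleftrightarrow> pr \<rho> a < 0"
    by (simp_all add: eq zero_less_divide_iff divide_less_0_iff)
  show "pr base_pt a \<noteq> 0" using pr_rho_bounds[OF assms] by (simp add: eq)
qed

lemma floor_base: "a \<in> \<Phi> \<Longrightarrow> \<lfloor>pr base_pt a\<rfloor> = (if pr \<rho> a > 0 then 0 else -1)"
  using base_pt_bounds[of a] by (auto simp: floor_eq_iff)

text \<open>The signed number of hyperplanes with gradient \<open>a\<close> crossed on the way from the fundamental alcove to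
  its image: no hyperplane contains \<open>base_pt\<close> or one of its images, so the floors number the strips.\<close>

definition crossing :: "('v \<Rightarrow> 'v) \<Rightarrow> 'v \<Rightarrow> int" where
  "crossing g a = \<lfloor>pr (g base_pt) a\<rfloor> - \<lfloor>pr base_pt a\<rfloor>"

text \<open>Each hyperplane is counted for \<open>a\<close> and again for \<open>- a\<close>, so
  this is twice the length (\<open>len_crossings\<close>). Summing over all roots allows reindexing
  by any element of the finite group.\<close>

definition crossings :: "('v \<Rightarrow> 'v) \<Rightarrow> int" where
  "crossings g = (\<Sum>a\<in>\<Phi>. \<bar>crossing g a\<bar>)"

lemma floor_pr_WE:
  assumes "g \<in> WE" "b \<in> \<Phi>"
  shows "pr (g x) (lin g b) = pr x b + of_int \<lfloor>pr (g 0) (lin g b)\<rfloor>"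
proof -
  have "pr (g 0) (lin g b) \<in> \<int>" using WE_E(2)[OF assms(1)] W0_root[OF WE_E(1)[OF assms(1)] assms(2)]
    by (simp add: weights_pr)
  moreover have "pr (g x) (lin g b) = pr (lin g x) (lin g b) + pr (g 0) (lin g b)"
    using WE_E(3)[OF assms(1), of x] by simp
  ultimately show ?thesis using W0_pr[OF WE_E(1)[OF assms(1)]] by simp
qed

text \<open>A cocycle rule: \<open>h\<close> carries hyperplanes with gradient \<open>b\<close> to
  hyperplanes with gradient \<open>lin h b\<close> and shifts their numbers by an integer, which
  cancels in the difference of floors.\<close>

lemma crossing_fcomp:
  assumes "g \<in> WE" "h \<in> WE" "b \<in> \<Phi>"
  shows "crossing (g \<odot> h) (lin h b) = crossing g b + crossing h (lin h b)"
  using floor_pr_WE[OF assms(2,3), of "g base_pt"] floor_pr_WE[OF assms(2,3), of base_pt]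
  by (simp add: crossing_def fcomp_apply)

lemma base_pt_nonint:
  assumes "g \<in> WE" "a \<in> \<Phi>" shows "pr (g base_pt) a \<notin> \<int>"
proof -
  have w: "lin g \<in> W0" using WE_E(1) assms by blast
  define b where "b = inv (lin g) a"
  have b: "b \<in> \<Phi>" "a = lin g b" using w W0_root[OF W0_inv] assms(2) by (auto simp: b_def)
  have "pr base_pt b \<notin> \<int>" using base_pt_bounds[OF b(1)] by (auto elim!: Ints_cases)
  then show ?thesis using floor_pr_WE[OF assms(1) b(1), of base_pt] b(2) by simp
qed

lemma crossing_minus:
  assumes "g \<in> WE" "a \<in> \<Phi>" shows "crossing g (- a) = - crossing g a"
proof -
  have "pr (g base_pt) a \<notin> \<int>" "pr base_pt a \<notin> \<int>"
    using base_pt_nonint[OF assms] base_pt_nonint[OF W0_WE[OF W0_id] assms(2)] by (simp_all add: id_apply)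
  then have "\<lceil>pr (g base_pt) a\<rceil> = \<lfloor>pr (g base_pt) a\<rfloor> + 1" "\<lceil>pr base_pt a\<rceil> = \<lfloor>pr base_pt a\<rfloor> + 1"
    by (auto simp: ceiling_altdef Ints_def)
  then show ?thesis by (simp add: crossing_def floor_minus)
qed

lemma crossing_id [simp]: "crossing id a = 0"
  by (simp add: crossing_def id_apply)

lemma crossing_inv:
  assumes "g \<in> WE" "b \<in> \<Phi>" shows "crossing (inv g) b = - crossing g (lin g b)"
  using crossing_fcomp[OF WE_inverse(2)[OF assms(1)] assms] assms by simp

lemma crossings_inv: "g \<in> WE \<Longrightarrow> crossings (inv g) = crossings g"
  unfolding crossings_def using crossing_inv sum_W0[OF WE_E(1), of g "\<lambda>a. \<bar>crossing g a\<bar>"]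
  by (simp cong: sum.cong)

lemma crossings_fcomp:
  "g \<in> WE \<Longrightarrow> h \<in> WE \<Longrightarrow> crossings (g \<odot> h) = (\<Sum>b\<in>\<Phi>. \<bar>crossing g b + crossing h (lin h b)\<bar>)"
  unfolding crossings_def using crossing_fcomp sum_W0[OF WE_E(1), of h "\<lambda>a. \<bar>crossing (g \<odot> h) a\<bar>"]
  by (simp cong: sum.cong)

lemma crossings_lin: "g \<in> WE \<Longrightarrow> h \<in> WE \<Longrightarrow> crossings g = (\<Sum>b\<in>\<Phi>. \<bar>crossing g (lin h b)\<bar>)"
  unfolding crossings_def using sum_W0[OF WE_E(1), of h "\<lambda>a. \<bar>crossing g a\<bar>"] by simp

text \<open>The triangle inequality is applied root by root and is an equality exactly when the two
  crossing numbers do not have opposite signs.\<close>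

lemma crossings_add_iff:
  assumes "g \<in> WE" "h \<in> WE"
  shows "crossings (g \<odot> h) = crossings g + crossings h \<longleftrightarrow>
    (\<forall>b\<in>\<Phi>. 0 \<le> crossing g b * crossing h (lin h b))"
proof -
  define f where "f b = \<bar>crossing g b\<bar> + \<bar>crossing h (lin h b)\<bar> - \<bar>crossing g b + crossing h (lin h b)\<bar>" for b
  have "crossings g + crossings h - crossings (g \<odot> h) = (\<Sum>b\<in>\<Phi>. f b)"
    unfolding crossings_fcomp[OF assms] crossings_lin[OF assms(2,2)]
    unfolding crossings_def f_def by (simp add: sum.distrib sum_subtractf)
  moreover have "(\<Sum>b\<in>\<Phi>. f b) = 0 \<longleftrightarrow> (\<forall>b\<in>\<Phi>. f b = 0)"
    by (rule sum_nonneg_eq_0_iff[OF finite_roots]) (simp add: f_def abs_triangle_ineq)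
  moreover have "f b = 0 \<longleftrightarrow> 0 \<le> crossing g b * crossing h (lin h b)" for b
  proof -
    have "(\<bar>x\<bar> + \<bar>y\<bar> - \<bar>x + y\<bar> = 0) = (0 \<le> x * y)" for x y :: int
      unfolding zero_le_mult_iff by linarith
    then show ?thesis unfolding f_def .
  qed
  ultimately show ?thesis by (metis diff_eq_eq add.right_neutral add.commute)
qed


section \<open>The walls of the fundamental alcove\<close>

text \<open>The highest root, of height n.\<close>

definition \<theta> :: 'v where "\<theta> = eps 1 - eps (Suc n)"

text \<open>The gradients, pointing out of the fundamental alcove, of its walls.\<close>

definition aff_simple :: "'v set" where "aff_simple = (\<lambda>i. - \<alpha> i) ` {1..n} \<union> {\<theta>}"

definition aff_refl :: "'v \<Rightarrow> 'v \<Rightarrow> 'v" where "aff_refl b = refl_in b (if b = \<theta> then 1 else 0)"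

lemma theta_root: "\<theta> \<in> \<Phi>" and rho_theta: "pr \<rho> \<theta> = real n"
  using eps_diff_root[of 1 "Suc n"] pr_rho_eps_diff[of 1 "Suc n"] n_pos by (auto simp: \<theta>_def)

lemma minus_simple_neq_theta: "i \<in> {1..n} \<Longrightarrow> - \<alpha> i \<noteq> \<theta>"
proof
  assume i: "i \<in> {1..n}" and eq: "- \<alpha> i = \<theta>"
  have "pr \<rho> (- \<alpha> i) = -1" using pr_rho[OF i] by simp
  then show False unfolding eq using rho_theta by simp
qed

lemma aff_simple_root: "b \<in> aff_simple \<Longrightarrow> b \<in> \<Phi>"
  using theta_root minus_root[OF simple_in] unfolding aff_simple_def by auto

lemma refl_minus: "refl_in (- (a::'v)) 0 = refl_in a 0"
  by (simp add: refl_in_def pairing_def fun_eq_iff)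

lemma aff_refl_simple: "i \<in> {1..n} \<Longrightarrow> aff_refl (- \<alpha> i) = refl_in (\<alpha> i) 0"
  using minus_simple_neq_theta by (simp add: aff_refl_def refl_minus)

lemma pos_root_cases:
  assumes "a \<in> \<Phi>" "pr \<rho> a > 0"
  obtains i j where "1 \<le> i" "i < j" "j \<le> Suc n" "a = eps i - eps j"
proof -
  obtain i j where *: "i \<in> {1..Suc n}" "j \<in> {1..Suc n}" "i \<noteq> j" "a = eps i - eps j"
    using assms(1) root_cases by metis
  have "pr \<rho> a = real j - real i" unfolding *(4) by (rule pr_rho_eps_diff[OF *(1,2)])
  then show ?thesis using that[of i j] * assms(2) by auto
qed

lemma pr_pos_theta:
  assumes "a \<in> \<Phi>" "pr \<rho> a > 0" "a \<noteq> \<theta>"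
  shows "pr \<theta> a = 0 \<or> pr \<theta> a = 1" "pr \<rho> a < pr \<rho> \<theta>"
proof -
  obtain i j where *: "1 \<le> i" "i < j" "j \<le> Suc n" "a = eps i - eps j"
    using assms pos_root_cases by metis
  have ne: "\<not> (i = 1 \<and> j = Suc n)" using assms(3) * by (auto simp: \<theta>_def)
  have "pr \<theta> a = pr (eps 1) (eps i - eps j) - pr (eps (Suc n)) (eps i - eps j)"
    unfolding \<theta>_def *(4) by (rule pr_simps(3))
  then show "pr \<theta> a = 0 \<or> pr \<theta> a = 1" using pr_eps_diff[of 1 i j] pr_eps_diff[of "Suc n" i j] * ne n_pos by auto
  have "pr \<rho> a = real j - real i" unfolding *(4) by (rule pr_rho_eps_diff) (use * in auto)
  then show "pr \<rho> a < pr \<rho> \<theta>" using * ne rho_theta by auto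
qed

lemma simple_refl_pos:
  assumes "a \<in> \<Phi>" "pr \<rho> a > 0" "k \<in> {1..n}" "a \<noteq> \<alpha> k"
  shows "pr \<rho> (refl_in (\<alpha> k) 0 a) > 0"
proof -
  obtain i j where *: "1 \<le> i" "i < j" "j \<le> Suc n" "a = eps i - eps j"
    using assms pos_root_cases by metis
  have ne: "\<not> (i = k \<and> j = Suc k)" using assms(4) * by (auto simp: simple_eps)
  define f where "f l = (if l = k then Suc k else if l = Suc k then k else l)" for l
  have "refl_in (\<alpha> k) 0 a = refl_in (\<alpha> k) 0 (eps i) - refl_in (\<alpha> k) 0 (eps j)"
    unfolding *(4) by (rule linear_diff[OF refl_linear])
  also have "\<dots> = eps (f i) - eps (f j)"
    using refl_eps[of i k] refl_eps[of j k] * assms(3) unfolding f_def by auto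
  finally have "pr \<rho> (refl_in (\<alpha> k) 0 a) = real (f j) - real (f i)"
    using pr_rho_eps_diff[of "f i" "f j"] * assms(3) by (auto simp: f_def)
  then show ?thesis using * ne by (auto simp: f_def)
qed

lemma refl_self: "a \<in> \<Phi> \<Longrightarrow> refl_in a 0 a = - a"
  by (simp add: refl_pr pr_root_self scaleR_2)

lemma crossing_W0:
  assumes "w \<in> W0" shows "crossing w (w b) = \<lfloor>pr base_pt b\<rfloor> - \<lfloor>pr base_pt (w b)\<rfloor>"
  using W0_pr[OF assms] by (simp add: crossing_def)

lemma crossing_eq_pos:
  assumes "g \<in> WE" "a \<in> \<Phi>" "\<And>a. a \<in> \<Phi> \<Longrightarrow> pr \<rho> a > 0 \<Longrightarrow> crossing g a = f a"
    "\<And>a. f (- a) = - f a"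
  shows "crossing g a = f a"
proof (cases "pr \<rho> a > 0")
  case False
  then have "pr \<rho> (- a) > 0" using root_height_nonzero[OF assms(2)] by simp
  then have "crossing g (- a) = f (- a)" using assms(3) minus_root[OF assms(2)] by blast
  then show ?thesis using crossing_minus[OF assms(1,2)] assms(4)[of a] by simp
qed (use assms in blast)

lemma refl_conj:
  assumes "w \<in> W0" "a \<in> \<Phi>" shows "refl_in (w a) 0 = inv w \<odot> refl_in a 0 \<odot> w"
proof
  fix x
  have "w (refl_in a 0 (inv w x)) = x - pr (inv w x) a *\<^sub>R w a"
    using assms by (simp add: refl_pr W0_linear_simps)
  moreover have "pr (inv w x) a = pr x (w a)" using W0_pr[OF assms(1), of "inv w x" a] assms by simp
  ultimately show "refl_in (w a) 0 x = (inv w \<odot> refl_in a 0 \<odot> w) x"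
    using refl_pr[OF W0_root[OF assms], of 0 x] by (simp add: fcomp_apply)
qed

text \<open>Conjugating by a simple reflection lengthens the root by one simple root at its upper
  end, so every root reflection is a product of simple ones.\<close>

lemma W0_refl_eps:
  assumes "1 \<le> i" "i < j" "j \<le> Suc n" shows "refl_in (eps i - eps j) 0 \<in> W0"
proof -
  have "Suc i \<le> j" using assms by simp
  then have "j \<le> Suc n \<longrightarrow> refl_in (eps i - eps j) 0 \<in> W0"
  proof (induction j rule: dec_induct)
    case base
    then show ?case using W0_refl[of i] assms(1) by (simp add: simple_eps)
  next
    case (step j)
    show ?case
    proof
      assume "Suc j \<le> Suc n"
      then have *: "refl_in (eps i - eps j) 0 \<in> W0" "j \<in> {1..n}" using step by auto
      let ?s = "refl_in (\<alpha> j) 0"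
      have a: "eps i - eps j \<in> \<Phi>" using step * assms(1) by (intro eps_diff_root) auto
      have s: "?s (eps i - eps j) = eps i - eps (Suc j)"
        using step * assms(1) refl_eps[of i j] refl_eps[of j j] linear_diff[OF refl_linear] by auto
      show "refl_in (eps i - eps (Suc j)) 0 \<in> W0"
        using refl_conj[OF W0_refl[OF *(2)] a] W0_fcomp W0_inv W0_refl[OF *(2)] *(1) unfolding s by simp
    qed
  qed
  then show ?thesis using assms by simp
qed

lemma W0_refl_root: assumes "a \<in> \<Phi>" shows "refl_in a 0 \<in> W0"
proof (cases "pr \<rho> a > 0")
  case True
  then show ?thesis using pos_root_cases[OF assms True] W0_refl_eps by metis
next
  case False
  then have "pr \<rho> (- a) > 0" using root_height_nonzero[OF assms] by simp
  then have "refl_in (- a) 0 \<in> W0" using pos_root_cases[OF minus_root[OF assms]] W0_refl_eps by metis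
  then show ?thesis by (simp add: refl_minus)
qed

lemma refl_eq: "a \<in> \<Phi> \<Longrightarrow> refl_in a k x = refl_in a 0 x + of_int k *\<^sub>R a"
  by (simp add: refl_pr algebra_simps)

lemma int_mult_root: "a \<in> \<Phi> \<Longrightarrow> of_int k *\<^sub>R a \<in> P"
  using pr_root_root_int by (simp add: weights_pr)

lemma refl_WE: "a \<in> \<Phi> \<Longrightarrow> refl_in a k \<in> WE"
  using WE_I'[OF W0_refl_root int_mult_root refl_eq] by blast

lemma lin_refl: "a \<in> \<Phi> \<Longrightarrow> lin (refl_in a k) = refl_in a 0"
  by (rule ext) (simp add: lin_def refl_pr algebra_simps)

lemma aff_refl_WE: "b \<in> aff_simple \<Longrightarrow> aff_refl b \<in> WE"
  unfolding aff_refl_def using refl_WE aff_simple_root by auto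

lemma lin_aff_refl: "b \<in> aff_simple \<Longrightarrow> lin (aff_refl b) = refl_in b 0"
  unfolding aff_refl_def using lin_refl aff_simple_root by auto

text \<open>A generator moves the base point into the neighbouring alcove and crosses the common
  wall only.\<close>

lemma crossing_aff_refl:
  assumes "b \<in> aff_simple" "a \<in> \<Phi>"
  shows "crossing (aff_refl b) a = (if a = b then 1 else if a = - b then -1 else 0)"
proof (rule crossing_eq_pos[OF aff_refl_WE[OF assms(1)] assms(2)])
  fix a assume a: "a \<in> \<Phi>" "pr \<rho> a > 0"
  have fa: "\<lfloor>pr base_pt a\<rfloor> = 0" using floor_base[OF a(1)] a by simp
  consider i where "i \<in> {1..n}" "b = - \<alpha> i" | "b = \<theta>"
    using assms(1) unfolding aff_simple_def by blast
  then show "crossing (aff_refl b) a = (if a = b then 1 else if a = - b then -1 else 0)"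
  proof cases
    case 1
    let ?s = "refl_in (\<alpha> i) 0"
    have s: "aff_refl b = ?s" using 1 aff_refl_simple by simp
    have ss: "?s (?s a) = a" by (rule refl_refl[OF simple_in[OF 1(1)]])
    have "crossing ?s (?s (?s a)) = \<lfloor>pr base_pt (?s a)\<rfloor> - \<lfloor>pr base_pt (?s (?s a))\<rfloor>"
      by (rule crossing_W0[OF W0_refl[OF 1(1)]])
    then have c: "crossing ?s a = \<lfloor>pr base_pt (?s a)\<rfloor>" unfolding ss fa by simp
    have "a \<noteq> b" using a pr_rho[OF 1(1)] 1(2) by force
    moreover have "crossing ?s a = -1" if "a = \<alpha> i"
      using that c refl_self[OF simple_in[OF 1(1)]] floor_base[OF minus_root[OF simple_in[OF 1(1)]]]
        pr_rho[OF 1(1)] by simp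
    moreover have "crossing ?s a = 0" if "a \<noteq> \<alpha> i"
      using c simple_refl_pos[OF a 1(1) that] floor_base[OF refl_root[OF simple_in[OF 1(1)] a(1)]] by simp
    ultimately show ?thesis using s 1(2) by auto
  next
    case 2
    have eq: "pr (aff_refl b base_pt) a = pr base_pt a - (pr base_pt \<theta> - 1) * pr \<theta> a"
      unfolding aff_refl_def 2 refl_pr[OF theta_root] by simp
    have bt: "0 < pr base_pt \<theta>" "pr base_pt \<theta> < 1" "0 < pr base_pt a" "pr base_pt a < 1"
      using base_pt_bounds[OF theta_root] base_pt_bounds[OF a(1)] a n_pos rho_theta by auto
    have neq: "a \<noteq> - b" using a 2 rho_theta by force
    show ?thesis
    proof (cases "a = \<theta>")
      case True
      have "pr (aff_refl b base_pt) a = 2 - pr base_pt \<theta>"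
        using eq pr_root_self[OF theta_root] True by simp
      then have "\<lfloor>pr (aff_refl b base_pt) a\<rfloor> = 1" using bt by (simp add: floor_eq_iff)
      then show ?thesis using True 2 fa by (simp add: crossing_def)
    next
      case False
      \<comment> \<open>If \<open>\<theta>\<close> pairs to 1 with \<open>a\<close>, the reflection
        adds \<open>1 - pr base_pt \<theta>\<close> to the value at \<open>a\<close>. The result
        stays below 1 because the height of \<open>a\<close> is smaller than that of
        \<open>\<theta>\<close>.\<close>
      have lt: "pr base_pt a < pr base_pt \<theta>"
        using pr_pos_theta(2)[OF a False] by (simp add: base_pt_def divide_strict_right_mono)
      have "\<lfloor>pr (aff_refl b base_pt) a\<rfloor> = 0"
        using pr_pos_theta(1)[OF a False] bt lt unfolding eq by (auto simp: floor_eq_iff)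
      then show ?thesis using False 2 fa neq by (simp add: crossing_def)
    qed
  qed
next
  have "b \<noteq> 0" using aff_simple_root[OF assms(1)] zero_not_root by metis
  then have "b \<noteq> - b" by (simp add: eq_neg_iff_add_eq_0 scaleR_2[symmetric])
  then show "(if - a = b then 1 else if - a = - b then -1 else 0) = - (if a = b then 1 else if a = - b then -1 else (0::int))" for a
    by (cases "a = b"; cases "a = - b") auto
qed

text \<open>Up to relabelling the roots by the reflection, only \<open>b\<close> and
  \<open>- b\<close> change their crossing number, each by 1. As \<open>b\<close> points outwards,
  the count drops exactly when the image alcove lies beyond that wall.\<close>

lemma crossings_step:
  assumes "g \<in> WE" "b \<in> aff_simple"
  shows "crossings (g \<odot> aff_refl b) = crossings g + (if crossing g b \<ge> 1 then -2 else 2)"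
proof -
  let ?s = "aff_refl b"
  have b: "b \<in> \<Phi>" "- b \<in> \<Phi>" "b \<noteq> - b"
    using aff_simple_root[OF assms(2)] minus_root zero_not_root by (auto simp: eq_neg_iff_add_eq_0 scaleR_2[symmetric])
  have s: "?s \<in> WE" "lin ?s = refl_in b 0" using aff_refl_WE lin_aff_refl assms by auto
  have inv: "refl_in b 0 (refl_in b 0 c) = c" for c by (rule refl_refl[OF b(1)])
  have rb: "refl_in b 0 b = - b" "refl_in b 0 (- b) = b"
    using refl_self[OF b(1)] inv[of b] by auto
  have eq: "crossing ?s (lin ?s c) = (if c = - b then 1 else if c = b then -1 else 0)" if "c \<in> \<Phi>" for c
    using crossing_aff_refl[OF assms(2) refl_root[OF b(1) that]] inv[of c] rb
    unfolding s(2) by (metis)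
  define f where "f c = \<bar>crossing g c + crossing ?s (lin ?s c)\<bar> - \<bar>crossing g c\<bar>" for c
  have "crossings (g \<odot> ?s) - crossings g = (\<Sum>c\<in>\<Phi>. f c)"
    unfolding crossings_fcomp[OF assms(1) s(1)] unfolding crossings_def f_def by (simp add: sum_subtractf)
  also have "\<dots> = (\<Sum>c\<in>{b, - b}. f c)"
    using b finite_roots eq by (intro sum.mono_neutral_right) (auto simp: f_def)
  also have "\<dots> = f b + f (- b)" using b(3) by simp
  also have "\<dots> = (if crossing g b \<ge> 1 then -2 else 2)"
    using eq[OF b(1)] eq[OF b(2)] b(3) crossing_minus[OF assms(1) b(1)] by (auto simp: f_def)
  finally show ?thesis by simp
qed


section \<open>The fundamental alcove, descents and the elements without crossings\<close>

abbreviation "A0 \<equiv> alcove0 n \<Phi> \<alpha>"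

lemma pr_eps_mono:
  assumes "\<And>k. k \<in> {1..n} \<Longrightarrow> pr x (\<alpha> k) \<ge> 0" "1 \<le> i" "i \<le> j" "j \<le> Suc n"
  shows "pr x (eps j) \<le> pr x (eps i)"
proof -
  have "0 \<le> (\<Sum>k = i..<j. pr x (\<alpha> k))" by (rule sum_nonneg) (use assms in auto)
  also have "\<dots> = pr x (eps i - eps j)" using eps_diff_sum[OF assms(2,3)] pr_sum(2) by metis
  finally show ?thesis by simp
qed

lemma pr_pos_root_bounds:
  assumes "\<And>k. k \<in> {1..n} \<Longrightarrow> pr x (\<alpha> k) \<ge> 0" "a \<in> \<Phi>" "pr \<rho> a > 0"
  shows "0 \<le> pr x a" "pr x a \<le> pr x \<theta>"
proof -
  obtain i j where *: "1 \<le> i" "i < j" "j \<le> Suc n" "a = eps i - eps j"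
    using assms pos_root_cases by metis
  show "0 \<le> pr x a" using pr_eps_mono[OF assms(1), of i j] * by simp
  show "pr x a \<le> pr x \<theta>"
    using pr_eps_mono[OF assms(1), of 1 i] pr_eps_mono[OF assms(1), of j "Suc n"] * by (simp add: \<theta>_def)
qed

lemma pr_pos_root_simple:
  assumes "\<And>k. k \<in> {1..n} \<Longrightarrow> pr x (\<alpha> k) \<ge> 0" "1 \<le> i" "i < j" "j \<le> Suc n"
  shows "pr x (\<alpha> i) \<le> pr x (eps i - eps j)"
  using pr_eps_mono[OF assms(1), of "Suc i" j] assms(2-4) by (simp add: eps_Suc)

lemma alcove_pr: "x \<in> A0 \<Longrightarrow> a \<in> \<Phi> \<Longrightarrow> pr \<rho> a > 0 \<Longrightarrow> 0 < pr x a \<and> pr x a < 1"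
  by (auto simp: alcove0_def pos_root_iff pairing_root)

lemma alcove_iff: "x \<in> A0 \<longleftrightarrow> (\<forall>i\<in>{1..n}. 0 < pr x (\<alpha> i)) \<and> pr x \<theta> < 1"
proof
  assume x: "x \<in> A0"
  have "0 < pr x (\<alpha> i)" if "i \<in> {1..n}" for i
    using alcove_pr[OF x simple_in[OF that]] pr_rho[OF that] by simp
  moreover have "pr x \<theta> < 1" using alcove_pr[OF x theta_root] rho_theta n_pos by simp
  ultimately show "(\<forall>i\<in>{1..n}. 0 < pr x (\<alpha> i)) \<and> pr x \<theta> < 1" by blast
next
  assume x: "(\<forall>i\<in>{1..n}. 0 < pr x (\<alpha> i)) \<and> pr x \<theta> < 1"
  then have nonneg: "pr x (\<alpha> k) \<ge> 0" if "k \<in> {1..n}" for k using that by (meson less_imp_le)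
  have "0 < pr x a \<and> pr x a < 1" if a: "a \<in> \<Phi>" "pr \<rho> a > 0" for a
  proof
    obtain i j where *: "1 \<le> i" "i < j" "j \<le> Suc n" "a = eps i - eps j"
      using a pos_root_cases by metis
    show "0 < pr x a" using pr_pos_root_simple[OF nonneg *(1-3)] x *(1-3) unfolding *(4)
      by (meson atLeastAtMost_iff less_Suc_eq_le less_le_trans order_less_le_trans)
    show "pr x a < 1" using pr_pos_root_bounds(2)[OF nonneg a] x by simp
  qed
  then show "x \<in> A0" by (simp add: alcove0_def pos_root_iff pairing_root)
qed

lemma base_pt_alcove: "base_pt \<in> A0"
  unfolding alcove_iff using base_pt_bounds(2)[OF simple_in] pr_rho base_pt_bounds(1)[OF theta_root] by auto

lemma crossings_0_iff: "crossings g = 0 \<longleftrightarrow> (\<forall>a\<in>\<Phi>. crossing g a = 0)"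
  unfolding crossings_def using finite_roots by (simp add: sum_nonneg_eq_0_iff)

lemma crossings_nonneg: "0 \<le> crossings g"
  unfolding crossings_def by (simp add: sum_nonneg)

lemma crossings_0_alcove:
  assumes "g \<in> WE" shows "crossings g = 0 \<longleftrightarrow> g base_pt \<in> A0"
proof
  assume "crossings g = 0"
  then have c: "crossing g a = 0" if "a \<in> \<Phi>" for a using that crossings_0_iff by blast
  have "0 < pr (g base_pt) a \<and> pr (g base_pt) a < 1" if a: "a \<in> \<Phi>" "pr \<rho> a > 0" for a
  proof -
    have fl: "\<lfloor>pr (g base_pt) a\<rfloor> = 0" using c[OF a(1)] floor_base[OF a(1)] a(2) by (simp add: crossing_def)
    moreover have "pr (g base_pt) a \<noteq> 0" using base_pt_nonint[OF assms a(1)] by auto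
    ultimately show ?thesis by (simp add: floor_eq_iff)
  qed
  then show "g base_pt \<in> A0" by (simp add: alcove0_def pos_root_iff pairing_root)
next
  assume A: "g base_pt \<in> A0"
  have "crossing g a = 0" if "a \<in> \<Phi>" for a
  proof (rule crossing_eq_pos[OF assms that])
    fix a assume a: "a \<in> \<Phi>" "pr \<rho> a > 0"
    then have "\<lfloor>pr (g base_pt) a\<rfloor> = 0" using alcove_pr[OF A a] by (simp add: floor_eq_iff)
    then show "crossing g a = 0" using floor_base[OF a(1)] a(2) by (simp add: crossing_def)
  qed simp
  then show "crossings g = 0" by (simp add: crossings_0_iff)
qed

text \<open>If no wall is crossed outwards, the image of \<open>base_pt\<close> satisfies all
  inequalities defining the alcove, so nothing is crossed at all.\<close>

lemma exists_descent:
  assumes "g \<in> WE" "crossings g \<noteq> 0" shows "\<exists>b\<in>aff_simple. crossing g b \<ge> 1"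
proof (rule ccontr)
  assume "\<not> ?thesis"
  then have c: "crossing g b \<le> 0" if "b \<in> aff_simple" for b using that by force
  have "0 < pr (g base_pt) (\<alpha> i)" if i: "i \<in> {1..n}" for i
  proof -
    have "crossing g (\<alpha> i) \<ge> 0"
      using c[of "- \<alpha> i"] i crossing_minus[OF assms(1) simple_in[OF i]] unfolding aff_simple_def by auto
    then have "\<lfloor>pr (g base_pt) (\<alpha> i)\<rfloor> \<ge> 0"
      using floor_base[OF simple_in[OF i]] pr_rho[OF i] by (simp add: crossing_def)
    moreover have "pr (g base_pt) (\<alpha> i) \<noteq> 0" using base_pt_nonint[OF assms(1) simple_in[OF i]] by auto
    ultimately show ?thesis by simp
  qed
  moreover have "pr (g base_pt) \<theta> < 1"
  proof -
    have "\<lfloor>pr (g base_pt) \<theta>\<rfloor> \<le> 0" using c[of \<theta>] floor_base[OF theta_root] rho_theta n_pos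
      unfolding aff_simple_def by (simp add: crossing_def)
    then show ?thesis by linarith
  qed
  ultimately have "g base_pt \<in> A0" by (simp add: alcove_iff)
  then show False using assms crossings_0_alcove by blast
qed

lemma crossings_0_maps_alcove:
  assumes "g \<in> WE" "crossings g = 0" "x \<in> A0" shows "g x \<in> A0"
proof -
  have g0: "g base_pt \<in> A0" using assms crossings_0_alcove by blast
  have "0 < pr (g x) a \<and> pr (g x) a < 1" if a: "a \<in> \<Phi>" "pr \<rho> a > 0" for a
  proof -
    define b where "b = inv (lin g) a"
    have b: "b \<in> \<Phi>" "a = lin g b" using WE_E(1)[OF assms(1)] W0_root[OF W0_inv] a(1) by (auto simp: b_def)
    \<comment> \<open>Strips go to strips, so one integer shift, read off at \<open>base_pt\<close>,
      serves all points of the alcove: it is 0 if \<open>b\<close> is positive and 1 if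
      \<open>b\<close> is negative.\<close>
    define m where "m = \<lfloor>pr (g 0) a\<rfloor>"
    have gx: "pr (g x) a = pr x b + of_int m" "pr (g base_pt) a = pr base_pt b + of_int m"
      using floor_pr_WE[OF assms(1) b(1), folded b(2)] unfolding m_def by blast+
    have gb: "0 < pr base_pt b + of_int m" "pr base_pt b + of_int m < 1"
      using alcove_pr[OF g0 a] unfolding gx by auto
    show ?thesis
    proof (cases "pr \<rho> b > 0")
      case True
      then have "m = 0" using base_pt_bounds[OF b(1)] gb by linarith
      then show ?thesis using alcove_pr[OF assms(3) b(1) True] unfolding gx by simp
    next
      case False
      then have nb: "pr \<rho> (- b) > 0" using root_height_nonzero[OF b(1)] by simp
      have "pr base_pt b < 0" using base_pt_bounds(3)[OF b(1)] nb by simp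
      then have "m = 1" using base_pt_bounds(1)[OF b(1)] gb by linarith
      then show ?thesis using alcove_pr[OF assms(3) minus_root[OF b(1)] nb] unfolding gx by simp
    qed
  qed
  then show ?thesis by (simp add: alcove0_def pos_root_iff pairing_root)
qed

lemma Pi_iff: "g \<in> Pi_stab n \<Phi> \<alpha> \<longleftrightarrow> g \<in> WE \<and> crossings g = 0"
proof
  assume "g \<in> Pi_stab n \<Phi> \<alpha>"
  then show "g \<in> WE \<and> crossings g = 0"
    using base_pt_alcove crossings_0_alcove unfolding Pi_stab_def by blast
next
  assume g: "g \<in> WE \<and> crossings g = 0"
  then have *: "x \<in> A0 \<Longrightarrow> g x \<in> A0" "x \<in> A0 \<Longrightarrow> inv g x \<in> A0" for x
    using crossings_0_maps_alcove[of g] crossings_0_maps_alcove[of "inv g"]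
      crossings_inv[of g] WE_inverse(2)[of g] by auto
  have "x \<in> g ` A0" if "x \<in> A0" for x
    using *(2)[OF that] WE_inv_simps(6)[of g x] g by (intro image_eqI[of _ _ "inv g x"]) auto
  then have "g ` A0 = A0" using *(1) by blast
  then show "g \<in> Pi_stab n \<Phi> \<alpha>" using g unfolding Pi_stab_def by blast
qed

section \<open>The generators of the affine Weyl group\<close>

lemma continuous_pr: "continuous_on UNIV (\<lambda>x. pr x a)"
  unfolding pr_def by (intro continuous_intros) (use norm1 in auto)

lemma closure_alcove: "closure A0 = {x. (\<forall>i\<in>{1..n}. 0 \<le> pr x (\<alpha> i)) \<and> pr x \<theta> \<le> 1}" (is "_ = ?K")
proof
  have "?K = (\<Inter>i\<in>{1..n}. {x. 0 \<le> pr x (\<alpha> i)}) \<inter> {x. pr x \<theta> \<le> 1}" by auto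
  also have "closed \<dots>"
    by (intro closed_Int closed_INT ballI closed_Collect_le continuous_pr continuous_on_const)
  finally have "closed ?K" .
  moreover have "A0 \<subseteq> ?K" using alcove_iff by (auto intro: less_imp_le)
  ultimately show "closure A0 \<subseteq> ?K" by (rule closure_minimal[rotated])
next
  show "?K \<subseteq> closure A0"
  proof
    fix x assume x: "x \<in> ?K"
    show "x \<in> closure A0" unfolding closure_approachable
    proof (intro allI impI)
      fix e :: real assume e: "e > 0"
      \<comment> \<open>A step from \<open>x\<close> towards the interior point
        \<open>base_pt\<close>. Adding 1 to the distance keeps the denominator positive, and the
        factor 2 makes the final estimate strict.\<close>
      define t where "t = min 1 (e / (2 * (norm (base_pt - x) + 1)))"
      have t: "0 < t" "t \<le> 1" using e by (auto simp: t_def intro!: divide_pos_pos add_nonneg_pos)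
      define y where "y = x + t *\<^sub>R (base_pt - x)"
      have pry: "pr y a = (1 - t) * pr x a + t * pr base_pt a" for a
        by (simp add: y_def algebra_simps)
      have "0 < pr y (\<alpha> i)" if "i \<in> {1..n}" for i
        unfolding pry using x t that base_pt_alcove alcove_iff by (intro add_nonneg_pos mult_nonneg_nonneg mult_pos_pos) auto
      moreover have "pr y \<theta> < 1"
      proof -
        have "(1 - t) * pr x \<theta> \<le> (1 - t) * 1" using x t by (intro mult_left_mono) auto
        moreover have "t * pr base_pt \<theta> < t * 1" using t base_pt_alcove alcove_iff by (intro mult_strict_left_mono) auto
        ultimately have "(1 - t) * pr x \<theta> + t * pr base_pt \<theta> < (1 - t) * 1 + t * 1"
          by (rule add_le_less_mono)
        then show ?thesis unfolding pry by simp
      qed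
      ultimately have "y \<in> A0" by (simp add: alcove_iff)
      moreover have "dist y x < e"
      proof -
        let ?d = "norm (base_pt - x)"
        have "dist y x = t * ?d" using t by (simp add: y_def dist_norm)
        also have "\<dots> \<le> (e / (2 * (?d + 1))) * ?d" by (intro mult_right_mono) (auto simp: t_def)
        also have "\<dots> < e"
        proof -
          have *: "e * d < e * (2 * (d + 1))" "0 < 2 * (d + 1)" if "0 \<le> d" for d :: real
            using e that by (auto intro: mult_strict_left_mono)
          have "e * ?d / (2 * (?d + 1)) < e"
            unfolding pos_divide_less_eq[OF *(2)[OF norm_ge_zero]] by (rule *(1)[OF norm_ge_zero])
          then show ?thesis by simp
        qed
        finally show ?thesis .
      qed
      ultimately show "\<exists>y\<in>A0. dist y x < e" by blast
    qed
  qed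
qed

lemma hyperplane_root: "a \<in> \<Phi> \<Longrightarrow> hyperplane a k = {x. pr x a = of_int k}"
  by (simp add: hyperplane_def pairing_root)

lemma pr_inner: "pr x a = r \<longleftrightarrow> a \<bullet> x = r * (\<alpha> 1 \<bullet> \<alpha> 1) / 2"
  using norm1 by (auto simp: pr_def inner_commute divide_simps mult.commute)

lemma pr_inner_le: "r \<le> pr x a \<longleftrightarrow> r * (\<alpha> 1 \<bullet> \<alpha> 1) / 2 \<le> a \<bullet> x"
  using norm1 by (simp add: pr_def inner_commute divide_simps mult.commute)

lemma pr_inner_ge: "pr x a \<le> r \<longleftrightarrow> a \<bullet> x \<le> r * (\<alpha> 1 \<bullet> \<alpha> 1) / 2"
  using norm1 by (simp add: pr_def inner_commute divide_simps mult.commute)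

lemma aff_dim_hyperplane_root: "a \<in> \<Phi> \<Longrightarrow> aff_dim (hyperplane a k) = int n - 1"
proof -
  assume a: "a \<in> \<Phi>"
  then have "a \<noteq> 0" using zero_not_root by blast
  then have "aff_dim {x. a \<bullet> x = r} = int n - 1" for r using aff_dim_hyperplane[of a r] dim_eq n_pos by simp
  then show ?thesis unfolding hyperplane_root[OF a] pr_inner by blast
qed

lemma affine_hyperplane_root: "a \<in> \<Phi> \<Longrightarrow> affine (hyperplane a k)"
  unfolding hyperplane_root pr_inner by (rule affine_hyperplane)

lemma convex_closure_alcove: "convex (closure A0)"
proof -
  have "closure A0 = (\<Inter>i\<in>{1..n}. {x. 0 \<le> pr x (\<alpha> i)}) \<inter> {x. pr x \<theta> \<le> 1}"
    unfolding closure_alcove by auto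
  also have "convex \<dots>" unfolding pr_inner_le pr_inner_ge
    by (intro convex_Int convex_INT convex_halfspace_ge convex_halfspace_le)
  finally show ?thesis .
qed

lemma open_alcove: "open A0"
proof -
  have "A0 = (\<Inter>i\<in>{1..n}. {x. 0 < pr x (\<alpha> i)}) \<inter> {x. pr x \<theta> < 1}"
    using alcove_iff by auto
  also have "open \<dots>"
    by (intro open_Int open_INT ballI open_Collect_less continuous_pr continuous_on_const finite_atLeastAtMost)
  finally show ?thesis .
qed

lemma aff_dim_closure_alcove: "aff_dim (closure A0) = int n"
  using aff_dim_open[OF open_alcove] base_pt_alcove dim_eq by (auto simp: closure_aff_dim)

lemma hyperplane_eq_refl:
  assumes "a \<in> \<Phi>" "b \<in> \<Phi>" "hyperplane a k = hyperplane b m" shows "refl_in a k = refl_in b m"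
proof -
  have eq: "pr x a = of_int k \<longleftrightarrow> pr x b = of_int m" for x
    using assms hyperplane_root by blast
  \<comment> \<open>\<open>p\<close> is the foot of the perpendicular from the origin, and
    \<open>y\<close> below is the part of \<open>b\<close> orthogonal to \<open>a\<close>. Moving
    from \<open>p\<close> along \<open>y\<close> stays on the hyperplane, so \<open>y\<close> is
    orthogonal to \<open>b\<close> as well and vanishes.\<close>
  define p where "p = (of_int k / 2) *\<^sub>R a"
  have p: "pr p a = of_int k" using pr_root_self[OF assms(1)] by (simp add: p_def)
  then have pb: "pr p b = of_int m" using eq by blast
  define y where "y = b - (pr b a / 2) *\<^sub>R a"
  have ya: "pr y a = 0" using pr_root_self[OF assms(1)] by (simp add: y_def)
  then have "pr (p + y) a = of_int k" using p by simp
  then have yb: "pr y b = 0" using eq[of "p + y"] pb by simp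
  have "pr y y = 0" using ya yb unfolding y_def by simp
  then have "y = 0" using pr_self_pos[of y] by fastforce
  then have b: "b = (pr b a / 2) *\<^sub>R a" by (simp add: y_def)
  then have "pr b a / 2 = 1 \<or> pr b a / 2 = -1"
    using root_system assms(1,2) unfolding root_system_def by metis
  then show ?thesis
  proof
    assume "pr b a / 2 = 1"
    then have "b = a" using b by simp
    then show ?thesis using p pb by simp
  next
    assume "pr b a / 2 = -1"
    then have ba: "b = - a" using b by simp
    then have "m = - k" using p pb by simp
    have "refl_in a k x = refl_in (- a) (- k) x" for x
      using refl_pr[OF assms(1), of k x] refl_pr[OF minus_root[OF assms(1)], of "- k" x]
      by (simp add: algebra_simps) (metis add_right_imp_eq)
    then show ?thesis using ba \<open>m = - k\<close> by auto
  qed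
qed

text \<open>A facet lies in one of the walls, and both span hyperplanes of the same dimension.\<close>

lemma facet_wall:
  assumes a: "a \<in> \<Phi>" and b: "b \<in> \<Phi>" and facet: "(hyperplane a k \<inter> closure A0) facet_of closure A0"
    and sub: "hyperplane a k \<inter> closure A0 \<subseteq> hyperplane b m"
  shows "refl_in a k = refl_in b m"
proof -
  let ?F = "hyperplane a k \<inter> closure A0"
  have dim: "aff_dim (affine hull ?F) = int n - 1" and ne: "?F \<noteq> {}"
    using facet aff_dim_closure_alcove unfolding facet_of_def by (auto simp: aff_dim_affine_hull)
  have "affine hull ?F = hyperplane c l" if "c \<in> \<Phi>" "?F \<subseteq> hyperplane c l" for c l
  proof (rule affine_dim_equal)
    show "affine hull ?F \<subseteq> hyperplane c l"
      using that affine_hyperplane_root by (simp add: hull_minimal)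
  qed (use dim ne aff_dim_hyperplane_root affine_hyperplane_root that in auto)
  then have "hyperplane a k = hyperplane b m" using a b sub by blast
  then show ?thesis using hyperplane_eq_refl a b by blast
qed

text \<open>A face inside a root hyperplane is a facet as soon as it contains a nonempty relatively
  open piece of that hyperplane.\<close>

lemma facetI:
  assumes a: "a \<in> \<Phi>" and U: "open U" "z \<in> U" "z \<in> hyperplane a k" "U \<inter> hyperplane a k \<subseteq> closure A0"
    and face: "(hyperplane a k \<inter> closure A0) face_of closure A0"
  shows "(hyperplane a k \<inter> closure A0) facet_of closure A0"
proof -
  have "hyperplane a k \<inter> U \<noteq> {}" using U by auto
  then have "int n - 1 = aff_dim (hyperplane a k \<inter> U)"
    using aff_dim_convex_Int_open[of "hyperplane a k" U] affine_imp_convex[OF affine_hyperplane_root[OF a]]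
      aff_dim_hyperplane_root[OF a] U by auto
  also have "\<dots> \<le> aff_dim (hyperplane a k \<inter> closure A0)" by (rule aff_dim_subset) (use U in auto)
  finally have "int n - 1 \<le> aff_dim (hyperplane a k \<inter> closure A0)" .
  moreover have "aff_dim (hyperplane a k \<inter> closure A0) \<le> int n - 1"
    using aff_dim_subset[of "hyperplane a k \<inter> closure A0" "hyperplane a k"] aff_dim_hyperplane_root[OF a] by auto
  ultimately show ?thesis using face aff_dim_closure_alcove U unfolding facet_of_def by auto
qed

lemma pr_theta_sum: "pr x \<theta> = (\<Sum>k = 1..n. pr x (\<alpha> k))"
  using eps_diff_sum[of 1 "Suc n"] n_pos by (simp add: \<theta>_def pr_sum(2)[symmetric] atLeastLessThanSuc_atLeastAtMost del: pr_simps)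

lemma facet_simple:
  assumes i: "i \<in> {1..n}" shows "(hyperplane (\<alpha> i) 0 \<inter> closure A0) facet_of closure A0"
proof -
  let ?U = "(\<Inter>j\<in>{1..n}-{i}. {x. 0 < pr x (\<alpha> j)}) \<inter> {x. pr x \<theta> < 1}"
  \<comment> \<open>The remaining simple roots get value 1 / (2 n), so that their sum, the value at
    \<open>\<theta>\<close>, stays below 1 and \<open>z\<close> lies on no other wall.\<close>
  obtain z where z: "\<And>j. j \<in> {1..n} \<Longrightarrow> pr z (\<alpha> j) = (if j = i then 0 else 1 / (2 * real n))"
    using exists_coweight[of "\<lambda>j. if j = i then 0 else 1 / (2 * real n)"] by blast
  have "pr z \<theta> = (\<Sum>k = 1..n. if k = i then 0 else 1 / (2 * real n))"
    unfolding pr_theta_sum using z by (intro sum.cong) auto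
  also have "\<dots> \<le> (\<Sum>k = 1..n. 1 / (2 * real n))" by (rule sum_mono) auto
  also have "\<dots> < 1" using n_pos by simp
  finally have zt: "pr z \<theta> < 1" .
  have face: "(closure A0 \<inter> {x. \<alpha> i \<bullet> x = 0}) face_of closure A0"
    by (rule face_of_Int_supporting_hyperplane_ge[OF convex_closure_alcove])
      (use i norm1 in \<open>auto simp: closure_alcove pr_inner_le\<close>)
  have h: "hyperplane (\<alpha> i) 0 = {x. \<alpha> i \<bullet> x = 0}" using hyperplane_root[OF simple_in[OF i], of 0] pr_inner[of _ "\<alpha> i" 0] by auto
  show ?thesis
  proof (rule facetI[OF simple_in[OF i], of ?U z])
    show "open ?U"
      by (intro open_Int open_INT ballI open_Collect_less continuous_pr continuous_on_const) auto
    show "z \<in> ?U" using z zt n_pos by auto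
    show "z \<in> hyperplane (\<alpha> i) 0" using z[OF i] hyperplane_root[OF simple_in[OF i]] by simp
    show "?U \<inter> hyperplane (\<alpha> i) 0 \<subseteq> closure A0"
    proof
      fix x assume x: "x \<in> ?U \<inter> hyperplane (\<alpha> i) 0"
      then have "pr x (\<alpha> i) = 0" using hyperplane_root[OF simple_in[OF i], of 0] by simp
      then have "0 \<le> pr x (\<alpha> j)" if "j \<in> {1..n}" for j using x that by (cases "j = i") (auto intro: less_imp_le)
      then show "x \<in> closure A0" using x by (auto simp: closure_alcove)
    qed
    show "(hyperplane (\<alpha> i) 0 \<inter> closure A0) face_of closure A0"
      using face unfolding h by (simp add: Int_commute)
  qed
qed

lemma facet_theta: "(hyperplane \<theta> 1 \<inter> closure A0) facet_of closure A0"
proof -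
  let ?U = "\<Inter>j\<in>{1..n}. {x. 0 < pr x (\<alpha> j)}"
  obtain z where z: "\<And>j. j \<in> {1..n} \<Longrightarrow> pr z (\<alpha> j) = 1 / real n"
    using exists_coweight[of "\<lambda>j. 1 / real n"] by blast
  have zt: "pr z \<theta> = 1" unfolding pr_theta_sum using z n_pos by simp
  have face: "(closure A0 \<inter> {x. \<theta> \<bullet> x = 1 * (\<alpha> 1 \<bullet> \<alpha> 1) / 2}) face_of closure A0"
    by (rule face_of_Int_supporting_hyperplane_le[OF convex_closure_alcove])
      (use pr_inner_ge[of _ \<theta> 1] in \<open>auto simp: closure_alcove\<close>)
  have h: "hyperplane \<theta> 1 = {x. \<theta> \<bullet> x = 1 * (\<alpha> 1 \<bullet> \<alpha> 1) / 2}"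
    using hyperplane_root[OF theta_root, of 1] pr_inner[of _ \<theta> 1] by auto
  show ?thesis
  proof (rule facetI[OF theta_root, of ?U z])
    show "open ?U"
      by (intro open_INT ballI open_Collect_less continuous_pr continuous_on_const) auto
    show "z \<in> ?U" using z n_pos by auto
    show "z \<in> hyperplane \<theta> 1" using zt hyperplane_root[OF theta_root] by simp
    show "?U \<inter> hyperplane \<theta> 1 \<subseteq> closure A0"
      using hyperplane_root[OF theta_root, of 1] by (force simp: closure_alcove)
    show "(hyperplane \<theta> 1 \<inter> closure A0) face_of closure A0"
      using face unfolding h by (simp add: Int_commute)
  qed
qed

text \<open>On the closed alcove every positive root takes values between 0 and 1, so only the
  levels 0 and 1 can support a facet. A facet at level 0 lies in a simple wall and one at level 1 in
  the wall of \<open>\<theta>\<close>, and then \<open>facet_wall\<close> applies.\<close>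

lemma S_aff_eq: "S_aff n \<Phi> \<alpha> = aff_refl ` aff_simple"
proof (intro subset_antisym subsetI)
  fix s assume "s \<in> S_aff n \<Phi> \<alpha>"
  then obtain a k where s: "s = refl_in a k" and a: "a \<in> pos_roots n \<Phi> \<alpha>"
    and facet: "(hyperplane a k \<inter> closure A0) facet_of closure A0"
    unfolding S_aff_def by blast
  have a\<Phi>: "a \<in> \<Phi>" "pr \<rho> a > 0" using a pos_root_iff by auto
  have K: "pr x (\<alpha> i) \<ge> 0" "pr x \<theta> \<le> 1" if "x \<in> closure A0" "i \<in> {1..n}" for x i
    using that closure_alcove by auto
  have Ka: "0 \<le> pr x a" "pr x a \<le> pr x \<theta>" if "x \<in> closure A0" for x
    using pr_pos_root_bounds[OF K(1)[OF that] a\<Phi>] by auto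
  have H: "hyperplane a k = {x. pr x a = of_int k}" by (rule hyperplane_root[OF a\<Phi>(1)])
  obtain x where x: "x \<in> closure A0" "pr x a = of_int k"
    using facet H unfolding facet_of_def by blast
  have "0 \<le> real_of_int k" "real_of_int k \<le> 1" using Ka[OF x(1)] K(2)[OF x(1), of 1] x(2) n_pos by auto
  then have "k = 0 \<or> k = 1" by linarith
  then show "s \<in> aff_refl ` aff_simple"
  proof
    assume k: "k = 0"
    \<comment> \<open>Where a positive root vanishes on the closed alcove, so does the simple root
      at its lower end.\<close>
    obtain i j where ij: "1 \<le> i" "i < j" "j \<le> Suc n" "a = eps i - eps j"
      using a\<Phi> pos_root_cases by metis
    have i: "i \<in> {1..n}" using ij by auto
    have "pr x (\<alpha> i) = 0" if "x \<in> hyperplane a k \<inter> closure A0" for x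
    proof -
      have xc: "x \<in> closure A0" and "pr x a = 0" using that H k by auto
      then have "pr x (\<alpha> i) \<le> 0" using pr_pos_root_simple[OF K(1)[OF xc] ij(1-3)] ij(4) by simp
      then show ?thesis using K(1)[OF xc i] by simp
    qed
    then have "hyperplane a k \<inter> closure A0 \<subseteq> hyperplane (\<alpha> i) 0"
      using hyperplane_root[OF simple_in[OF i], of 0] by auto
    then have "s = refl_in (\<alpha> i) 0" using facet_wall[OF a\<Phi>(1) simple_in[OF i] facet] s by simp
    then have "s = aff_refl (- \<alpha> i)" using aff_refl_simple[OF i] by simp
    then show ?thesis using i unfolding aff_simple_def by blast
  next
    assume k: "k = 1"
    have "pr x \<theta> = 1" if "x \<in> hyperplane a k \<inter> closure A0" for x
      using that H k Ka(2)[of x] K(2)[of x 1] n_pos by auto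
    then have "hyperplane a k \<inter> closure A0 \<subseteq> hyperplane \<theta> 1"
      using hyperplane_root[OF theta_root, of 1] by auto
    then have "s = refl_in \<theta> 1" using facet_wall[OF a\<Phi>(1) theta_root facet] s by simp
    then show ?thesis unfolding aff_simple_def aff_refl_def by auto
  qed
next
  fix s assume "s \<in> aff_refl ` aff_simple"
  then consider i where "i \<in> {1..n}" "s = refl_in (\<alpha> i) 0" | "s = refl_in \<theta> 1"
    using aff_refl_simple unfolding aff_simple_def aff_refl_def by auto
  then show "s \<in> S_aff n \<Phi> \<alpha>"
  proof cases
    case 1
    moreover have "\<alpha> i \<in> pos_roots n \<Phi> \<alpha>" using simple_in pr_rho 1 by (simp add: pos_root_iff)
    ultimately show ?thesis using facet_simple unfolding S_aff_def by blast
  next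
    case 2
    moreover have "\<theta> \<in> pos_roots n \<Phi> \<alpha>" using theta_root rho_theta n_pos by (simp add: pos_root_iff)
    ultimately show ?thesis using facet_theta unfolding S_aff_def by blast
  qed
qed


section \<open>Simple transitivity and length\<close>

text \<open>Modulo \<open>n + 1\<close> this is the class of a weight in the quotient of the weight lattice by the root lattice.\<close>

definition weight_class :: "'v \<Rightarrow> int" where "weight_class \<mu> = (\<Sum>i = 1..n. int i * \<lfloor>pr \<mu> (\<alpha> i)\<rfloor>)"

definition Q :: "'v set" where "Q = {\<mu> \<in> P. int (Suc n) dvd weight_class \<mu>}"

lemma floor_add_weight: "\<mu> \<in> P \<Longrightarrow> a \<in> \<Phi> \<Longrightarrow> \<lfloor>pr (\<mu> + \<nu>) a\<rfloor> = \<lfloor>pr \<mu> a\<rfloor> + \<lfloor>pr \<nu> a\<rfloor>"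
  by (auto simp: weights_pr elim!: Ints_cases dest!: bspec)

lemma weight_class_add: "\<mu> \<in> P \<Longrightarrow> weight_class (\<mu> + \<nu>) = weight_class \<mu> + weight_class \<nu>"
  using floor_add_weight simple_in by (simp add: weight_class_def sum.distrib[symmetric] distrib_left del: pr_simps)

lemma weight_class_0: "weight_class 0 = 0"
  by (simp add: weight_class_def)

lemma weight_class_minus: "\<mu> \<in> P \<Longrightarrow> weight_class (- \<mu>) = - weight_class \<mu>"
  using weight_class_add[of \<mu> "- \<mu>"] weight_class_0 by simp

lemma Q_add: "\<mu> \<in> Q \<Longrightarrow> \<nu> \<in> Q \<Longrightarrow> \<mu> + \<nu> \<in> Q" and Q_minus: "\<mu> \<in> Q \<Longrightarrow> - \<mu> \<in> Q" and Q_0: "0 \<in> Q"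
  using weights_add weights_minus weights_0 weight_class_0
  by (auto simp: Q_def weight_class_add weight_class_minus)

lemma Q_sum: "(\<And>i. i \<in> A \<Longrightarrow> f i \<in> Q) \<Longrightarrow> (\<Sum>i\<in>A. f i) \<in> Q"
  by (induction A rule: infinite_finite_induct) (auto simp: Q_0 Q_add)

lemma Q_mult: assumes "\<mu> \<in> Q" shows "of_int k *\<^sub>R \<mu> \<in> Q"
proof -
  have nat: "real m *\<^sub>R \<mu> \<in> Q" for m
    by (induction m) (use assms in \<open>auto simp: Q_0 Q_add algebra_simps\<close>)
  show ?thesis
  proof (cases k rule: int_cases2)
    case (nonneg m) then show ?thesis using nat by simp
  next
    case (nonpos m) then show ?thesis using Q_minus[OF nat[of m]] by simp
  qed
qed

text \<open>The contributions 2 j, -(j - 1) and -(j + 1) cancel, except at the last node, where the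
  missing neighbour leaves n + 1.\<close>

lemma simple_Q: assumes j: "j \<in> {1..n}" shows "\<alpha> j \<in> Q"
proof -
  have fl: "\<lfloor>- 1 :: real\<rfloor> = - 1" by (simp add: floor_eq_iff)
  have "weight_class (\<alpha> j) = (\<Sum>i = 1..n. (if i = j then 2 * int j else 0)
      + (if i = j - 1 then - int (j - 1) else 0) + (if i = Suc j then - int (Suc j) else 0))"
    unfolding weight_class_def using j fl by (intro sum.cong) (auto simp: pr_simple)
  also have "\<dots> = 2 * int j - int (j - 1) - (if Suc j \<le> n then int (Suc j) else 0)"
    using j by (auto simp: sum.distrib)
  also have "\<dots> = (if Suc j \<le> n then 0 else int (Suc n))" using j by auto
  finally show ?thesis using root_weight[OF simple_in[OF j]] by (simp add: Q_def)
qed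

lemma root_Q: assumes "a \<in> \<Phi>" shows "a \<in> Q"
proof -
  have pos: "eps i - eps j \<in> Q" if "1 \<le> i" "i < j" "j \<le> Suc n" for i j
    unfolding eps_diff_sum[OF that(1) less_imp_le[OF that(2)]] by (rule Q_sum) (use that simple_Q in auto)
  show ?thesis
  proof (cases "pr \<rho> a > 0")
    case True
    then show ?thesis using pos_root_cases[OF assms True] pos by metis
  next
    case False
    then have "pr \<rho> (- a) > 0" using root_height_nonzero[OF assms] by simp
    then have "- a \<in> Q" using pos_root_cases[OF minus_root[OF assms]] pos by metis
    then show ?thesis using Q_minus by fastforce
  qed
qed

lemma Q_W0: "w \<in> W0 \<Longrightarrow> \<mu> \<in> Q \<Longrightarrow> w \<mu> \<in> Q"
proof (induction arbitrary: \<mu> rule: W0_induct)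
  case (step i h)
  have "pr \<mu> (\<alpha> i) \<in> \<int>" using step.prems simple_in[OF step.hyps(1)] by (auto simp: Q_def weights_pr)
  then obtain m where m: "pr \<mu> (\<alpha> i) = of_int m" by (auto elim: Ints_cases)
  have "refl_in (\<alpha> i) 0 \<mu> = \<mu> + - (of_int m *\<^sub>R \<alpha> i)" using refl_simple[OF step.hyps(1)] m by simp
  also have "\<dots> \<in> Q" by (intro Q_add Q_minus Q_mult simple_Q step.prems step.hyps(1))
  finally show ?case using step.IH by (simp add: fcomp_apply)
qed (simp add: id_apply)

text \<open>Stated in one direction only: it serves to separate the affine group from the nontrivial
  elements of length zero.\<close>

lemma W_aff_Q: "g \<in> W_aff n \<Phi> \<alpha> \<Longrightarrow> g \<in> WE \<and> g 0 \<in> Q"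
  unfolding W_aff_def
proof (induction rule: generated_induct)
  case id
  then show ?case using W0_WE[OF W0_id] Q_0 by (simp add: id_apply[of 0])
next
  case (step r h)
  then obtain a k where r: "r = refl_in a k" "a \<in> \<Phi>" using pos_root_iff by blast
  have "r 0 = of_int k *\<^sub>R a" using refl_pr[OF r(2), of k 0] r(1) by simp
  then have "r 0 \<in> Q" using Q_mult[OF root_Q[OF r(2)]] by simp
  then have "lin h (r 0) + h 0 \<in> Q" using step.IH WE_E(1) Q_W0 Q_add by blast
  then have "(r \<odot> h) 0 \<in> Q" using WE_E(3)[of h "r 0"] step.IH by (simp add: fcomp_apply)
  then show ?case using refl_WE[OF r(2)] r(1) step.IH WE_fcomp by blast
qed

lemma W_aff_WE: "g \<in> W_aff n \<Phi> \<alpha> \<Longrightarrow> g \<in> WE"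
  using W_aff_Q by blast

lemma W_aff_fcomp: "g \<in> W_aff n \<Phi> \<alpha> \<Longrightarrow> h \<in> W_aff n \<Phi> \<alpha> \<Longrightarrow> g \<odot> h \<in> W_aff n \<Phi> \<alpha>"
  unfolding W_aff_def by (rule generated_fcomp)

lemma W_aff_inv: "g \<in> W_aff n \<Phi> \<alpha> \<Longrightarrow> inv g \<in> W_aff n \<Phi> \<alpha>"
proof -
  have "r \<odot> r = id" if "r \<in> {refl_in a k |a k. a \<in> pos_roots n \<Phi> \<alpha>}" for r
    using that pos_root_iff refl_fcomp_refl by blast
  then show "g \<in> W_aff n \<Phi> \<alpha> \<Longrightarrow> inv g \<in> W_aff n \<Phi> \<alpha>"
    unfolding W_aff_def using generated_inv by blast
qed

lemma id_W_aff: "id \<in> W_aff n \<Phi> \<alpha>"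
  unfolding W_aff_def by (rule generated_id)

lemma S_aff_W_aff: "s \<in> S_aff n \<Phi> \<alpha> \<Longrightarrow> s \<in> W_aff n \<Phi> \<alpha>"
  unfolding S_aff_def W_aff_def by (intro generated_base) blast

lemma W0_eps_perm:
  assumes "w \<in> W0"
  shows "\<exists>\<sigma>. \<sigma> permutes {1..Suc n} \<and> (\<forall>j\<in>{1..Suc n}. w (eps j) = eps (\<sigma> j))"
  using assms
proof (induction rule: W0_induct)
  case id
  then show ?case by (rule exI[of _ id], rule conjI, rule permutes_id) (simp add: id_apply)
next
  case (step i h)
  then obtain \<sigma> where \<sigma>: "\<sigma> permutes {1..Suc n}" "\<forall>j\<in>{1..Suc n}. h (eps j) = eps (\<sigma> j)" by blast
  let ?t = "Transposition.transpose i (Suc i)"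
  have t: "?t permutes {1..Suc n}" using step.hyps(1) by (intro permutes_swap_id) auto
  have "(refl_in (\<alpha> i) 0 \<odot> h) (eps j) = eps ((\<sigma> \<circ> ?t) j)" if "j \<in> {1..Suc n}" for j
  proof -
    have "?t j \<in> {1..Suc n}" using permutes_in_image[OF t] that by blast
    moreover have "refl_in (\<alpha> i) 0 (eps j) = eps (?t j)"
      using refl_eps[OF that step.hyps(1)] by (simp add: transpose_def)
    ultimately show ?thesis using \<sigma>(2) by (simp add: fcomp_apply)
  qed
  then show ?case using permutes_compose[OF t \<sigma>(1)] by blast
qed

text \<open>\<open>w\<close> permutes the vectors \<open>eps\<close>, and preserving positive roots
  makes the permutation increasing.\<close>

lemma W0_pos_id:
  assumes "w \<in> W0" "\<And>b. b \<in> \<Phi> \<Longrightarrow> pr \<rho> b > 0 \<Longrightarrow> pr \<rho> (w b) > 0" shows "w = id"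
proof -
  obtain \<sigma> where \<sigma>: "\<sigma> permutes {1..Suc n}" "\<forall>j\<in>{1..Suc n}. w (eps j) = eps (\<sigma> j)"
    using W0_eps_perm assms(1) by blast
  have mem: "\<sigma> j \<in> {1..Suc n}" if "j \<in> {1..Suc n}" for j using permutes_in_image[OF \<sigma>(1)] that by blast
  have mono: "\<sigma> i < \<sigma> j" if ij: "1 \<le> i" "i < j" "j \<le> Suc n" for i j
  proof -
    have ij': "i \<in> {1..Suc n}" "j \<in> {1..Suc n}" "i \<noteq> j" using ij by auto
    have "w (eps i - eps j) = eps (\<sigma> i) - eps (\<sigma> j)" using \<sigma>(2) ij' W0_linear_simps[OF assms(1)] by metis
    moreover have "pr \<rho> (eps i - eps j) = real j - real i" by (rule pr_rho_eps_diff[OF ij'(1,2)])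
    ultimately have "pr \<rho> (eps (\<sigma> i) - eps (\<sigma> j)) > 0"
      using assms(2)[OF eps_diff_root[OF ij']] ij by (simp del: pr_simps)
    then show ?thesis using pr_rho_eps_diff[OF mem[OF ij'(1)] mem[OF ij'(2)]] by simp
  qed
  have "j \<le> Suc n \<longrightarrow> j \<le> \<sigma> j" if "1 \<le> j" for j
    using that
  proof (induction j rule: dec_induct)
    case base
    then show ?case using mem[of 1] by auto
  next
    case (step j)
    then show ?case using mono[of j "Suc j"] by auto
  qed
  then have "\<sigma> = id" using \<sigma>(1) by (intro permutes_natset_ge) auto
  then have fix_eps: "w (eps j) = eps j" if "j \<in> {1..Suc n}" for j using \<sigma>(2) that by (simp add: id_apply)
  have "w (\<alpha> k) = \<alpha> k" if "k \<in> {1..n}" for k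
    using simple_eps[of k] fix_eps[of k] fix_eps[of "Suc k"] that W0_linear_simps(2)[OF assms(1)] by auto
  then have "pr (w x) (\<alpha> k) = pr x (\<alpha> k)" if "k \<in> {1..n}" for k x
    using W0_pr[OF assms(1), of x "\<alpha> k"] that by simp
  then have "w x = x" for x by (rule pr_eqI)
  then show ?thesis by (simp add: fun_eq_iff id_apply)
qed

text \<open>Simple transitivity on alcoves. The translation part pairs to 0 or 1 with each positive
  root. The values at the simple roots add up to the value at \<open>\<theta>\<close>, so at most
  one of them is 1. If that happened at node i, the weight class would be i, which n + 1 does not
  divide. So the translation part is 0, and the linear part preserves positive roots.\<close>

lemma W_aff_crossings_0:
  assumes "g \<in> W_aff n \<Phi> \<alpha>" "crossings g = 0" shows "g = id"
proof -
  have g: "g \<in> WE" and q: "g 0 \<in> Q" using W_aff_Q assms by auto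
  have w: "lin g \<in> W0" using WE_E g by blast
  have A: "g base_pt \<in> A0" using crossings_0_alcove[OF g] assms(2) by blast
  have prg: "pr (g base_pt) a = pr (lin g base_pt) a + pr (g 0) a" for a
    unfolding WE_E(3)[OF g, of base_pt] by simp
  have small: "\<bar>pr (lin g base_pt) a\<bar> < 1" if "a \<in> \<Phi>" for a
    using W0_pr_inv[OF w] base_pt_bounds(1)[OF W0_root[OF W0_inv[OF w] that]] by simp
  have "\<exists>m. pr (g 0) a = of_int m \<and> 0 \<le> m \<and> m \<le> 1" if a: "a \<in> \<Phi>" "pr \<rho> a > 0" for a
  proof -
    obtain m where m: "pr (g 0) a = of_int m"
      using WE_E(2)[OF g] a by (auto simp: weights_pr elim!: Ints_cases)
    have "m > -1" "m < 2" using alcove_pr[OF A a] small[OF a(1)] unfolding prg m by linarith+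
    then show ?thesis using m by (intro exI[of _ m]) auto
  qed
  then obtain m where m: "\<And>a. a \<in> \<Phi> \<Longrightarrow> pr \<rho> a > 0 \<Longrightarrow> pr (g 0) a = of_int (m a) \<and> 0 \<le> m a \<and> m a \<le> 1"
    by metis
  have mi: "pr (g 0) (\<alpha> i) = of_int (m (\<alpha> i))" "0 \<le> m (\<alpha> i)" if "i \<in> {1..n}" for i
    using m[OF simple_in[OF that]] pr_rho[OF that] by auto
  have "of_int (\<Sum>i = 1..n. m (\<alpha> i)) = pr (g 0) \<theta>" unfolding pr_theta_sum using mi(1) by simp
  also have "\<dots> = of_int (m \<theta>)" using m[OF theta_root] rho_theta n_pos by simp
  finally have "(\<Sum>i = 1..n. m (\<alpha> i)) = m \<theta>" by (simp only: of_int_eq_iff)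
  then have sum: "(\<Sum>i = 1..n. m (\<alpha> i)) \<le> 1" using m[OF theta_root] rho_theta n_pos by simp
  have cls: "weight_class (g 0) = (\<Sum>i = 1..n. int i * m (\<alpha> i))"
    unfolding weight_class_def using mi(1) by simp
  have "m (\<alpha> i) = 0" if i: "i \<in> {1..n}" for i
  proof (rule ccontr)
    assume "m (\<alpha> i) \<noteq> 0"
    then have m1: "m (\<alpha> i) \<ge> 1" using mi(2)[OF i] by simp
    have rest: "m (\<alpha> j) = 0" if j: "j \<in> {1..n}" "j \<noteq> i" for j
    proof -
      have "m (\<alpha> i) + m (\<alpha> j) = (\<Sum>k\<in>{i, j}. m (\<alpha> k))" using j by simp
      also have "\<dots> \<le> (\<Sum>k = 1..n. m (\<alpha> k))" by (rule sum_mono2) (use i j mi in auto)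
      finally show ?thesis using sum m1 mi(2)[OF j(1)] by linarith
    qed
    have "m (\<alpha> i) \<le> 1" using m[OF simple_in[OF i]] pr_rho[OF i] by simp
    then have "m (\<alpha> i) = 1" using m1 by simp
    then have "weight_class (g 0) = (\<Sum>k\<in>{i}. int k)"
      unfolding cls using rest i by (intro sum.mono_neutral_cong_right) auto
    moreover have "int (Suc n) dvd weight_class (g 0)" using q by (simp add: Q_def)
    ultimately show False using i zdvd_not_zless[of "int i" "int (Suc n)"] by auto
  qed
  then have g0: "g 0 = 0" using mi(1) by (intro pr_eqI) simp
  then have lg: "lin g = g" by (simp add: lin_def fun_eq_iff)
  have "pr \<rho> (g b) > 0" if b: "b \<in> \<Phi>" "pr \<rho> b > 0" for b
  proof (rule ccontr)
    have gb: "g b \<in> \<Phi>" using W0_root[OF w b(1)] lg by simp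
    assume "\<not> ?thesis"
    then have "pr \<rho> (- g b) > 0" using root_height_nonzero[OF gb] by simp
    then have "0 < pr (g base_pt) (- g b)" using alcove_pr[OF A minus_root[OF gb]] by blast
    moreover have "pr (g base_pt) (g b) = pr base_pt b" using W0_pr[OF w] lg by simp
    ultimately show False using base_pt_bounds(2)[OF b(1)] b(2) by simp
  qed
  then show ?thesis using W0_pos_id w lg by simp
qed

lemma crossings_Pi_fcomp:
  assumes "g \<in> WE" "crossings g = 0" "h \<in> WE"
  shows "crossings (g \<odot> h) = crossings h" "crossings (h \<odot> g) = crossings h"
  using assms crossings_0_iff crossings_add_iff[of g h] crossings_add_iff[of h g] W0_root[OF WE_E(1)] by auto

lemma S_aff_WE: "s \<in> S_aff n \<Phi> \<alpha> \<Longrightarrow> s \<in> WE"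
  using W_aff_WE S_aff_W_aff by blast

lemma aff_refl_involution: "b \<in> aff_simple \<Longrightarrow> aff_refl b \<odot> aff_refl b = id"
  unfolding aff_refl_def using aff_simple_root by (intro refl_fcomp_refl)

lemma word_WE: "set ss \<subseteq> S_aff n \<Phi> \<alpha> \<Longrightarrow> word_prod ss \<in> WE \<and> word_prod ss \<in> W_aff n \<Phi> \<alpha>"
  by (induction ss) (auto simp: word_prod_simps W0_WE[OF W0_id] id_W_aff WE_fcomp S_aff_WE W_aff_fcomp S_aff_W_aff)

lemma crossings_word_le:
  assumes "g \<in> WE" "set ss \<subseteq> S_aff n \<Phi> \<alpha>" shows "crossings (g \<odot> word_prod ss) \<le> crossings g + 2 * int (length ss)"
  using assms
proof (induction ss arbitrary: g)
  case (Cons s ss)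
  then obtain b where b: "b \<in> aff_simple" "s = aff_refl b" using S_aff_eq by auto
  have "crossings (g \<odot> s) \<le> crossings g + 2" using crossings_step[OF Cons.prems(1) b(1)] b(2) by auto
  moreover have "g \<odot> s \<in> WE" using Cons.prems S_aff_WE WE_fcomp by auto
  ultimately show ?case using Cons.IH[of "g \<odot> s"] Cons.prems by (auto simp: word_prod_simps fcomp_assoc)
qed (simp add: word_prod_simps)

text \<open>Walking back through walls costs two crossings per generator and ends at an element that
  crosses nothing.\<close>

lemma WE_word:
  assumes "g \<in> WE"
  shows "\<exists>\<pi> ss. \<pi> \<in> WE \<and> crossings \<pi> = 0 \<and> set ss \<subseteq> S_aff n \<Phi> \<alpha> \<and> g = \<pi> \<odot> word_prod ss \<and>
    crossings g = 2 * int (length ss)"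
proof -
  have "\<forall>g. g \<in> WE \<longrightarrow> nat (crossings g) = N \<longrightarrow> (\<exists>\<pi> ss. \<pi> \<in> WE \<and> crossings \<pi> = 0 \<and> set ss \<subseteq> S_aff n \<Phi> \<alpha> \<and>
    g = \<pi> \<odot> word_prod ss \<and> crossings g = 2 * int (length ss))" for N
  proof (induction N rule: less_induct)
    case (less N)
    show ?case
    proof (intro allI impI)
      fix g assume g: "g \<in> WE" and N: "nat (crossings g) = N"
      show "\<exists>\<pi> ss. \<pi> \<in> WE \<and> crossings \<pi> = 0 \<and> set ss \<subseteq> S_aff n \<Phi> \<alpha> \<and>
        g = \<pi> \<odot> word_prod ss \<and> crossings g = 2 * int (length ss)"
      proof (cases "crossings g = 0")
        case True
        then show ?thesis using g by (intro exI[of _ g] exI[of _ "[]"]) (simp add: word_prod_simps)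
      next
        case False
        then obtain b where b: "b \<in> aff_simple" "crossing g b \<ge> 1" using exists_descent g by blast
        let ?s = "aff_refl b"
        have s: "?s \<in> S_aff n \<Phi> \<alpha>" using b S_aff_eq by blast
        have g': "g \<odot> ?s \<in> WE" using g s S_aff_WE WE_fcomp by blast
        have c: "crossings (g \<odot> ?s) = crossings g - 2" using crossings_step[OF g b(1)] b(2) by simp
        then have "nat (crossings (g \<odot> ?s)) < N" using N crossings_nonneg[of "g \<odot> ?s"] by linarith
        then obtain \<pi> ss where *: "\<pi> \<in> WE" "crossings \<pi> = 0" "set ss \<subseteq> S_aff n \<Phi> \<alpha>"
          "g \<odot> ?s = \<pi> \<odot> word_prod ss" "crossings (g \<odot> ?s) = 2 * int (length ss)"
          using less g' by blast
        have "g = (g \<odot> ?s) \<odot> ?s" using aff_refl_involution[OF b(1)] by (simp add: fcomp_assoc)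
        then have "g = \<pi> \<odot> word_prod (ss @ [?s])"
          unfolding *(4) by (simp add: word_prod_append word_prod_simps fcomp_assoc)
        then show ?thesis using * s c by (intro exI[of _ \<pi>] exI[of _ "ss @ [?s]"]) auto
      qed
    qed
  qed
  then show ?thesis using assms by blast
qed

lemma W_aff_word:
  assumes "u \<in> W_aff n \<Phi> \<alpha>"
  shows "\<exists>ss. set ss \<subseteq> S_aff n \<Phi> \<alpha> \<and> u = word_prod ss \<and> crossings u = 2 * int (length ss)"
proof -
  obtain \<pi> ss where *: "\<pi> \<in> WE" "crossings \<pi> = 0" "set ss \<subseteq> S_aff n \<Phi> \<alpha>"
    "u = \<pi> \<odot> word_prod ss" "crossings u = 2 * int (length ss)"
    using WE_word[OF W_aff_WE[OF assms]] by blast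
  have "\<pi> = u \<odot> inv (word_prod ss)" unfolding *(4) using word_WE[OF *(3)] by (simp add: fcomp_assoc)
  then have "\<pi> \<in> W_aff n \<Phi> \<alpha>" using assms word_WE[OF *(3)] W_aff_inv W_aff_fcomp by metis
  then have "\<pi> = id" using W_aff_crossings_0 *(2) by blast
  then show ?thesis using * by auto
qed

lemma len_aff_crossings:
  assumes "u \<in> W_aff n \<Phi> \<alpha>" shows "2 * int (len_aff n \<Phi> \<alpha> u) = crossings u"
proof -
  obtain ss where *: "set ss \<subseteq> S_aff n \<Phi> \<alpha>" "u = word_prod ss" "crossings u = 2 * int (length ss)"
    using W_aff_word[OF assms] by blast
  have "len_aff n \<Phi> \<alpha> u = length ss" unfolding len_aff_def
  proof (rule Least_equality)
    show "\<exists>ss'. set ss' \<subseteq> S_aff n \<Phi> \<alpha> \<and> length ss' = length ss \<and> u = word_prod ss'" using * by blast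
    fix k assume "\<exists>ss'. set ss' \<subseteq> S_aff n \<Phi> \<alpha> \<and> length ss' = k \<and> u = word_prod ss'"
    then obtain ss' where ss': "set ss' \<subseteq> S_aff n \<Phi> \<alpha>" "length ss' = k" "u = word_prod ss'" by blast
    have "crossings id = 0" by (simp add: crossings_def)
    then have "crossings u \<le> 2 * int k"
      using crossings_word_le[OF W0_WE[OF W0_id] ss'(1)] ss' by simp
    then show "length ss \<le> k" using *(3) by simp
  qed
  then show ?thesis using *(3) by simp
qed

text \<open>\<open>len\<close> is a definite description over all factorizations into an element of
  \<open>Pi_stab\<close> and an affine one. The first factor does not change
  \<open>crossings\<close>, so every factorization yields the same value.\<close>

lemma len_crossings:
  assumes "g \<in> WE" shows "2 * int (len n \<Phi> \<alpha> g) = crossings g"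
proof -
  obtain \<pi> ss where *: "\<pi> \<in> WE" "crossings \<pi> = 0" "set ss \<subseteq> S_aff n \<Phi> \<alpha>" "g = \<pi> \<odot> word_prod ss"
    using WE_word[OF assms] by blast
  let ?u = "word_prod ss"
  have u: "?u \<in> W_aff n \<Phi> \<alpha>" "?u \<in> WE" using word_WE[OF *(3)] by auto
  have "len n \<Phi> \<alpha> g = len_aff n \<Phi> \<alpha> ?u" unfolding len_def
  proof (rule the_equality)
    show "\<exists>\<pi>\<in>Pi_stab n \<Phi> \<alpha>. \<exists>u\<in>W_aff n \<Phi> \<alpha>. g = \<pi> \<odot> u \<and> len_aff n \<Phi> \<alpha> ?u = len_aff n \<Phi> \<alpha> u"
      using * u Pi_iff by blast
    fix k assume "\<exists>\<pi>\<in>Pi_stab n \<Phi> \<alpha>. \<exists>u\<in>W_aff n \<Phi> \<alpha>. g = \<pi> \<odot> u \<and> k = len_aff n \<Phi> \<alpha> u"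
    then obtain \<pi>' u' where \<pi>': "\<pi>' \<in> WE" "crossings \<pi>' = 0" "u' \<in> W_aff n \<Phi> \<alpha>" "g = \<pi>' \<odot> u'"
      "k = len_aff n \<Phi> \<alpha> u'" using Pi_iff by blast
    have "crossings u' = crossings g" "crossings ?u = crossings g"
      using crossings_Pi_fcomp(1)[OF \<pi>'(1,2) W_aff_WE[OF \<pi>'(3)]] crossings_Pi_fcomp(1)[OF *(1,2) u(2)]
        \<pi>'(4) *(4) by auto
    then have "2 * int k = 2 * int (len_aff n \<Phi> \<alpha> ?u)"
      using len_aff_crossings[OF \<pi>'(3)] len_aff_crossings[OF u(1)] \<pi>'(5) by simp
    then show "k = len_aff n \<Phi> \<alpha> ?u" by simp
  qed
  then show ?thesis using len_aff_crossings[OF u(1)] crossings_Pi_fcomp(1)[OF *(1,2) u(2)] *(4) by simp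
qed


section \<open>Length, descents and the longest element\<close>

abbreviation "lgt \<equiv> len n \<Phi> \<alpha>"
abbreviation "S \<equiv> S_aff n \<Phi> \<alpha>"
abbreviation "w0 \<equiv> longest n \<Phi> \<alpha>"

lemma len_add_iff:
  assumes "g \<in> WE" "h \<in> WE"
  shows "lgt (g \<odot> h) = lgt g + lgt h \<longleftrightarrow> (\<forall>b\<in>\<Phi>. 0 \<le> crossing g b * crossing h (lin h b))"
  using crossings_add_iff[OF assms] len_crossings[OF assms(1)] len_crossings[OF assms(2)]
    len_crossings[OF WE_fcomp[OF assms]] by linarith

lemma len_inv: "g \<in> WE \<Longrightarrow> lgt (inv g) = lgt g"
  using crossings_inv[of g] len_crossings[of g] len_crossings[OF WE_inverse(2), of g] by simp

lemma len_0_iff: "g \<in> WE \<Longrightarrow> lgt g = 0 \<longleftrightarrow> crossings g = 0"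
  using len_crossings[of g] by linarith

lemma id_WE: "id \<in> WE" using W0_WE[OF W0_id] .

lemma len_id: "lgt id = 0"
  using len_0_iff[OF id_WE] by (simp add: crossings_def)

lemma len_0_fcomp:
  assumes "g \<in> WE" "h \<in> WE" "lgt g = 0" shows "lgt (g \<odot> h) = lgt h" "lgt (h \<odot> g) = lgt h"
proof -
  have "crossings g = 0" using len_0_iff assms by blast
  then show "lgt (g \<odot> h) = lgt h" "lgt (h \<odot> g) = lgt h"
    using crossings_Pi_fcomp[OF assms(1) _ assms(2)] len_crossings[OF assms(2)]
      len_crossings[OF WE_fcomp[OF assms(1,2)]] len_crossings[OF WE_fcomp[OF assms(2,1)]] by linarith+
qed

lemma S_involution: "s \<in> S \<Longrightarrow> s \<odot> s = id" "s \<in> S \<Longrightarrow> s \<odot> (s \<odot> g) = g" "s \<in> S \<Longrightarrow> g \<odot> s \<odot> s = g"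
proof -
  show *: "s \<odot> s = id" if "s \<in> S" using aff_refl_involution S_aff_eq that by auto
  show "s \<odot> (s \<odot> g) = g" if "s \<in> S" using *[OF that] by (metis fcomp_assoc id_fcomp)
  show "g \<odot> s \<odot> s = g" if "s \<in> S" using *[OF that] by (metis fcomp_assoc fcomp_id)
qed

lemma S_inv: "s \<in> S \<Longrightarrow> inv s = s"
  using S_involution(1) by (intro inv_equality) (metis fcomp_apply id_apply)+

lemma len_S_right: "s \<in> S \<Longrightarrow> g \<in> WE \<Longrightarrow> lgt (g \<odot> s) = lgt g + 1 \<or> lgt g = lgt (g \<odot> s) + 1"
  using crossings_step[of g] S_aff_eq len_crossings[of g] len_crossings[of "g \<odot> s"] WE_fcomp[OF _ S_aff_WE, of g s]
  by (auto split: if_splits)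

lemma len_S_left:
  assumes "s \<in> S" "g \<in> WE" shows "lgt (s \<odot> g) = lgt g + 1 \<or> lgt g = lgt (s \<odot> g) + 1"
proof -
  have "inv (s \<odot> g) = inv g \<odot> s" using inv_fcomp[OF S_aff_WE] assms S_inv by simp
  then have "lgt (s \<odot> g) = lgt (inv g \<odot> s)" using len_inv[OF WE_fcomp[OF S_aff_WE]] assms by metis
  then show ?thesis using len_S_right[OF assms(1) WE_inverse(2)[OF assms(2)]] len_inv[OF assms(2)] by simp
qed

lemma left_descent:
  assumes "g \<in> WE" "lgt g \<noteq> 0" shows "\<exists>s\<in>S. lgt g = lgt (s \<odot> g) + 1"
proof -
  have i: "inv g \<in> WE" "crossings (inv g) \<noteq> 0"
    using WE_inverse(2) assms crossings_inv len_0_iff by auto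
  then obtain b where b: "b \<in> aff_simple" "crossing (inv g) b \<ge> 1" using exists_descent by blast
  let ?s = "aff_refl b"
  have s: "?s \<in> S" using b S_aff_eq by blast
  have "crossings (inv g \<odot> ?s) = crossings (inv g) - 2" using crossings_step[OF i(1) b(1)] b(2) by simp
  then have "lgt (inv g) = lgt (inv g \<odot> ?s) + 1"
    using len_crossings[OF i(1)] len_crossings[OF WE_fcomp[OF i(1) S_aff_WE[OF s]]] by simp
  moreover have "inv (?s \<odot> g) = inv g \<odot> ?s" using inv_fcomp[OF S_aff_WE[OF s] assms(1)] S_inv[OF s] by simp
  ultimately have "lgt g = lgt (?s \<odot> g) + 1"
    using len_inv[OF assms(1)] len_inv[OF WE_fcomp[OF S_aff_WE[OF s] assms(1)]] by simp
  then show ?thesis using s by blast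
qed

lemma len_S: "s \<in> S \<Longrightarrow> lgt s = 1"
  using len_S_right[OF _ id_WE, of s] len_id by auto

lemma simple_S: "i \<in> {1..n} \<Longrightarrow> refl_in (\<alpha> i) 0 \<in> S"
  using aff_refl_simple S_aff_eq unfolding aff_simple_def by (metis Un_iff image_eqI)

text \<open>A finite element crosses only hyperplanes through the origin, and these correspond to
  the roots whose sign it changes: its length counts inversions.\<close>

lemma W0_crossing: 
  assumes "w \<in> W0" "b \<in> \<Phi>"
  shows "crossing w (w b) = (if pr \<rho> b > 0 then 0 else -1) - (if pr \<rho> (w b) > 0 then 0 else -1)"
  using crossing_W0[OF assms(1)] floor_base[OF assms(2)] floor_base[OF W0_root[OF assms]] by simp

lemma simple_left_descent:
  assumes "w \<in> W0" "i \<in> {1..n}" "pr \<rho> (w (\<alpha> i)) < 0"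
  shows "lgt w = lgt (refl_in (\<alpha> i) 0 \<odot> w) + 1"
proof -
  let ?s = "refl_in (\<alpha> i) 0"
  have s: "?s \<in> S" "?s \<in> WE" "aff_refl (- \<alpha> i) = ?s" "- \<alpha> i \<in> aff_simple"
    using simple_S S_aff_WE aff_refl_simple assms(2) unfolding aff_simple_def by auto
  have w: "w \<in> WE" "inv w \<in> WE" using assms(1) W0_WE WE_inverse by auto
  have "crossing w (w (\<alpha> i)) = 1"
    using W0_crossing[OF assms(1) simple_in[OF assms(2)]] pr_rho[OF assms(2)] assms(3) by simp
  then have "crossing (inv w) (- \<alpha> i) = 1"
    using crossing_inv[OF w(1) simple_in[OF assms(2)]] crossing_minus[OF w(2) simple_in[OF assms(2)]] assms(1) by simp
  then have "crossings (inv w \<odot> ?s) = crossings (inv w) - 2"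
    using crossings_step[OF w(2) s(4)] s(3) by simp
  then have "lgt (inv w) = lgt (inv w \<odot> ?s) + 1"
    using len_crossings[OF w(2)] len_crossings[OF WE_fcomp[OF w(2) s(2)]] by simp
  moreover have "inv (?s \<odot> w) = inv w \<odot> ?s" using inv_fcomp[OF s(2) w(1)] S_inv[OF s(1)] by simp
  ultimately show ?thesis using len_inv[OF w(1)] len_inv[OF WE_fcomp[OF s(2) w(1)]] by simp
qed

text \<open>If no simple root became negative, \<open>inv w\<close> would send \<open>\<rho>\<close>
  to a strictly dominant vector, so all positive roots would stay positive and \<open>w\<close>
  would be trivial.\<close>

lemma W0_left_descent:
  assumes "w \<in> W0" "w \<noteq> id"
  shows "\<exists>i\<in>{1..n}. pr \<rho> (w (\<alpha> i)) < 0 \<and> lgt w = lgt (refl_in (\<alpha> i) 0 \<odot> w) + 1"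
proof (rule ccontr)
  assume "\<not> ?thesis"
  then have nn: "pr \<rho> (w (\<alpha> i)) \<ge> 0" if "i \<in> {1..n}" for i
    using simple_left_descent[OF assms(1) that] that by (meson not_le)
  have pos: "pr (inv w \<rho>) (\<alpha> i) > 0" if "i \<in> {1..n}" for i
  proof -
    have "pr (inv w \<rho>) (\<alpha> i) = pr \<rho> (w (\<alpha> i))" using W0_pr[OF assms(1), of "inv w \<rho>" "\<alpha> i"] assms(1) by simp
    then show ?thesis using nn[OF that] root_height_nonzero[OF W0_root[OF assms(1) simple_in[OF that]]] by simp
  qed
  have "pr \<rho> (w b) > 0" if b: "b \<in> \<Phi>" "pr \<rho> b > 0" for b
  proof -
    obtain i j where ij: "1 \<le> i" "i < j" "j \<le> Suc n" "b = eps i - eps j" using b pos_root_cases by metis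
    have "pr (inv w \<rho>) (\<alpha> i) \<le> pr (inv w \<rho>) b"
      unfolding ij(4) by (rule pr_pos_root_simple[OF _ ij(1-3)]) (use pos in \<open>auto intro: less_imp_le\<close>)
    then have "pr (inv w \<rho>) b > 0" using pos[of i] ij by auto
    then show ?thesis using W0_pr[OF assms(1), of "inv w \<rho>" b] assms(1) by simp
  qed
  then show False using W0_pos_id assms by blast
qed

text \<open>The action on the finite set of roots is faithful, because the simple roots
  span.\<close>

lemma finite_W0: "finite W0"
proof -
  have "inj_on (\<lambda>w. restrict w \<Phi>) W0"
  proof (rule inj_onI)
    fix v w assume vw: "v \<in> W0" "w \<in> W0" "restrict v \<Phi> = restrict w \<Phi>"
    have eq: "v a = w a" if "a \<in> \<Phi>" for a using fun_cong[OF vw(3), of a] that by simp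
    have "v x = w x" for x
    proof -
      have "x \<in> span (\<alpha> ` {1..n})" using span_simple by simp
      then show ?thesis
      proof (induction rule: span_induct_alt)
        case (step c u y)
        then obtain j where "j \<in> {1..n}" "u = \<alpha> j" by blast
        then have "v u = w u" using eq[OF simple_in] by simp
        then show ?case using step(2) by (simp only: W0_linear_simps[OF vw(1)] W0_linear_simps[OF vw(2)])
      qed (use vw in \<open>simp add: W0_linear_simps\<close>)
    qed
    then show "v = w" by (rule ext)
  qed
  moreover have "(\<lambda>w. restrict w \<Phi>) ` W0 \<subseteq> \<Phi> \<rightarrow>\<^sub>E \<Phi>" using W0_root by (auto simp: PiE_iff)
  ultimately show ?thesis using finite_roots by (metis finite_PiE finite_subset finite_imageD)
qed

lemma base_pt_W0_sign:
  assumes "w \<in> W0" "a \<in> \<Phi>"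
  shows "pr (w base_pt) a > 0 \<longleftrightarrow> pr \<rho> (inv w a) > 0" "pr (w base_pt) a \<noteq> 0" "\<bar>pr (w base_pt) a\<bar> < 1"
  using W0_pr_inv[OF assms(1)] base_pt_bounds[OF W0_root[OF W0_inv[OF assms(1)] assms(2)]] by auto

text \<open>Among the finitely many images of \<open>z\<close>, one with maximal pairing with
  \<open>\<rho>\<close> is dominant, since a simple reflection at a negative value would increase
  it. The inverse of the element reaching it is the required direction.\<close>

lemma exists_chamber:
  assumes "\<And>a. a \<in> \<Phi> \<Longrightarrow> pr z a \<noteq> 0"
  shows "\<exists>d\<in>W0. \<forall>a\<in>\<Phi>. pr (d base_pt) a > 0 \<longleftrightarrow> pr z a > 0"
proof -
  let ?A = "(\<lambda>w. pr (w z) \<rho>) ` W0"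
  have A: "finite ?A" "?A \<noteq> {}" using finite_W0 W0_id by auto
  obtain w where w: "w \<in> W0" "pr (w z) \<rho> = Max ?A" using Max_in[OF A] by force
  have wmax: "pr (v z) \<rho> \<le> pr (w z) \<rho>" if "v \<in> W0" for v
    unfolding w(2) using that by (intro Max_ge[OF A(1)]) auto
  have simple: "pr (w z) (\<alpha> i) \<ge> 0" if i: "i \<in> {1..n}" for i
  proof -
    have "pr ((w \<odot> refl_in (\<alpha> i) 0) z) \<rho> \<le> pr (w z) \<rho>" by (rule wmax[OF W0_fcomp[OF w(1) W0_refl[OF i]]])
    then show ?thesis using pr_rho[OF i] by (simp add: fcomp_apply refl_simple[OF i] pr_commute[of _ \<rho>])
  qed
  have pos: "pr (w z) b > 0" if b: "b \<in> \<Phi>" "pr \<rho> b > 0" for b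
  proof -
    have "pr (w z) b = pr z (inv w b)" by (rule W0_pr_inv[OF w(1)])
    then have "pr (w z) b \<noteq> 0" using assms W0_root[OF W0_inv[OF w(1)] b(1)] by simp
    moreover have "pr (w z) b \<ge> 0" using pr_pos_root_bounds(1)[OF simple b] .
    ultimately show ?thesis by simp
  qed
  have "pr (inv w base_pt) a > 0 \<longleftrightarrow> pr z a > 0" if a: "a \<in> \<Phi>" for a
  proof -
    have wa: "w a \<in> \<Phi>" using W0_root[OF w(1) a] .
    have 1: "pr (inv w base_pt) a = pr base_pt (w a)"
      using W0_pr[OF w(1), of "inv w base_pt" a] w(1) by simp
    have 2: "pr z a = pr (w z) (w a)" using W0_pr[OF w(1)] by simp
    show ?thesis
    proof (cases "pr \<rho> (w a) > 0")
      case True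
      then show ?thesis unfolding 1 2 using pos[OF wa True] base_pt_bounds(2)[OF wa] by simp
    next
      case False
      then have "pr \<rho> (- w a) > 0" using root_height_nonzero[OF wa] by simp
      then have "pr (w z) (- w a) > 0" by (rule pos[OF minus_root[OF wa]])
      then show ?thesis unfolding 1 2 using False base_pt_bounds(2)[OF wa] by simp
    qed
  qed
  then show ?thesis using W0_inv[OF w(1)] by blast
qed

lemma W0_sign_eq:
  assumes "v \<in> W0" "w \<in> W0" "\<And>a. a \<in> \<Phi> \<Longrightarrow> pr (v base_pt) a > 0 \<Longrightarrow> pr (w base_pt) a > 0"
  shows "v = w"
proof -
  have "v \<odot> inv w = id"
  proof (rule W0_pos_id)
    show "v \<odot> inv w \<in> W0" using assms W0_fcomp W0_inv by blast
    fix b assume b: "b \<in> \<Phi>" "pr \<rho> b > 0"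
    have "pr (v base_pt) (v b) > 0" using W0_pr[OF assms(1)] base_pt_bounds(2)[OF b(1)] b(2) by simp
    then have "pr (w base_pt) (v b) > 0" using assms(3) W0_root[OF assms(1) b(1)] by blast
    then show "pr \<rho> ((v \<odot> inv w) b) > 0"
      using base_pt_W0_sign(1)[OF assms(2) W0_root[OF assms(1) b(1)]] by (simp add: fcomp_apply)
  qed
  then have "v \<odot> inv w \<odot> w = w" by simp
  then show ?thesis using WE_inv_simps(2)[OF W0_WE[OF assms(2)]] by (simp add: fcomp_assoc)
qed

text \<open>Take the element whose chamber contains \<open>- base_pt\<close>. It changes the sign of
  every root, so its crossing numbers all have the maximal modulus 1. Equal length forces equality
  at every root, which determines the chamber.\<close>

lemma longest_props:
  shows "w0 \<in> W0" "b \<in> \<Phi> \<Longrightarrow> pr \<rho> b > 0 \<Longrightarrow> pr \<rho> (w0 b) < 0"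
    "w \<in> W0 \<Longrightarrow> lgt w \<le> lgt w0" "w \<in> W0 \<Longrightarrow> lgt w = lgt w0 \<Longrightarrow> w = w0"
proof -
  obtain d where d: "d \<in> W0" "\<forall>a\<in>\<Phi>. pr (d base_pt) a > 0 \<longleftrightarrow> pr (- base_pt) a > 0"
    using exists_chamber[of "- base_pt"] base_pt_bounds(4) by auto
  have neg: "pr \<rho> (d b) < 0" if b: "b \<in> \<Phi>" "pr \<rho> b > 0" for b
  proof -
    have "pr (d base_pt) (d b) > 0" using W0_pr[OF d(1)] base_pt_bounds(2)[OF b(1)] b(2) by simp
    then have "pr base_pt (d b) < 0" using d(2) W0_root[OF d(1) b(1)] by auto
    then show ?thesis using base_pt_bounds(3)[OF W0_root[OF d(1) b(1)]] by simp
  qed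
  have cr: "crossings w = (\<Sum>b\<in>\<Phi>. \<bar>crossing w (w b)\<bar>)" if "w \<in> W0" for w
    using crossings_lin[OF W0_WE[OF that] W0_WE[OF that]] that by simp
  have one: "\<bar>crossing d (d b)\<bar> = 1" if b: "b \<in> \<Phi>" for b
  proof (cases "pr \<rho> b > 0")
    case True
    then show ?thesis using W0_crossing[OF d(1) b] neg[OF b True] by simp
  next
    case False
    then have "pr \<rho> (- b) > 0" using root_height_nonzero[OF b] by simp
    then have "pr \<rho> (d (- b)) < 0" using neg minus_root[OF b] by blast
    then show ?thesis using W0_crossing[OF d(1) b] False W0_linear_simps(3)[OF d(1)] by simp
  qed
  have le: "\<bar>crossing w (w b)\<bar> \<le> \<bar>crossing d (d b)\<bar>" if "w \<in> W0" "b \<in> \<Phi>" for w b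
    using W0_crossing[OF that] one[OF that(2)] by simp
  have max: "lgt w \<le> lgt d" if "w \<in> W0" for w
  proof -
    have "crossings w \<le> crossings d" unfolding cr[OF that] cr[OF d(1)] by (rule sum_mono) (rule le[OF that])
    then show ?thesis using len_crossings[OF W0_WE[OF that]] len_crossings[OF W0_WE[OF d(1)]] by simp
  qed
  have uniq: "w = d" if w: "w \<in> W0" "lgt w = lgt d" for w
  proof (rule W0_sign_eq[OF w(1) d(1)])
    fix a assume a: "a \<in> \<Phi>" "pr (w base_pt) a > 0"
    define b where "b = inv w a"
    have b: "b \<in> \<Phi>" "pr \<rho> b > 0" "w b = a"
      using W0_root[OF W0_inv[OF w(1)] a(1)] base_pt_W0_sign(1)[OF w(1) a(1)] a(2) w(1) by (auto simp: b_def)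
    have "(\<Sum>b\<in>\<Phi>. \<bar>crossing w (w b)\<bar>) = (\<Sum>b\<in>\<Phi>. \<bar>crossing d (d b)\<bar>)"
      using len_crossings[OF W0_WE[OF w(1)]] len_crossings[OF W0_WE[OF d(1)]] w(2) cr[OF w(1)] cr[OF d(1)] by simp
    then have "\<bar>crossing w (w b)\<bar> = \<bar>crossing d (d b)\<bar>"
      by (rule sum_mono_inv[OF _ le[OF w(1)] b(1) finite_roots])
    then have "\<not> pr \<rho> a > 0" using W0_crossing[OF w(1) b(1)] one[OF b(1)] b by auto
    then show "pr (d base_pt) a > 0" using d(2) a(1) base_pt_bounds(2,4)[OF a(1)] by auto
  qed
  have "w0 = d" unfolding longest_def
    by (rule the_equality) (use d(1) max uniq in \<open>auto intro: le_antisym\<close>)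
  then show "w0 \<in> W0" "b \<in> \<Phi> \<Longrightarrow> pr \<rho> b > 0 \<Longrightarrow> pr \<rho> (w0 b) < 0"
    "w \<in> W0 \<Longrightarrow> lgt w \<le> lgt w0" "w \<in> W0 \<Longrightarrow> lgt w = lgt w0 \<Longrightarrow> w = w0"
    using d neg max uniq by auto
qed

section \<open>Minimal coset representatives\<close>

text \<open>A finite element has nonpositive crossing number at every positive root, so by
  \<open>len_add_iff\<close> this sign condition gives additivity of lengths with the whole finite
  group; \<open>min_reps_iff\<close> shows that \<open>w0\<close> alone detects it.\<close>

definition min_reps :: "('v \<Rightarrow> 'v) set" where
  "min_reps = {g \<in> WE. \<forall>b\<in>\<Phi>. pr \<rho> b > 0 \<longrightarrow> crossing g (lin g b) \<le> 0}"

lemma min_reps_WE: "y \<in> min_reps \<Longrightarrow> y \<in> WE"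
  by (simp add: min_reps_def)

lemma len_min_reps: assumes "w \<in> W0" "y \<in> min_reps" shows "lgt (w \<odot> y) = lgt w + lgt y"
proof -
  have wy: "w \<in> WE" "y \<in> WE" using assms W0_WE min_reps_WE by auto
  have pos: "0 \<le> crossing w b * crossing y (lin y b)" if b: "b \<in> \<Phi>" "pr \<rho> b > 0" for b
  proof -
    have "crossing w (w (inv w b)) \<le> 0"
      using W0_crossing[OF assms(1) W0_root[OF W0_inv[OF assms(1)] b(1)]] b(2) assms(1) by simp
    moreover have "crossing y (lin y b) \<le> 0" using assms(2) b by (simp add: min_reps_def)
    ultimately show ?thesis using assms(1) by (simp add: mult_nonpos_nonpos)
  qed
  have "0 \<le> crossing w b * crossing y (lin y b)" if b: "b \<in> \<Phi>" for b
  proof (cases "pr \<rho> b > 0")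
    case False
    then have "pr \<rho> (- b) > 0" using root_height_nonzero[OF b] by simp
    then have "0 \<le> crossing w (- b) * crossing y (lin y (- b))" by (rule pos[OF minus_root[OF b]])
    then show ?thesis
      using crossing_minus[OF wy(1) b] crossing_minus[OF wy(2) W0_root[OF WE_E(1)[OF wy(2)] b]]
        W0_linear_simps(3)[OF WE_E(1)[OF wy(2)]] by simp
  qed (rule pos[OF b])
  then show ?thesis using len_add_iff[OF wy] by blast
qed

lemma min_reps_iff:
  assumes "y \<in> WE" shows "y \<in> min_reps \<longleftrightarrow> lgt (w0 \<odot> y) = lgt w0 + lgt y"
proof
  assume eq: "lgt (w0 \<odot> y) = lgt w0 + lgt y"
  have "crossing y (lin y b) \<le> 0" if b: "b \<in> \<Phi>" "pr \<rho> b > 0" for b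
  proof -
    define c where "c = inv w0 b"
    have c: "c \<in> \<Phi>" "w0 c = b" using W0_root[OF W0_inv[OF longest_props(1)] b(1)] longest_props(1) by (auto simp: c_def)
    have "\<not> pr \<rho> c > 0" using longest_props(2)[OF c(1)] c(2) b(2) by auto
    then have "crossing w0 b = -1" using W0_crossing[OF longest_props(1) c(1)] c(2) b(2) by simp
    moreover have "0 \<le> crossing w0 b * crossing y (lin y b)"
      using eq len_add_iff[OF W0_WE[OF longest_props(1)] assms] b(1) by blast
    ultimately show ?thesis by simp
  qed
  then show "y \<in> min_reps" using assms by (simp add: min_reps_def)
qed (rule len_min_reps[OF longest_props(1)])

lemma inv_longest: "inv w0 = w0"
  using longest_props(4)[OF W0_inv[OF longest_props(1)]] len_inv[OF W0_WE[OF longest_props(1)]] by simp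

lemma X0_WE: "x \<in> X0 n \<Phi> \<alpha> \<Longrightarrow> x \<in> WE"
  by (simp add: X0_def)

text \<open>Inversion preserves length and exchanges the two sides, so statements about
  \<open>min_reps\<close> carry over to \<open>X0\<close>.\<close>

lemma inv_X0_iff: assumes "x \<in> WE" shows "x \<in> X0 n \<Phi> \<alpha> \<longleftrightarrow> inv x \<in> min_reps"
proof -
  have w0: "w0 \<in> WE" using W0_WE[OF longest_props(1)] .
  have "inv (x \<odot> w0) = w0 \<odot> inv x" using inv_fcomp[OF assms w0] inv_longest by simp
  then have "lgt (x \<odot> w0) = lgt (w0 \<odot> inv x)" using len_inv[OF WE_fcomp[OF assms w0]] by simp
  then show ?thesis using min_reps_iff[OF WE_inverse(2)[OF assms]] assms len_inv[OF assms] by (auto simp: X0_def)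
qed

lemma inv_X0: "inv ` X0 n \<Phi> \<alpha> = min_reps"
proof
  show "inv ` X0 n \<Phi> \<alpha> \<subseteq> min_reps" using inv_X0_iff X0_WE by blast
  show "min_reps \<subseteq> inv ` X0 n \<Phi> \<alpha>"
  proof
    fix y assume y: "y \<in> min_reps"
    then have "inv y \<in> X0 n \<Phi> \<alpha>" using inv_X0_iff[OF WE_inverse(2)[OF min_reps_WE[OF y]]] min_reps_WE by simp
    then show "y \<in> inv ` X0 n \<Phi> \<alpha>" using WE_inv_inv[OF min_reps_WE[OF y]] by (metis imageI)
  qed
qed

lemma len_X0: assumes "x \<in> X0 n \<Phi> \<alpha>" "w \<in> W0" shows "lgt (x \<odot> w) = lgt x + lgt w"
proof -
  have x: "x \<in> WE" "w \<in> WE" using assms X0_WE W0_WE by auto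
  have "lgt (x \<odot> w) = lgt (inv w \<odot> inv x)" using len_inv[OF WE_fcomp[OF x]] inv_fcomp[OF x] by simp
  also have "\<dots> = lgt (inv w) + lgt (inv x)"
    using len_min_reps[OF W0_inv[OF assms(2)]] inv_X0_iff[OF x(1)] assms(1) by blast
  finally show ?thesis using len_inv x by simp
qed


section \<open>The nearest alcove at a weight\<close>

lemma exists_min_rep: assumes "\<mu> \<in> P" shows "\<exists>d\<in>W0. \<forall>a\<in>\<Phi>. pr (d base_pt) a > 0 \<longleftrightarrow> pr base_pt a > pr \<mu> a"
proof -
  have "pr (base_pt - \<mu>) a \<noteq> 0" if a: "a \<in> \<Phi>" for a
  proof -
    have "pr base_pt a \<notin> \<int>" using base_pt_nonint[OF id_WE a] by (simp add: id_apply)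
    moreover have "pr \<mu> a \<in> \<int>" using assms a by (simp add: weights_pr)
    ultimately show ?thesis by auto
  qed
  then show ?thesis using exists_chamber[of "base_pt - \<mu>"] by simp
qed

text \<open>The alcoves at the vertex \<open>\<mu>\<close> that are images of the fundamental one
  placed there are indexed by the finite group. The one chosen here faces \<open>base_pt\<close>,
  hence is nearest to the fundamental alcove.\<close>

definition rep_dir :: "'v \<Rightarrow> 'v \<Rightarrow> 'v" where
  "rep_dir \<mu> = (SOME d. d \<in> W0 \<and> (\<forall>a\<in>\<Phi>. pr (d base_pt) a > 0 \<longleftrightarrow> pr base_pt a > pr \<mu> a))"

definition min_rep :: "'v \<Rightarrow> 'v \<Rightarrow> 'v" where "min_rep \<mu> = rep_dir \<mu> \<odot> transl \<mu>"

lemma rep_dir: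
  assumes "\<mu> \<in> P"
  shows "rep_dir \<mu> \<in> W0" "a \<in> \<Phi> \<Longrightarrow> pr (rep_dir \<mu> base_pt) a > 0 \<longleftrightarrow> pr base_pt a > pr \<mu> a"
  using someI_ex[of "\<lambda>d. d \<in> W0 \<and> (\<forall>a\<in>\<Phi>. pr (d base_pt) a > 0 \<longleftrightarrow> pr base_pt a > pr \<mu> a)"]
    exists_min_rep[OF assms] unfolding rep_dir_def by blast+

lemma min_rep_WE: "\<mu> \<in> P \<Longrightarrow> min_rep \<mu> \<in> WE"
  unfolding min_rep_def using rep_dir(1) WE_I by blast

lemma lin_min_rep: "\<mu> \<in> P \<Longrightarrow> lin (min_rep \<mu>) = rep_dir \<mu>"
  unfolding min_rep_def using lin_fcomp[OF W0_WE transl_WE] rep_dir(1) by simp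

lemma min_rep_0: "\<mu> \<in> P \<Longrightarrow> min_rep \<mu> 0 = \<mu>"
  unfolding min_rep_def using rep_dir(1) by (simp add: fcomp_apply W0_linear_simps)

text \<open>For a positive root the fundamental alcove lies in strip 0. A vertex on hyperplane m is
  approached from the near side, that is from strip m - 1 if m is at least 1 and from strip m
  otherwise. Negative roots give the mirror image.\<close>

definition min_cross :: "int \<Rightarrow> bool \<Rightarrow> int" where
  "min_cross m pos = (if pos then (if m \<ge> 1 then m - 1 else m) else (if m \<le> -1 then m + 1 else m))"

lemma weight_int: assumes "\<mu> \<in> P" "a \<in> \<Phi>" obtains m where "pr \<mu> a = of_int m" "\<lfloor>pr \<mu> a\<rfloor> = m"
  using assms by (auto simp: weights_pr elim!: Ints_cases dest!: bspec)

lemma rep_dir_sign: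
  assumes "\<mu> \<in> P" "a \<in> \<Phi>"
  shows "pr (rep_dir \<mu> base_pt) a > 0 \<longleftrightarrow> (if pr \<rho> a > 0 then \<lfloor>pr \<mu> a\<rfloor> \<le> 0 else \<lfloor>pr \<mu> a\<rfloor> \<le> -1)"
proof -
  have "pr base_pt a > pr \<mu> a \<longleftrightarrow> (if pr \<rho> a > 0 then \<lfloor>pr \<mu> a\<rfloor> \<le> 0 else \<lfloor>pr \<mu> a\<rfloor> \<le> -1)"
  proof (rule weight_int[OF assms])
    fix m assume "pr \<mu> a = of_int m" "\<lfloor>pr \<mu> a\<rfloor> = m"
    then show ?thesis using base_pt_bounds[OF assms(2)] by (simp; linarith)
  qed
  then show ?thesis using rep_dir(2)[OF assms] by simp
qed

lemma crossing_min_rep: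
  assumes "\<mu> \<in> P" "a \<in> \<Phi>" shows "crossing (min_rep \<mu>) a = min_cross \<lfloor>pr \<mu> a\<rfloor> (pr \<rho> a > 0)"
proof -
  let ?m = "\<lfloor>pr \<mu> a\<rfloor>" and ?d = "pr (rep_dir \<mu> base_pt) a"
  have "pr (min_rep \<mu> base_pt) a = ?d + of_int ?m"
    by (rule weight_int[OF assms]) (simp add: min_rep_def fcomp_apply)
  then have "\<lfloor>pr (min_rep \<mu> base_pt) a\<rfloor> = \<lfloor>?d\<rfloor> + ?m" by simp
  moreover have "\<lfloor>?d\<rfloor> = (if ?d > 0 then 0 else -1)"
    using base_pt_W0_sign(2,3)[OF rep_dir(1)[OF assms(1)] assms(2)] by (auto simp: floor_eq_iff)
  ultimately show ?thesis unfolding crossing_def floor_base[OF assms(2)] min_cross_def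
    using rep_dir_sign[OF assms] by auto
qed

lemma min_rep_min_reps: assumes "\<mu> \<in> P" shows "min_rep \<mu> \<in> min_reps"
proof -
  have "crossing (min_rep \<mu>) (rep_dir \<mu> b) \<le> 0" if b: "b \<in> \<Phi>" "pr \<rho> b > 0" for b
  proof -
    have rb: "rep_dir \<mu> b \<in> \<Phi>" using W0_root[OF rep_dir(1)[OF assms] b(1)] .
    have "pr (rep_dir \<mu> base_pt) (rep_dir \<mu> b) > 0"
      using W0_pr[OF rep_dir(1)[OF assms]] base_pt_bounds(2)[OF b(1)] b(2) by simp
    then show ?thesis using rep_dir_sign[OF assms rb] crossing_min_rep[OF assms rb]
      by (auto simp: min_cross_def split: if_splits)
  qed
  then show ?thesis using min_rep_WE[OF assms] lin_min_rep[OF assms] by (simp add: min_reps_def)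
qed

lemma WE_eqI: "g \<in> WE \<Longrightarrow> h \<in> WE \<Longrightarrow> lin g = lin h \<Longrightarrow> g 0 = h 0 \<Longrightarrow> g = h"
proof
  fix x assume "g \<in> WE" "h \<in> WE" "lin g = lin h" "g 0 = h 0"
  then show "g x = h x" using WE_E(3)[of g x] WE_E(3)[of h x] by simp
qed

text \<open>The sign condition says that the alcove, seen from its vertex \<open>y 0\<close>, faces
  the fundamental one, and this leaves a single choice.\<close>

lemma min_reps_unique: assumes "y \<in> min_reps" shows "y = min_rep (y 0)"
proof -
  have y: "y \<in> WE" using assms min_reps_WE by blast
  have \<mu>: "y 0 \<in> P" and e: "lin y \<in> W0" using WE_E(1,2)[OF y] by auto
  have "lin y = rep_dir (y 0)"
  proof (rule W0_sign_eq[OF e rep_dir(1)[OF \<mu>]])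
    fix a assume a: "a \<in> \<Phi>" "pr (lin y base_pt) a > 0"
    define b where "b = inv (lin y) a"
    have b: "b \<in> \<Phi>" "pr \<rho> b > 0" "lin y b = a"
      using W0_root[OF W0_inv[OF e] a(1)] base_pt_W0_sign(1)[OF e a(1)] a(2) e by (auto simp: b_def)
    have "crossing y a \<le> 0" using assms b unfolding min_reps_def by force
    moreover have "pr (y base_pt) a = pr (lin y base_pt) a + of_int \<lfloor>pr (y 0) a\<rfloor>"
      unfolding WE_E(3)[OF y, of base_pt] by (rule weight_int[OF \<mu> a(1)]) simp
    then have "\<lfloor>pr (y base_pt) a\<rfloor> = \<lfloor>pr (lin y base_pt) a\<rfloor> + \<lfloor>pr (y 0) a\<rfloor>" by simp
    moreover have "\<lfloor>pr (lin y base_pt) a\<rfloor> \<ge> 0" using a(2) by simp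
    ultimately have "\<lfloor>pr (y 0) a\<rfloor> \<le> \<lfloor>pr base_pt a\<rfloor>" unfolding crossing_def by linarith
    then show "pr (rep_dir (y 0) base_pt) a > 0"
      using rep_dir_sign[OF \<mu> a(1)] floor_base[OF a(1)] by (auto split: if_splits)
  qed
  then show ?thesis by (intro WE_eqI[OF y min_rep_WE[OF \<mu>]]) (simp_all add: lin_min_rep \<mu> min_rep_0)
qed

text \<open>The finite factor acts first and fixes the origin, so \<open>g 0\<close> labels the
  coset of \<open>g\<close>.\<close>

lemma coset_decomp:
  assumes "g \<in> WE" shows "\<exists>w\<in>W0. g = w \<odot> min_rep (g 0)"
proof -
  have \<mu>: "g 0 \<in> P" using WE_E(2)[OF assms] .
  let ?w = "lin g \<odot> inv (rep_dir (g 0))"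
  have d: "rep_dir (g 0) \<in> WE" using W0_WE rep_dir(1)[OF \<mu>] by blast
  have "?w \<odot> min_rep (g 0) = lin g \<odot> transl (g 0)"
    by (simp only: min_rep_def fcomp_assoc WE_inv_simps(4)[OF d])
  also have "\<dots> = g" by (rule ext) (simp add: fcomp_apply WE_E(3)[OF assms, symmetric])
  finally show ?thesis using W0_fcomp[OF WE_E(1)[OF assms] W0_inv[OF rep_dir(1)[OF \<mu>]]] by metis
qed

lemma coset_unique:
  assumes "v \<in> W0" "w \<in> W0" "x \<in> min_reps" "y \<in> min_reps" "v \<odot> x = w \<odot> y"
  shows "v = w" "x = y"
proof -
  have "(v \<odot> x) 0 = x 0" "(w \<odot> y) 0 = y 0" using assms(1,2) by (simp_all add: fcomp_apply W0_linear_simps)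
  then show "x = y" using min_reps_unique assms by metis
  then have "v \<odot> x \<odot> inv x = w \<odot> x \<odot> inv x" using assms(5) by simp
  then show "v = w" using WE_inv_simps(1)[OF min_reps_WE[OF assms(3)]] by (simp add: fcomp_assoc)
qed

section \<open>Minuscule weights\<close>

definition antidominant :: "'v \<Rightarrow> bool" where
  "antidominant \<mu> \<longleftrightarrow> \<mu> \<in> P \<and> (\<forall>a\<in>\<Phi>. pr \<rho> a > 0 \<longrightarrow> pr \<mu> a \<le> 0)"

lemma antidominant_iff: "\<mu> \<in> antidominant_weights n \<Phi> \<alpha> \<longleftrightarrow> antidominant \<mu>"
proof -
  have "\<mu> \<in> antidominant_weights n \<Phi> \<alpha> \<longleftrightarrow> - \<mu> \<in> dominant_weights n \<Phi> \<alpha>"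
    unfolding antidominant_weights_def by force
  also have "\<dots> \<longleftrightarrow> antidominant \<mu>"
    using weights_minus[of \<mu>] weights_minus[of "- \<mu>"]
    by (auto simp: antidominant_def dominant_weights_def pos_root_iff pairing_root)
  finally show ?thesis .
qed

lemma antidominant_simple: "antidominant \<mu> \<longleftrightarrow> \<mu> \<in> P \<and> (\<forall>i\<in>{1..n}. pr \<mu> (\<alpha> i) \<le> 0)"
proof
  assume "antidominant \<mu>"
  then show "\<mu> \<in> P \<and> (\<forall>i\<in>{1..n}. pr \<mu> (\<alpha> i) \<le> 0)" using simple_in pr_rho by (simp add: antidominant_def)
next
  assume *: "\<mu> \<in> P \<and> (\<forall>i\<in>{1..n}. pr \<mu> (\<alpha> i) \<le> 0)"
  then have "0 \<le> pr (- \<mu>) a" if "a \<in> \<Phi>" "pr \<rho> a > 0" for a using pr_pos_root_bounds(1)[of "- \<mu>"] that by simp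
  then show "antidominant \<mu>" using * by (simp add: antidominant_def)
qed

lemma antidominant_weight: "antidominant \<mu> \<Longrightarrow> \<mu> \<in> P"
  by (simp add: antidominant_def)

lemma crossing_transl: "a \<in> \<Phi> \<Longrightarrow> \<mu> \<in> P \<Longrightarrow> crossing (transl \<mu>) a = \<lfloor>pr \<mu> a\<rfloor>"
  using floor_add_weight[of \<mu> a base_pt] by (simp add: crossing_def add.commute)

lemma transl_min_reps: "antidominant \<mu> \<Longrightarrow> transl \<mu> \<in> min_reps"
  using transl_WE crossing_transl by (auto simp: min_reps_def antidominant_def id_apply floor_le_iff)

lemma min_rep_antidominant: "antidominant \<mu> \<Longrightarrow> min_rep \<mu> = transl \<mu>"
  using min_reps_unique[OF transl_min_reps, of \<mu>] by simp

lemma crossings_transl: "\<mu> \<in> P \<Longrightarrow> crossings (transl \<mu>) = (\<Sum>a\<in>\<Phi>. \<bar>\<lfloor>pr \<mu> a\<rfloor>\<bar>)"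
  unfolding crossings_def by (simp add: crossing_transl)

lemma len_transl_W0:
  assumes "w \<in> W0" "\<mu> \<in> P" shows "lgt (transl (w \<mu>)) = lgt (transl \<mu>)"
proof -
  have "(\<Sum>a\<in>\<Phi>. \<bar>\<lfloor>pr (w \<mu>) a\<rfloor>\<bar>) = (\<Sum>a\<in>\<Phi>. \<bar>\<lfloor>pr (w \<mu>) (w a)\<rfloor>\<bar>)"
    by (rule sum_W0[OF assms(1), symmetric])
  then have "crossings (transl (w \<mu>)) = crossings (transl \<mu>)"
    using crossings_transl assms weights_W0 W0_pr[OF assms(1)] by simp
  then show ?thesis using len_crossings[OF transl_WE] assms weights_W0 by (metis mult_cancel_left of_nat_eq_iff zero_neq_numeral)
qed

definition minuscule :: "'v \<Rightarrow> bool" where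
  "minuscule \<mu> \<longleftrightarrow> \<mu> \<in> P \<and> (\<forall>a\<in>\<Phi>. \<bar>\<lfloor>pr \<mu> a\<rfloor>\<bar> \<le> 1)"

lemma minuscule_weight: "minuscule \<mu> \<Longrightarrow> \<mu> \<in> P"
  by (simp add: minuscule_def)

lemma minuscule_W0: "minuscule \<mu> \<Longrightarrow> w \<in> W0 \<Longrightarrow> minuscule (w \<mu>)"
  using weights_W0 W0_pr_inv W0_root[OF W0_inv] by (simp add: minuscule_def)

text \<open>A pairing 1 with a positive root contributes no crossing to
  \<open>min_rep \<mu>\<close>, so for minuscule weights all its crossing numbers at positive roots
  are nonpositive, like those of \<open>y\<close>. A pairing of 2 would already spoil the
  sign.\<close>

lemma len_min_rep_fcomp:
  assumes "minuscule \<mu>" "y \<in> min_reps" shows "lgt (min_rep \<mu> \<odot> y) = lgt (min_rep \<mu>) + lgt y"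
proof -
  have y: "y \<in> WE" "min_rep \<mu> \<in> WE" using assms min_reps_WE min_rep_WE minuscule_weight by auto
  have pos: "0 \<le> crossing (min_rep \<mu>) b * crossing y (lin y b)" if b: "b \<in> \<Phi>" "pr \<rho> b > 0" for b
  proof -
    have "crossing y (lin y b) \<le> 0" using assms(2) b by (simp add: min_reps_def)
    moreover have "\<bar>\<lfloor>pr \<mu> b\<rfloor>\<bar> \<le> 1" using assms(1) b(1) by (simp add: minuscule_def)
    then have "crossing (min_rep \<mu>) b \<le> 0"
      using crossing_min_rep[OF minuscule_weight[OF assms(1)] b(1)] b(2) by (auto simp: min_cross_def)
    ultimately show ?thesis by (simp add: mult_nonpos_nonpos)
  qed
  have "0 \<le> crossing (min_rep \<mu>) b * crossing y (lin y b)" if b: "b \<in> \<Phi>" for b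
  proof (cases "pr \<rho> b > 0")
    case False
    then have "pr \<rho> (- b) > 0" using root_height_nonzero[OF b] by simp
    then have "0 \<le> crossing (min_rep \<mu>) (- b) * crossing y (lin y (- b))" by (rule pos[OF minus_root[OF b]])
    then show ?thesis
      using crossing_minus[OF y(2) b] crossing_minus[OF y(1) W0_root[OF WE_E(1)[OF y(1)] b]]
        W0_linear_simps(3)[OF WE_E(1)[OF y(1)]] by simp
  qed (rule pos[OF b])
  then show ?thesis using len_add_iff[OF y(2,1)] by blast
qed

text \<open>Root by root, the crossings lost in reducing \<open>min_rep \<mu> \<odot> y\<close> to the minimal representative of its
  coset are accounted for by crossings of the translation by \<open>\<mu>\<close> that \<open>min_rep \<mu>\<close> does not make.
  Here \<open>t\<close> and \<open>l\<close> are the pairings of the two weights with a root, \<open>s'\<close> and \<open>s\<close> the signs of that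
  root before and after applying the direction of \<open>y\<close>.\<close>

lemma min_cross_ineq:
  assumes "\<bar>t\<bar> \<le> 1" "s' \<longleftrightarrow> (if s then l \<le> 0 else l \<le> -1)"
  shows "\<bar>min_cross t s' + min_cross l s - min_cross (t + l) s\<bar> + \<bar>min_cross t s'\<bar> \<le> \<bar>t\<bar>"
proof -
  have "t = -1 \<or> t = 0 \<or> t = 1" using assms(1) by linarith
  then show ?thesis using assms(2) unfolding min_cross_def by (elim disjE) (auto split: if_splits)
qed

text \<open>The case in which \<open>y\<close> is a translation: its linear part is the identity, so
  both signs agree. The right side is the antidominance condition at one root.\<close>

lemma min_cross_eq_iff:
  assumes "\<bar>t\<bar> \<le> 1" "s \<longleftrightarrow> (if s then l \<le> 0 else l \<le> -1)"
  shows "\<bar>min_cross t s + min_cross l s - min_cross (t + l) s\<bar> + \<bar>min_cross t s\<bar> = \<bar>t\<bar> \<longleftrightarrow>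
    (if s then t + l \<le> 0 else t + l \<ge> 0)"
proof -
  have "t = -1 \<or> t = 0 \<or> t = 1" using assms(1) by linarith
  then show ?thesis using assms(2) unfolding min_cross_def by (elim disjE) (auto split: if_splits)
qed

text \<open>By the cocycle rule the crossings of \<open>w\<close> are the difference between those
  of the product and those of \<open>min_rep \<kappa>\<close>. Reindexing by \<open>lin y\<close>
  expresses each summand through two pairings. In the third claim, \<open>lin y\<close> is the
  direction of the nearest alcove at \<open>y 0\<close>, which ties the sign of \<open>b\<close> to
  that of its image.\<close>

lemma crossings_loss:
  assumes \<mu>: "\<mu> \<in> P" and y: "y \<in> min_reps" and w: "w \<in> W0" and eq: "min_rep \<mu> \<odot> y = w \<odot> min_rep \<kappa>" and \<kappa>: "\<kappa> \<in> P"
  shows "\<kappa> = lin y \<mu> + y 0"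
    "crossings w = (\<Sum>b\<in>\<Phi>. \<bar>min_cross \<lfloor>pr \<mu> b\<rfloor> (pr \<rho> b > 0) + min_cross \<lfloor>pr (y 0) (lin y b)\<rfloor> (pr \<rho> (lin y b) > 0)
       - min_cross (\<lfloor>pr \<mu> b\<rfloor> + \<lfloor>pr (y 0) (lin y b)\<rfloor>) (pr \<rho> (lin y b) > 0)\<bar>)"
    "b \<in> \<Phi> \<Longrightarrow> pr \<rho> b > 0 \<longleftrightarrow> (if pr \<rho> (lin y b) > 0 then \<lfloor>pr (y 0) (lin y b)\<rfloor> \<le> 0 else \<lfloor>pr (y 0) (lin y b)\<rfloor> \<le> -1)"
proof -
  have yW: "y \<in> WE" using y min_reps_WE by blast
  have e: "lin y \<in> W0" and \<nu>: "y 0 \<in> P" using WE_E(1,2)[OF yW] by auto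
  have ye: "y = min_rep (y 0)" using min_reps_unique[OF y] .
  have dir: "lin y = rep_dir (y 0)" using lin_min_rep[OF \<nu>] ye by simp
  show \<kappa>_eq: "\<kappa> = lin y \<mu> + y 0"
  proof -
    have "(w \<odot> min_rep \<kappa>) 0 = \<kappa>" using w \<kappa> by (simp add: fcomp_apply W0_linear_simps min_rep_0)
    moreover have "(min_rep \<mu> \<odot> y) 0 = y \<mu>" using \<mu> by (simp add: fcomp_apply min_rep_0)
    ultimately show ?thesis using eq WE_E(3)[OF yW, of \<mu>] by simp
  qed
  define f where "f a = crossing (min_rep \<mu> \<odot> y) a - crossing (min_rep \<kappa>) a" for a
  have kW: "min_rep \<kappa> \<in> WE" "rep_dir \<kappa> \<in> W0" "w \<in> WE" "min_rep \<mu> \<in> WE"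
    using min_rep_WE rep_dir(1) \<kappa> \<mu> W0_WE[OF w] by auto
  have "crossing w b = f (rep_dir \<kappa> b)" if "b \<in> \<Phi>" for b
    using crossing_fcomp[OF kW(3,1) that] eq lin_min_rep[OF \<kappa>] by (simp add: f_def)
  then have "crossings w = (\<Sum>b\<in>\<Phi>. \<bar>f (rep_dir \<kappa> b)\<bar>)" unfolding crossings_def by simp
  also have "\<dots> = (\<Sum>b\<in>\<Phi>. \<bar>f (lin y b)\<bar>)"
    using sum_W0[OF kW(2), of "\<lambda>a. \<bar>f a\<bar>"] sum_W0[OF e, of "\<lambda>a. \<bar>f a\<bar>"] by simp
  also have "\<dots> = (\<Sum>b\<in>\<Phi>. \<bar>min_cross \<lfloor>pr \<mu> b\<rfloor> (pr \<rho> b > 0) + min_cross \<lfloor>pr (y 0) (lin y b)\<rfloor> (pr \<rho> (lin y b) > 0)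
       - min_cross (\<lfloor>pr \<mu> b\<rfloor> + \<lfloor>pr (y 0) (lin y b)\<rfloor>) (pr \<rho> (lin y b) > 0)\<bar>)"
  proof (rule sum.cong[OF refl])
    fix b assume b: "b \<in> \<Phi>"
    have eb: "lin y b \<in> \<Phi>" using W0_root[OF e b] .
    have "\<lfloor>pr \<kappa> (lin y b)\<rfloor> = \<lfloor>pr (lin y \<mu>) (lin y b)\<rfloor> + \<lfloor>pr (y 0) (lin y b)\<rfloor>"
      unfolding \<kappa>_eq by (rule floor_add_weight[OF weights_W0[OF \<mu> e] eb])
    then have "\<lfloor>pr \<kappa> (lin y b)\<rfloor> = \<lfloor>pr \<mu> b\<rfloor> + \<lfloor>pr (y 0) (lin y b)\<rfloor>" using W0_pr[OF e] by simp
    then show "\<bar>f (lin y b)\<bar> = \<bar>min_cross \<lfloor>pr \<mu> b\<rfloor> (pr \<rho> b > 0) + min_cross \<lfloor>pr (y 0) (lin y b)\<rfloor> (pr \<rho> (lin y b) > 0)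
       - min_cross (\<lfloor>pr \<mu> b\<rfloor> + \<lfloor>pr (y 0) (lin y b)\<rfloor>) (pr \<rho> (lin y b) > 0)\<bar>"
      using crossing_fcomp[OF kW(4) yW b] crossing_min_rep[OF \<mu> b] crossing_min_rep[OF \<kappa> eb]
        crossing_min_rep[OF \<nu> eb] ye by (simp add: f_def)
  qed
  finally show "crossings w = (\<Sum>b\<in>\<Phi>. \<bar>min_cross \<lfloor>pr \<mu> b\<rfloor> (pr \<rho> b > 0) + min_cross \<lfloor>pr (y 0) (lin y b)\<rfloor> (pr \<rho> (lin y b) > 0)
       - min_cross (\<lfloor>pr \<mu> b\<rfloor> + \<lfloor>pr (y 0) (lin y b)\<rfloor>) (pr \<rho> (lin y b) > 0)\<bar>)" .
  show "pr \<rho> b > 0 \<longleftrightarrow> (if pr \<rho> (lin y b) > 0 then \<lfloor>pr (y 0) (lin y b)\<rfloor> \<le> 0 else \<lfloor>pr (y 0) (lin y b)\<rfloor> \<le> -1)"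
    if b: "b \<in> \<Phi>"
    using rep_dir_sign[OF \<nu> W0_root[OF e b]] W0_pr[OF e, of base_pt b] base_pt_bounds(2)[OF b] dir by simp
qed

lemma min_rep_crossings:
  assumes "\<mu> \<in> P" shows "crossings (min_rep \<mu>) = (\<Sum>b\<in>\<Phi>. \<bar>min_cross \<lfloor>pr \<mu> b\<rfloor> (pr \<rho> b > 0)\<bar>)"
  unfolding crossings_def using crossing_min_rep[OF assms] by simp

lemma len_loss_le:
  assumes \<mu>: "minuscule \<mu>" and y: "y \<in> min_reps" and w: "w \<in> W0" and eq: "min_rep \<mu> \<odot> y = w \<odot> min_rep \<kappa>" and \<kappa>: "\<kappa> \<in> P"
  shows "lgt w + lgt (min_rep \<mu>) \<le> lgt (transl \<mu>)"
proof -
  have \<mu>P: "\<mu> \<in> P" using \<mu> minuscule_weight by blast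
  note loss = crossings_loss[OF \<mu>P y w eq \<kappa>]
  have "crossings w + crossings (min_rep \<mu>) \<le> (\<Sum>b\<in>\<Phi>. \<bar>\<lfloor>pr \<mu> b\<rfloor>\<bar>)"
    unfolding loss(2) min_rep_crossings[OF \<mu>P] sum.distrib[symmetric]
    by (rule sum_mono, rule min_cross_ineq) (use \<mu> loss(3) in \<open>auto simp: minuscule_def\<close>)
  then show ?thesis
    using len_crossings[OF W0_WE[OF w]] len_crossings[OF min_rep_WE[OF \<mu>P]] len_crossings[OF transl_WE[OF \<mu>P]]
      crossings_transl[OF \<mu>P] by linarith
qed

text \<open>The estimate is a sum of nonnegative defects, so equality holds exactly when
  \<open>min_cross_eq_iff\<close> applies at every root.\<close>

lemma len_loss_eq_iff:
  assumes \<mu>: "minuscule \<mu>" and \<nu>: "antidominant \<nu>" and w: "w \<in> W0" and eq: "min_rep \<mu> \<odot> transl \<nu> = w \<odot> min_rep \<kappa>" and \<kappa>: "\<kappa> \<in> P"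
  shows "lgt w + lgt (min_rep \<mu>) = lgt (transl \<mu>) \<longleftrightarrow> antidominant (\<nu> + \<mu>)"
proof -
  have \<mu>P: "\<mu> \<in> P" using \<mu> minuscule_weight by blast
  have \<nu>P: "\<nu> \<in> P" using \<nu> antidominant_weight by blast
  note loss = crossings_loss[OF \<mu>P transl_min_reps[OF \<nu>] w eq \<kappa>]
  define f where "f b = \<bar>\<lfloor>pr \<mu> b\<rfloor>\<bar> - \<bar>min_cross \<lfloor>pr \<mu> b\<rfloor> (pr \<rho> b > 0)\<bar> -
    \<bar>min_cross \<lfloor>pr \<mu> b\<rfloor> (pr \<rho> b > 0) + min_cross \<lfloor>pr \<nu> b\<rfloor> (pr \<rho> b > 0) - min_cross (\<lfloor>pr \<mu> b\<rfloor> + \<lfloor>pr \<nu> b\<rfloor>) (pr \<rho> b > 0)\<bar>" for b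
  have "crossings (transl \<mu>) - crossings (min_rep \<mu>) - crossings w = (\<Sum>b\<in>\<Phi>. f b)"
    unfolding loss(2) min_rep_crossings[OF \<mu>P] crossings_transl[OF \<mu>P] f_def
    by (simp add: sum_subtractf id_apply)
  then have "lgt w + lgt (min_rep \<mu>) = lgt (transl \<mu>) \<longleftrightarrow> (\<Sum>b\<in>\<Phi>. f b) = 0"
    using len_crossings[OF W0_WE[OF w]] len_crossings[OF min_rep_WE[OF \<mu>P]] len_crossings[OF transl_WE[OF \<mu>P]]
    by linarith
  also have "\<dots> \<longleftrightarrow> (\<forall>b\<in>\<Phi>. f b = 0)"
  proof (rule sum_nonneg_eq_0_iff[OF finite_roots])
    fix b assume b: "b \<in> \<Phi>"
    have "\<bar>min_cross \<lfloor>pr \<mu> b\<rfloor> (pr \<rho> b > 0) + min_cross \<lfloor>pr \<nu> b\<rfloor> (pr \<rho> b > 0) - min_cross (\<lfloor>pr \<mu> b\<rfloor> + \<lfloor>pr \<nu> b\<rfloor>) (pr \<rho> b > 0)\<bar>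
      + \<bar>min_cross \<lfloor>pr \<mu> b\<rfloor> (pr \<rho> b > 0)\<bar> \<le> \<bar>\<lfloor>pr \<mu> b\<rfloor>\<bar>"
      by (rule min_cross_ineq) (use \<mu> b loss(3)[OF b] in \<open>auto simp: minuscule_def id_apply\<close>)
    then show "0 \<le> f b" by (simp add: f_def)
  qed
  also have "\<dots> \<longleftrightarrow> (\<forall>b\<in>\<Phi>. if pr \<rho> b > 0 then \<lfloor>pr \<mu> b\<rfloor> + \<lfloor>pr \<nu> b\<rfloor> \<le> 0 else \<lfloor>pr \<mu> b\<rfloor> + \<lfloor>pr \<nu> b\<rfloor> \<ge> 0)"
  proof (rule ball_cong[OF refl])
    fix b assume b: "b \<in> \<Phi>"
    have "f b = 0 \<longleftrightarrow> \<bar>min_cross \<lfloor>pr \<mu> b\<rfloor> (pr \<rho> b > 0) + min_cross \<lfloor>pr \<nu> b\<rfloor> (pr \<rho> b > 0) - min_cross (\<lfloor>pr \<mu> b\<rfloor> + \<lfloor>pr \<nu> b\<rfloor>) (pr \<rho> b > 0)\<bar>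
      + \<bar>min_cross \<lfloor>pr \<mu> b\<rfloor> (pr \<rho> b > 0)\<bar> = \<bar>\<lfloor>pr \<mu> b\<rfloor>\<bar>" unfolding f_def by linarith
    also have "\<dots> \<longleftrightarrow> (if pr \<rho> b > 0 then \<lfloor>pr \<mu> b\<rfloor> + \<lfloor>pr \<nu> b\<rfloor> \<le> 0 else \<lfloor>pr \<mu> b\<rfloor> + \<lfloor>pr \<nu> b\<rfloor> \<ge> 0)"
      by (rule min_cross_eq_iff) (use \<mu> b loss(3)[OF b] in \<open>auto simp: minuscule_def id_apply\<close>)
    finally show "f b = 0 \<longleftrightarrow> (if pr \<rho> b > 0 then \<lfloor>pr \<mu> b\<rfloor> + \<lfloor>pr \<nu> b\<rfloor> \<le> 0 else \<lfloor>pr \<mu> b\<rfloor> + \<lfloor>pr \<nu> b\<rfloor> \<ge> 0)" .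
  qed
  also have "\<dots> \<longleftrightarrow> (\<forall>b\<in>\<Phi>. if pr \<rho> b > 0 then pr (\<nu> + \<mu>) b \<le> 0 else pr (\<nu> + \<mu>) b \<ge> 0)"
  proof (rule ball_cong[OF refl])
    fix b assume b: "b \<in> \<Phi>"
    have "pr (\<nu> + \<mu>) b = of_int (\<lfloor>pr \<mu> b\<rfloor> + \<lfloor>pr \<nu> b\<rfloor>)"
      by (rule weight_int[OF \<mu>P b], rule weight_int[OF \<nu>P b]) simp
    then show "(if pr \<rho> b > 0 then \<lfloor>pr \<mu> b\<rfloor> + \<lfloor>pr \<nu> b\<rfloor> \<le> 0 else \<lfloor>pr \<mu> b\<rfloor> + \<lfloor>pr \<nu> b\<rfloor> \<ge> 0) \<longleftrightarrow>
      (if pr \<rho> b > 0 then pr (\<nu> + \<mu>) b \<le> 0 else pr (\<nu> + \<mu>) b \<ge> 0)"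
      by (simp only: of_int_le_0_iff of_int_0_le_iff)
  qed
  also have "\<dots> \<longleftrightarrow> antidominant (\<nu> + \<mu>)"
  proof
    assume A: "antidominant (\<nu> + \<mu>)"
    show "\<forall>b\<in>\<Phi>. if pr \<rho> b > 0 then pr (\<nu> + \<mu>) b \<le> 0 else pr (\<nu> + \<mu>) b \<ge> 0"
    proof
      fix b assume b: "b \<in> \<Phi>"
      show "if pr \<rho> b > 0 then pr (\<nu> + \<mu>) b \<le> 0 else pr (\<nu> + \<mu>) b \<ge> 0"
      proof (cases "pr \<rho> b > 0")
        case True
        then show ?thesis using A b unfolding antidominant_def by simp
      next
        case False
        then have "pr \<rho> (- b) > 0" using root_height_nonzero[OF b] by simp
        then have "pr (\<nu> + \<mu>) (- b) \<le> 0" using A minus_root[OF b] unfolding antidominant_def by blast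
        then show ?thesis using False by simp
      qed
    qed
  next
    assume "\<forall>b\<in>\<Phi>. if pr \<rho> b > 0 then pr (\<nu> + \<mu>) b \<le> 0 else pr (\<nu> + \<mu>) b \<ge> 0"
    then show "antidominant (\<nu> + \<mu>)" using weights_add[OF \<nu>P \<mu>P] unfolding antidominant_def by metis
  qed
  finally show ?thesis .
qed

text \<open>At a simple left descent of \<open>w\<close>, antidominance of \<open>\<mu>\<close> and
  of \<open>w \<mu>\<close> bound the same pairing from both sides. So the simple reflection fixes
  \<open>\<mu>\<close> and can be split off.\<close>

lemma antidominant_unique:
  assumes "antidominant \<mu>" "w \<in> W0" "antidominant (w \<mu>)" shows "w \<mu> = \<mu>"
proof -
  have "\<forall>w. w \<in> W0 \<longrightarrow> lgt w = N \<longrightarrow> antidominant (w \<mu>) \<longrightarrow> w \<mu> = \<mu>" for N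
  proof (induction N rule: less_induct)
    case (less N)
    show ?case
    proof (intro allI impI)
      fix w assume w: "w \<in> W0" "lgt w = N" "antidominant (w \<mu>)"
      show "w \<mu> = \<mu>"
      proof (cases "w = id")
        case False
        then obtain i where i: "i \<in> {1..n}" "pr \<rho> (w (\<alpha> i)) < 0" "lgt w = lgt (refl_in (\<alpha> i) 0 \<odot> w) + 1"
          using W0_left_descent[OF w(1)] by blast
        have wa: "w (\<alpha> i) \<in> \<Phi>" using W0_root[OF w(1) simple_in[OF i(1)]] .
        have "pr \<mu> (\<alpha> i) \<le> 0" using assms(1) i(1) antidominant_simple by blast
        moreover have "pr \<rho> (- w (\<alpha> i)) > 0" using i(2) by simp
        then have "pr (w \<mu>) (- w (\<alpha> i)) \<le> 0"
          using w(3) minus_root[OF wa] unfolding antidominant_def by blast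
        then have "pr \<mu> (\<alpha> i) \<ge> 0" using W0_pr[OF w(1), of \<mu> "\<alpha> i"] by simp
        ultimately have "refl_in (\<alpha> i) 0 \<mu> = \<mu>" using refl_simple[OF i(1)] by simp
        then have "(refl_in (\<alpha> i) 0 \<odot> w) \<mu> = w \<mu>" by (simp add: fcomp_apply)
        moreover have "lgt (refl_in (\<alpha> i) 0 \<odot> w) < N" using i(3) w(2) by simp
        then have "antidominant ((refl_in (\<alpha> i) 0 \<odot> w) \<mu>) \<longrightarrow> (refl_in (\<alpha> i) 0 \<odot> w) \<mu> = \<mu>"
          using less W0_fcomp[OF W0_refl[OF i(1)] w(1)] by blast
        ultimately show ?thesis using w(3) by simp
      qed (simp add: id_apply)
    qed
  qed
  then show ?thesis using assms by blast
qed

lemma rep_dir_antidominant: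
  assumes "minuscule \<mu>" shows "antidominant (inv (rep_dir \<mu>) \<mu>)"
proof -
  have \<mu>: "\<mu> \<in> P" using assms minuscule_weight by blast
  let ?d = "rep_dir \<mu>"
  have d: "?d \<in> W0" using rep_dir(1)[OF \<mu>] .
  have "pr (inv ?d \<mu>) b \<le> 0" if b: "b \<in> \<Phi>" "pr \<rho> b > 0" for b
  proof -
    have db: "?d b \<in> \<Phi>" using W0_root[OF d b(1)] .
    have eq: "pr (inv ?d \<mu>) b = pr \<mu> (?d b)" using W0_pr[OF d, of "inv ?d \<mu>" b] d by simp
    have "pr (?d base_pt) (?d b) > 0" using W0_pr[OF d] base_pt_bounds(2)[OF b(1)] b(2) by simp
    then have le: "\<lfloor>pr \<mu> (?d b)\<rfloor> \<le> 0" using rep_dir_sign[OF \<mu> db] by (auto split: if_splits) linarith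
    obtain m where "pr \<mu> (?d b) = of_int m" "\<lfloor>pr \<mu> (?d b)\<rfloor> = m" by (rule weight_int[OF \<mu> db])
    then show ?thesis unfolding eq using le by simp
  qed
  then show ?thesis using weights_W0[OF \<mu> W0_inv[OF d]] by (simp add: antidominant_def)
qed

text \<open>The pairing is the coefficient of \<open>\<alpha> i\<close> in the root, and positive
  roots of type A are sums of distinct consecutive simple roots.\<close>

lemma fund_weight_pr:
  assumes "i \<in> {1..n}" "a \<in> \<Phi>" "pr \<rho> a > 0"
  shows "pr (fund_weight n \<alpha> i) a = 0 \<or> pr (fund_weight n \<alpha> i) a = 1"
proof -
  obtain p q where pq: "1 \<le> p" "p < q" "q \<le> Suc n" "a = eps p - eps q" using assms pos_root_cases by metis
  have "pr (fund_weight n \<alpha> i) a = (\<Sum>k = p..<q. pr (fund_weight n \<alpha> i) (\<alpha> k))"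
    unfolding pq(4) eps_diff_sum[OF pq(1) less_imp_le[OF pq(2)]] by (rule pr_sum(2))
  also have "\<dots> = (\<Sum>k = p..<q. if i = k then 1 else 0)"
    by (rule sum.cong[OF refl], rule pr_fund_weight) (use pq in auto)
  also have "\<dots> = 0 \<or> \<dots> = 1" by (simp add: sum.delta)
  finally show ?thesis .
qed

lemma fund_weight_minuscule: assumes "i \<in> {1..n}" shows "minuscule (fund_weight n \<alpha> i)"
proof -
  let ?w = "fund_weight n \<alpha> i"
  have "pr ?w a \<in> {-1, 0, 1}" if a: "a \<in> \<Phi>" for a
  proof (cases "pr \<rho> a > 0")
    case True
    then show ?thesis using fund_weight_pr[OF assms a] by auto
  next
    case False
    then have "pr \<rho> (- a) > 0" using root_height_nonzero[OF a] by simp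
    then show ?thesis using fund_weight_pr[OF assms minus_root[OF a]] by auto
  qed
  then have *: "pr ?w a = -1 \<or> pr ?w a = 0 \<or> pr ?w a = 1" if "a \<in> \<Phi>" for a using that by blast
  have "pr ?w a \<in> \<int>" "\<bar>\<lfloor>pr ?w a\<rfloor>\<bar> \<le> 1" if a: "a \<in> \<Phi>" for a
  proof -
    obtain m :: int where "pr ?w a = of_int m" "\<bar>m\<bar> \<le> 1"
      using *[OF a] by (metis abs_minus_cancel abs_one abs_zero of_int_0 of_int_1 of_int_minus order_refl zero_le_one)
    then show "pr ?w a \<in> \<int>" "\<bar>\<lfloor>pr ?w a\<rfloor>\<bar> \<le> 1" by auto
  qed
  then show ?thesis by (simp add: minuscule_def weights_pr)
qed

definition dominant :: "'v \<Rightarrow> bool" where "dominant \<mu> \<longleftrightarrow> antidominant (- \<mu>)"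

lemma fund_weight_dominant: "i \<in> {1..n} \<Longrightarrow> dominant (fund_weight n \<alpha> i)"
  using pr_fund_weight weights_minus[OF minuscule_weight[OF fund_weight_minuscule]]
  by (simp add: dominant_def antidominant_simple)

lemma dominant_pr: "dominant \<mu> \<Longrightarrow> a \<in> \<Phi> \<Longrightarrow> pr \<rho> a > 0 \<Longrightarrow> pr \<mu> a \<ge> 0"
  by (auto simp: dominant_def antidominant_def)

lemma transl_inv: "\<mu> \<in> P \<Longrightarrow> inv (transl \<mu>) = transl (- \<mu>)"
  by (rule inv_equality) auto

lemma transl_X0: assumes "dominant \<mu>" shows "transl \<mu> \<in> X0 n \<Phi> \<alpha>"
proof -
  have \<mu>: "\<mu> \<in> P" using weights_minus[OF antidominant_weight] assms unfolding dominant_def by fastforce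
  then show ?thesis using inv_X0_iff[OF transl_WE[OF \<mu>]] transl_inv[OF \<mu>] transl_min_reps assms
    unfolding dominant_def by simp
qed

text \<open>A dominant minuscule weight is a vertex of the closed fundamental alcove, so the nearest
  alcove there is the fundamental one. This supplies the elements of length zero used for weight
  functions and for bar invariance.\<close>

lemma len_min_rep_dominant:
  assumes "minuscule \<mu>" "dominant \<mu>" shows "lgt (min_rep \<mu>) = 0"
proof -
  have \<mu>: "\<mu> \<in> P" using assms minuscule_weight by blast
  have "crossing (min_rep \<mu>) a = 0" if "a \<in> \<Phi>" for a
  proof (rule crossing_eq_pos[OF min_rep_WE[OF \<mu>] that])
    fix a assume a: "a \<in> \<Phi>" "pr \<rho> a > 0"
    have "0 \<le> \<lfloor>pr \<mu> a\<rfloor>" "\<bar>\<lfloor>pr \<mu> a\<rfloor>\<bar> \<le> 1" using dominant_pr[OF assms(2) a] assms(1) a(1) by (auto simp: minuscule_def)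
    then have "\<lfloor>pr \<mu> a\<rfloor> = 0 \<or> \<lfloor>pr \<mu> a\<rfloor> = 1" by linarith
    moreover have "min_cross 0 True = 0" "min_cross 1 True = 0" by (simp_all add: min_cross_def)
    ultimately show "crossing (min_rep \<mu>) a = 0" using crossing_min_rep[OF \<mu> a(1)] a(2) by metis
  qed simp
  then show ?thesis using len_0_iff[OF min_rep_WE[OF \<mu>]] crossings_0_iff by blast
qed

section \<open>Weight functions\<close>

text \<open>This is what forces a weight function to take the same value on all generators.\<close>

lemma affine_reflection_conj:
  assumes i: "i \<in> {1..n}"
  defines "\<pi> \<equiv> min_rep (fund_weight n \<alpha> i)"
  shows "\<pi> \<odot> refl_in (\<alpha> i) 0 \<odot> inv \<pi> = aff_refl \<theta>"
proof -
  let ?s = "refl_in (\<alpha> i) 0" and ?\<omega> = "fund_weight n \<alpha> i"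
  have \<omega>: "minuscule ?\<omega>" "dominant ?\<omega>" "?\<omega> \<in> P"
    using fund_weight_minuscule fund_weight_dominant minuscule_weight i by auto
  have \<pi>: "\<pi> \<in> WE" "lgt \<pi> = 0" "\<pi> 0 = ?\<omega>"
    using min_rep_WE[OF \<omega>(3)] len_min_rep_dominant[OF \<omega>(1,2)] min_rep_0[OF \<omega>(3)] by (auto simp: \<pi>_def)
  have s: "?s \<in> S" "?s \<in> WE" using simple_S i S_aff_WE by auto
  have d: "lin \<pi> \<in> W0" using WE_E(1)[OF \<pi>(1)] .
  define a where "a = inv (lin \<pi>) (\<alpha> i)"
  have a: "a \<in> \<Phi>" "lin \<pi> a = \<alpha> i" using W0_root[OF W0_inv[OF d] simple_in[OF i]] d by (auto simp: a_def)
  define r where "r = \<pi> \<odot> ?s \<odot> inv \<pi>"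
  \<comment> \<open>The conjugated reflection no longer fixes the origin: \<open>\<pi>\<close> sends
    0 to the fundamental weight, which pairs to 1 with \<open>\<alpha> i\<close>, and this is where
    the level -1 comes from.\<close>
  have r_eq: "r = refl_in a (-1)"
  proof
    fix x
    have "\<pi> (refl_in a (-1) x) = lin \<pi> (refl_in a (-1) x) + \<pi> 0" by (rule WE_E(3)[OF \<pi>(1)])
    also have "\<dots> = lin \<pi> x + \<pi> 0 - (pr x a + 1) *\<^sub>R \<alpha> i"
      using a d by (simp add: refl_pr W0_linear_simps)
    also have "\<dots> = \<pi> x - (pr x a + 1) *\<^sub>R \<alpha> i" using WE_E(3)[OF \<pi>(1), of x] by simp
    also have "pr x a + 1 = pr (\<pi> x) (\<alpha> i)"
    proof -
      have "pr (\<pi> x) (\<alpha> i) = pr (lin \<pi> x) (lin \<pi> a) + pr ?\<omega> (\<alpha> i)"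
        unfolding WE_E(3)[OF \<pi>(1), of x] using a(2) \<pi>(3) by simp
      then show ?thesis using W0_pr[OF d] pr_fund_weight[OF i] by simp
    qed
    finally have "\<pi> (refl_in a (-1) x) = ?s (\<pi> x)" by (simp add: refl_simple[OF i])
    then show "r x = refl_in a (-1) x" using WE_inv_simps(5)[OF \<pi>(1), of "refl_in a (-1) x"]
      by (simp add: r_def fcomp_apply)
  qed
  have rW: "r \<in> W_aff n \<Phi> \<alpha>"
  proof (cases "pr \<rho> a > 0")
    case True
    then have "a \<in> pos_roots n \<Phi> \<alpha>" using a pos_root_iff by blast
    then show ?thesis unfolding r_eq W_aff_def by (intro generated_base) blast
  next
    case False
    then have "- a \<in> pos_roots n \<Phi> \<alpha>" using a root_height_nonzero[OF a(1)] minus_root by (simp add: pos_root_iff)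
    moreover have "refl_in a (-1) x = refl_in (- a) 1 x" for x
      using refl_pr[OF a(1), of "-1" x] refl_pr[OF minus_root[OF a(1)], of 1 x]
      by (simp add: algebra_simps) (metis add_left_cancel add_right_cancel)
    then have "refl_in a (-1) = refl_in (- a) 1" by (rule ext)
    ultimately show ?thesis unfolding r_eq W_aff_def by (intro generated_base) blast
  qed
  have len_r: "lgt r = 1"
    unfolding r_def using len_0_fcomp(1)[OF \<pi>(1) s(2) \<pi>(2)] len_0_fcomp(2)[OF WE_inverse(2)[OF \<pi>(1)] WE_fcomp[OF \<pi>(1) s(2)]]
      len_inv[OF \<pi>(1)] \<pi>(2) len_S[OF s(1)] by simp
  then have "crossings r \<noteq> 0" using len_0_iff[OF W_aff_WE[OF rW]] by simp
  then obtain b where b: "b \<in> aff_simple" "crossing r b \<ge> 1" using exists_descent W_aff_WE[OF rW] by blast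
  have bS: "aff_refl b \<in> S" using b S_aff_eq by blast
  have "crossings (r \<odot> aff_refl b) = 0"
    using crossings_step[OF W_aff_WE[OF rW] b(1)] b(2) len_crossings[OF W_aff_WE[OF rW]] len_r by simp
  then have "r \<odot> aff_refl b = id"
    using W_aff_crossings_0 W_aff_fcomp[OF rW S_aff_W_aff[OF bS]] by blast
  then have "r = aff_refl b" using S_involution(3)[OF bS, of r] by simp
  \<comment> \<open>Among the generators, \<open>aff_refl \<theta>\<close> is the only one that
    moves the origin.\<close>
  moreover have "b = \<theta>"
  proof (rule ccontr)
    assume "b \<noteq> \<theta>"
    then have "aff_refl b 0 = 0" using refl_pr[OF aff_simple_root[OF b(1)], of 0 0] by (simp add: aff_refl_def)
    moreover have "r 0 = - a" unfolding r_eq using refl_pr[OF a(1), of "-1" 0] by simp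
    ultimately show False using \<open>r = aff_refl b\<close> a(1) zero_not_root by auto
  qed
  ultimately show ?thesis by (simp add: r_def)
qed

text \<open>Conjugation by elements of length zero does not change the value: a left factor is
  removed by invariance, a right one by additivity. So all generators share one value, and
  additivity along reduced words does the rest.\<close>

lemma weight_function_multiple:
  assumes L: "positive_weight_function n \<Phi> \<alpha> L"
  shows "\<exists>c>0. \<forall>g\<in>WE. L g = c * lgt g"
proof -
  have add: "L (g \<odot> h) = L g + L h" if "g \<in> WE" "h \<in> WE" "lgt (g \<odot> h) = lgt g + lgt h" for g h
    using L that unfolding positive_weight_function_def by blast
  have left: "L (g \<odot> h) = L h" if "g \<in> WE" "lgt g = 0" "h \<in> WE" for g h
    using L that Pi_iff len_0_iff unfolding positive_weight_function_def by blast
  have L0: "L w = 0 \<longleftrightarrow> w = id" if "w \<in> W_aff n \<Phi> \<alpha>" for w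
    using L that unfolding positive_weight_function_def by simp
  have zero: "L g = 0" if "g \<in> WE" "lgt g = 0" for g
    using left[OF that id_WE] L0[OF id_W_aff] by simp
  define c where "c = L (aff_refl \<theta>)"
  have \<theta>S: "aff_refl \<theta> \<in> S" using S_aff_eq unfolding aff_simple_def by blast
  have simple: "L (refl_in (\<alpha> i) 0) = c" if i: "i \<in> {1..n}" for i
  proof -
    let ?s = "refl_in (\<alpha> i) 0" and ?\<omega> = "fund_weight n \<alpha> i"
    let ?\<pi> = "min_rep ?\<omega>"
    have \<omega>: "minuscule ?\<omega>" "dominant ?\<omega>" "?\<omega> \<in> P"
      using fund_weight_minuscule fund_weight_dominant minuscule_weight i by auto
    have \<pi>: "?\<pi> \<in> WE" "lgt ?\<pi> = 0" "inv ?\<pi> \<in> WE" "lgt (inv ?\<pi>) = 0"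
      using min_rep_WE[OF \<omega>(3)] len_min_rep_dominant[OF \<omega>(1,2)] WE_inverse len_inv by auto
    have s: "?s \<in> WE" using simple_S[OF i] S_aff_WE by blast
    have "c = L (?\<pi> \<odot> (?s \<odot> inv ?\<pi>))"
      unfolding c_def affine_reflection_conj[OF i, symmetric] by (simp add: fcomp_assoc)
    also have "\<dots> = L (?s \<odot> inv ?\<pi>)" by (rule left[OF \<pi>(1,2) WE_fcomp[OF s \<pi>(3)]])
    also have "\<dots> = L ?s + L (inv ?\<pi>)"
      by (rule add[OF s \<pi>(3)]) (use len_0_fcomp(2)[OF \<pi>(3) s \<pi>(4)] \<pi>(4) in simp)
    finally show ?thesis using zero[OF \<pi>(3,4)] by simp
  qed
  have S: "L s = c" if s: "s \<in> S" for s
  proof -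
    obtain b where b: "b \<in> aff_simple" "s = aff_refl b" using s S_aff_eq by blast
    then consider i where "i \<in> {1..n}" "b = - \<alpha> i" | "b = \<theta>" unfolding aff_simple_def by blast
    then show ?thesis
    proof cases
      case 1
      then show ?thesis unfolding b(2) 1(2) aff_refl_simple[OF 1(1)] using simple by blast
    next
      case 2
      then show ?thesis unfolding b(2) c_def by simp
    qed
  qed
  have "\<forall>g. g \<in> WE \<longrightarrow> lgt g = N \<longrightarrow> L g = c * lgt g" for N
  proof (induction N)
    case 0
    then show ?case using zero by auto
  next
    case (Suc N)
    show ?case
    proof (intro allI impI)
      fix g assume g: "g \<in> WE" "lgt g = Suc N"
      then obtain s where s: "s \<in> S" "lgt g = lgt (s \<odot> g) + 1" using left_descent[OF g(1)] by auto
      have sg: "s \<odot> g \<in> WE" using WE_fcomp S_aff_WE s g by blast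
      have "g = s \<odot> (s \<odot> g)" using S_involution(2)[OF s(1)] by simp
      then have "L g = L s + L (s \<odot> g)"
        using add[OF S_aff_WE[OF s(1)] sg] len_S[OF s(1)] s(2) by simp
      also have "\<dots> = c + c * lgt (s \<odot> g)" using S[OF s(1)] Suc sg g s(2) by auto
      finally show "L g = c * lgt g" using s(2) by simp
    qed
  qed
  then have "\<forall>g\<in>WE. L g = c * lgt g" by blast
  moreover have "c > 0"
  proof -
    have "aff_refl \<theta> \<noteq> id" using len_S[OF \<theta>S] len_id by auto
    then show ?thesis using L0[OF S_aff_W_aff[OF \<theta>S]] by (simp add: c_def)
  qed
  ultimately show ?thesis by blast
qed

end


section \<open>Laurent polynomials of bounded degree\<close>

abbreviation lookup :: "laurent \<Rightarrow> int \<Rightarrow> complex" where "lookup \<equiv> Poly_Mapping.lookup"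

text \<open>Integrality of the coefficients is included so that degree at most -1 is precisely
  \<open>laurent_neg\<close>.\<close>

definition deg_le :: "int \<Rightarrow> laurent set" where
  "deg_le d = {a. \<forall>k. lookup a k \<in> \<int> \<and> (d < k \<longrightarrow> lookup a k = 0)}"

lemma laurent_neg_deg: "laurent_neg = deg_le (-1)"
  unfolding laurent_neg_def deg_le_def by (intro Collect_cong) force

lemma deg_le_0: "0 \<in> deg_le d"
  by (simp add: deg_le_def)

lemma deg_le_add: "a \<in> deg_le d \<Longrightarrow> b \<in> deg_le d \<Longrightarrow> a + b \<in> deg_le d"
  by (simp add: deg_le_def lookup_add)

lemma deg_le_diff: "a \<in> deg_le d \<Longrightarrow> b \<in> deg_le d \<Longrightarrow> a - b \<in> deg_le d"
  by (simp add: deg_le_def lookup_minus)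

lemma deg_le_sum: "(\<And>i. i \<in> A \<Longrightarrow> f i \<in> deg_le d) \<Longrightarrow> (\<Sum>i\<in>A. f i) \<in> deg_le d"
  by (induction A rule: infinite_finite_induct) (auto simp: deg_le_0 deg_le_add)

lemma deg_le_mono: "a \<in> deg_le d \<Longrightarrow> d \<le> e \<Longrightarrow> a \<in> deg_le e"
  by (auto simp: deg_le_def)

lemma deg_le_single: "c \<in> \<int> \<Longrightarrow> k \<le> d \<Longrightarrow> Poly_Mapping.single k c \<in> deg_le d"
  by (auto simp: deg_le_def lookup_single when_def)

lemma sum_single: "(\<Sum>k\<in>Poly_Mapping.keys a. Poly_Mapping.single k (lookup a k)) = a"
  by (rule poly_mapping_eqI)
    (auto simp: lookup_sum lookup_single when_def in_keys_iff sum.delta' cong: if_cong)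

lemma deg_le_mult: assumes "a \<in> deg_le d" "b \<in> deg_le e" shows "a * b \<in> deg_le (d + e)"
proof -
  have keys: "k \<le> d'" if "x \<in> deg_le d'" "k \<in> Poly_Mapping.keys x" for x k d'
    using that unfolding deg_le_def by (force simp: in_keys_iff)
  have "a * b = (\<Sum>k\<in>Poly_Mapping.keys a. \<Sum>l\<in>Poly_Mapping.keys b.
      Poly_Mapping.single (k + l) (lookup a k * lookup b l))"
    by (subst (1) sum_single[of a, symmetric], subst (1) sum_single[of b, symmetric])
      (simp only: sum_product mult_single)
  also have "\<dots> \<in> deg_le (d + e)"
    by (intro deg_le_sum deg_le_single Ints_mult)
      (use assms keys[OF assms(1)] keys[OF assms(2)] in \<open>auto simp: deg_le_def intro: add_mono\<close>)
  finally show ?thesis .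
qed

lemma qpow_add: "qpow (k + l) = qpow k * qpow l"
  by (simp add: qpow_def mult_single)

lemma qpow_0: "qpow 0 = 1"
  by (simp add: qpow_def)

lemma qpow_deg_le: "k \<le> d \<Longrightarrow> qpow k \<in> deg_le d"
  unfolding qpow_def by (rule deg_le_single) auto

lemma lookup_qpow: "lookup (qpow k) l = (if k = l then 1 else 0)"
  by (simp add: qpow_def lookup_single when_def)

lemma lookup_bar: "lookup (bar_laurent a) k = lookup a (- k)"
  unfolding bar_laurent_def using Poly_Mapping.map_key.rep_eq[of uminus a] by (simp add: inj_def)

lemma bar_laurent_simps [simp]:
  "bar_laurent 0 = 0" "bar_laurent 1 = 1" "bar_laurent (qpow k) = qpow (- k)"
  by (rule poly_mapping_eqI; force simp: lookup_bar lookup_qpow lookup_one when_def)+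

lemma bar_fixed_neg:
  assumes "bar_laurent a = a" "a \<in> deg_le (-1)" shows "a = 0"
proof (rule poly_mapping_eqI)
  fix k
  have "lookup a k = lookup a (- k)" using lookup_bar[of a k] assms(1) by simp
  then show "lookup a k = lookup 0 k" using assms(2) unfolding deg_le_def by (cases "k \<ge> 0") auto
qed

section \<open>The Hecke algebra\<close>

locale hecke_setting = type_A n \<Phi> \<alpha>
  for n :: nat and \<Phi> :: "'v::euclidean_space set" and \<alpha> :: "nat \<Rightarrow> 'v" +
  fixes L :: "('v \<Rightarrow> 'v) \<Rightarrow> nat" and scale :: "laurent \<Rightarrow> 'h::ring_1 \<Rightarrow> 'h" and T :: "('v \<Rightarrow> 'v) \<Rightarrow> 'h"
    and br :: "'h \<Rightarrow> 'h" and C :: "('v \<Rightarrow> 'v) \<Rightarrow> 'h" and p :: "('v \<Rightarrow> 'v) \<Rightarrow> ('v \<Rightarrow> 'v) \<Rightarrow> laurent"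
  assumes weight_function: "positive_weight_function n \<Phi> \<alpha> L"
    and hecke: "hecke_algebra n \<Phi> \<alpha> L scale T"
    and bar: "bar_involution n \<Phi> \<alpha> scale T br"
    and kl: "kl_basis n \<Phi> \<alpha> scale T br C"
    and rel_kl: "relative_kl_family n \<Phi> \<alpha> scale T br C p"
begin

sublocale M: module scale
  using hecke unfolding hecke_algebra_def by blast

lemma scale_mult: "scale a x * y = scale a (x * y)" "x * scale a y = scale a (x * y)"
  using hecke unfolding hecke_algebra_def by metis+

lemma T_inj: "inj_on T WE" and T_indep: "M.independent (T ` WE)" and T_span: "M.span (T ` WE) = UNIV"
  using hecke unfolding hecke_algebra_def by auto

lemma T_mult: "g \<in> WE \<Longrightarrow> h \<in> WE \<Longrightarrow> lgt (g \<odot> h) = lgt g + lgt h \<Longrightarrow> T g * T h = T (g \<odot> h)"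
  using hecke unfolding hecke_algebra_def by blast

definition c :: nat where "c = (SOME c. c > 0 \<and> (\<forall>g\<in>WE. L g = c * lgt g))"

lemma c_pos: "c > 0" and L_eq: "g \<in> WE \<Longrightarrow> L g = c * lgt g"
  using someI_ex[of "\<lambda>c. c > 0 \<and> (\<forall>g\<in>WE. L g = c * lgt g)"] weight_function_multiple[OF weight_function]
  unfolding c_def by blast+

text \<open>The powers of the parameter \<open>q ^ c\<close>, where \<open>c\<close> is the common
  value of the weight function on the generators.\<close>

definition v :: "int \<Rightarrow> laurent" where "v k = qpow (int c * k)"

lemma v_add: "v (k + l) = v k * v l"
  by (simp add: v_def distrib_left qpow_add)

lemma v_0 [simp]: "v 0 = 1"
  by (simp add: v_def qpow_0)

lemma v_bar [simp]: "bar_laurent (v k) = v (- k)"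
  by (simp add: v_def)

lemma v_cancel: "v (- k) * v k = 1" "v k * v (- k) = 1"
  using v_add[of k "- k"] by (simp_all add: mult.commute)

lemma v_deg_0: "k \<le> 0 \<Longrightarrow> v k \<in> deg_le 0"
  unfolding v_def by (rule qpow_deg_le) (simp add: mult_nonneg_nonpos)

lemma v_deg_neg: "k < 0 \<Longrightarrow> v k \<in> deg_le (-1)"
  unfolding v_def by (rule qpow_deg_le) (use c_pos mult_pos_neg[of "int c" k] in linarith)

definition \<xi> :: laurent where "\<xi> = v 1 - v (-1)"

lemma T_quadratic: "s \<in> S \<Longrightarrow> T s * T s = 1 + scale \<xi> (T s)"
  using hecke L_eq[OF S_aff_WE, of s] len_S[of s] unfolding hecke_algebra_def \<xi>_def v_def by simp

lemma T_id: "T id = 1"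
proof -
  have "T id * x = x" for x
  proof -
    have "x \<in> M.span (T ` WE)" using T_span by simp
    then show ?thesis
    proof (induction rule: M.span_induct_alt)
      case (step a u y)
      then obtain g where g: "g \<in> WE" "u = T g" by blast
      have "T id * T g = T g" using T_mult[OF id_WE g(1)] len_id by simp
      then show ?case using step g by (simp add: distrib_left scale_mult)
    qed simp
  qed
  from this[of 1] show ?thesis by simp
qed

lemma T_left:
  assumes "s \<in> S" "y \<in> WE"
  shows "T s * T y = T (s \<odot> y) + (if lgt y = lgt (s \<odot> y) + 1 then scale \<xi> (T y) else 0)"
proof (cases "lgt y = lgt (s \<odot> y) + 1")
  case True
  have sy: "s \<odot> y \<in> WE" using WE_fcomp S_aff_WE assms by blast
  have "s \<odot> (s \<odot> y) = y" by (rule S_involution(2)[OF assms(1)])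
  then have Ty: "T s * T (s \<odot> y) = T y"
    using T_mult[OF S_aff_WE[OF assms(1)] sy] True len_S[OF assms(1)] by simp
  then have "T s * T y = (T s * T s) * T (s \<odot> y)" by (simp add: mult.assoc)
  also have "\<dots> = T (s \<odot> y) + scale \<xi> (T y)"
    unfolding T_quadratic[OF assms(1)] by (simp add: distrib_right scale_mult Ty)
  finally show ?thesis using True by simp
next
  case False
  then have "lgt (s \<odot> y) = lgt s + lgt y" using len_S_left[OF assms] len_S[OF assms(1)] by simp
  then show ?thesis using T_mult[OF S_aff_WE[OF assms(1)] assms(2)] False by simp
qed

lemma T_right:
  assumes "s \<in> S" "y \<in> WE"
  shows "T y * T s = T (y \<odot> s) + (if lgt y = lgt (y \<odot> s) + 1 then scale \<xi> (T y) else 0)"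
proof (cases "lgt y = lgt (y \<odot> s) + 1")
  case True
  have sy: "y \<odot> s \<in> WE" using WE_fcomp S_aff_WE assms by blast
  have "y \<odot> s \<odot> s = y" by (rule S_involution(3)[OF assms(1)])
  then have Ty: "T (y \<odot> s) * T s = T y"
    using T_mult[OF sy S_aff_WE[OF assms(1)]] True len_S[OF assms(1)] by simp
  then have "T y * T s = T (y \<odot> s) * (T s * T s)" by (simp add: mult.assoc[symmetric])
  also have "\<dots> = T (y \<odot> s) + scale \<xi> (T y)"
    unfolding T_quadratic[OF assms(1)] by (simp add: distrib_left scale_mult Ty)
  finally show ?thesis using True by simp
next
  case False
  then have "lgt (y \<odot> s) = lgt y + lgt s" using len_S_right[OF assms] len_S[OF assms(1)] by simp
  then show ?thesis using T_mult[OF assms(2) S_aff_WE[OF assms(1)]] False by simp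
qed

section \<open>Coordinates in the standard basis\<close>

definition coef :: "'h \<Rightarrow> ('v \<Rightarrow> 'v) \<Rightarrow> laurent" where
  "coef h w = M.representation (T ` WE) h (T w)"

lemma in_span [simp]: "h \<in> M.span (T ` WE)"
  using T_span by simp

lemma coef_add: "coef (x + y) w = coef x w + coef y w"
  and coef_diff: "coef (x - y) w = coef x w - coef y w"
  and coef_scale: "coef (scale a x) w = a * coef x w"
  and coef_0: "coef 0 w = 0"
  by (simp_all add: coef_def M.representation_add[OF T_indep] M.representation_diff[OF T_indep]
      M.representation_scale[OF T_indep] M.representation_zero)

lemma coef_sum: "coef (\<Sum>i\<in>A. f i) w = (\<Sum>i\<in>A. coef (f i) w)"
  by (simp add: coef_def M.representation_sum[OF T_indep])

lemma coef_T: "g \<in> WE \<Longrightarrow> w \<in> WE \<Longrightarrow> coef (T g) w = (if w = g then 1 else 0)"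
  using M.representation_basis[OF T_indep, of "T g"] T_inj by (auto simp: coef_def inj_on_def)

definition supp :: "'h \<Rightarrow> ('v \<Rightarrow> 'v) set" where "supp h = {w \<in> WE. coef h w \<noteq> 0}"

lemma finite_supp: "finite (supp h)"
proof -
  have "T ` supp h \<subseteq> {b. M.representation (T ` WE) h b \<noteq> 0}" unfolding supp_def coef_def by blast
  then have "finite (T ` supp h)" using M.finite_representation finite_subset by blast
  moreover have "inj_on T (supp h)" by (rule inj_on_subset[OF T_inj]) (auto simp: supp_def)
  ultimately show ?thesis by (rule finite_imageD)
qed

lemma expand: "h = (\<Sum>w\<in>supp h. scale (coef h w) (T w))"
proof -
  have "{b. M.representation (T ` WE) h b \<noteq> 0} = T ` supp h"
    using M.representation_ne_zero[of "T ` WE" h] unfolding supp_def coef_def by blast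
  moreover have "inj_on T (supp h)" by (rule inj_on_subset[OF T_inj]) (auto simp: supp_def)
  ultimately have "(\<Sum>b | M.representation (T ` WE) h b \<noteq> 0. scale (M.representation (T ` WE) h b) b)
      = (\<Sum>w\<in>supp h. scale (coef h w) (T w))"
    by (simp add: sum.reindex coef_def)
  then show ?thesis using M.sum_nonzero_representation_eq[OF T_indep, of h] by simp
qed

lemma coef_eqI: assumes "\<And>w. w \<in> WE \<Longrightarrow> coef x w = coef y w" shows "x = y"
proof -
  have "supp (x - y) = {}" using assms by (auto simp: supp_def coef_diff)
  then show ?thesis using expand[of "x - y"] by simp
qed

text \<open>Semilinear maps are allowed, so that the bar involution is covered together with
  multiplication by a fixed element.\<close>

lemma coef_linear:
  assumes add: "\<And>x y. f (x + y) = f x + f y" and zero: "f 0 = 0" and sc: "\<And>a x. f (scale a x) = scale (g a) (f x)"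
  shows "coef (f h) z = (\<Sum>w\<in>supp h. g (coef h w) * coef (f (T w)) z)"
proof -
  have "f (\<Sum>w\<in>A. scale (coef h w) (T w)) = (\<Sum>w\<in>A. scale (g (coef h w)) (f (T w)))" for A
    by (induction A rule: infinite_finite_induct) (auto simp: zero add sc)
  then have "f h = (\<Sum>w\<in>supp h. scale (g (coef h w)) (f (T w)))" using expand[of h] by metis
  then show ?thesis by (simp add: coef_sum coef_scale)
qed

lemma sum_supp_delta:
  assumes "u \<in> WE" shows "(\<Sum>w\<in>supp h. coef h w * (if w = u then a else 0)) = coef h u * a"
proof -
  have "(\<Sum>w\<in>supp h. coef h w * (if w = u then a else 0)) = (\<Sum>w\<in>supp h. if w = u then coef h w * a else 0)"
    by (rule sum.cong) auto
  also have "\<dots> = coef h u * a" using finite_supp[of h] assms by (auto simp: sum.delta supp_def)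
  finally show ?thesis .
qed

lemma coef_T_left:
  assumes s: "s \<in> S" and z: "z \<in> WE"
  shows "coef (T s * h) z = coef h (s \<odot> z) + (if lgt z = lgt (s \<odot> z) + 1 then \<xi> * coef h z else 0)"
proof -
  have sz: "s \<odot> z \<in> WE" using WE_fcomp S_aff_WE assms by blast
  have inv: "s \<odot> (s \<odot> w) = w" for w :: "'v \<Rightarrow> 'v" by (rule S_involution(2)[OF s])
  have "coef (T s * T w) z = (if w = s \<odot> z then 1 else 0) +
      (if w = z then (if lgt z = lgt (s \<odot> z) + 1 then \<xi> else 0) else 0)" if w: "w \<in> WE" for w
  proof -
    have sw: "s \<odot> w \<in> WE" using WE_fcomp S_aff_WE s w by blast
    have "z = s \<odot> w \<longleftrightarrow> w = s \<odot> z" using inv by metis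
    then show ?thesis unfolding T_left[OF s w]
      by (auto simp: coef_add coef_scale coef_T[OF sw z] coef_T[OF w z] coef_T[OF z z] coef_0)
  qed
  then have "coef (T s * h) z = (\<Sum>w\<in>supp h. coef h w * (if w = s \<odot> z then 1 else 0)) +
      (\<Sum>w\<in>supp h. coef h w * (if w = z then (if lgt z = lgt (s \<odot> z) + 1 then \<xi> else 0) else 0))"
    by (subst coef_linear[where f = "\<lambda>x. T s * x" and g = "\<lambda>a. a"])
      (auto simp: distrib_left scale_mult sum.distrib[symmetric] supp_def intro!: sum.cong)
  then show ?thesis unfolding sum_supp_delta[OF sz] sum_supp_delta[OF z] by (simp add: mult.commute)
qed

lemma coef_T_right:
  assumes s: "s \<in> S" and z: "z \<in> WE"
  shows "coef (h * T s) z = coef h (z \<odot> s) + (if lgt z = lgt (z \<odot> s) + 1 then \<xi> * coef h z else 0)"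
proof -
  have sz: "z \<odot> s \<in> WE" using WE_fcomp S_aff_WE assms by blast
  have inv: "w \<odot> s \<odot> s = w" for w :: "'v \<Rightarrow> 'v" by (rule S_involution(3)[OF s])
  have "coef (T w * T s) z = (if w = z \<odot> s then 1 else 0) +
      (if w = z then (if lgt z = lgt (z \<odot> s) + 1 then \<xi> else 0) else 0)" if w: "w \<in> WE" for w
  proof -
    have sw: "w \<odot> s \<in> WE" using WE_fcomp S_aff_WE s w by blast
    have "z = w \<odot> s \<longleftrightarrow> w = z \<odot> s" using inv by metis
    then show ?thesis unfolding T_right[OF s w]
      by (auto simp: coef_add coef_scale coef_T[OF sw z] coef_T[OF w z] coef_T[OF z z] coef_0)
  qed
  then have "coef (h * T s) z = (\<Sum>w\<in>supp h. coef h w * (if w = z \<odot> s then 1 else 0)) +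
      (\<Sum>w\<in>supp h. coef h w * (if w = z then (if lgt z = lgt (z \<odot> s) + 1 then \<xi> else 0) else 0))"
    by (subst coef_linear[where f = "\<lambda>x. x * T s" and g = "\<lambda>a. a"])
      (auto simp: distrib_right scale_mult sum.distrib[symmetric] supp_def intro!: sum.cong)
  then show ?thesis unfolding sum_supp_delta[OF sz] sum_supp_delta[OF z] by (simp add: mult.commute)
qed

section \<open>The bar involution\<close>

lemma br_simps: "br 1 = 1" "br (x + y) = br x + br y" "br (x * y) = br x * br y" "br (br x) = x"
  "br (scale a x) = scale (bar_laurent a) (br x)"
  using bar unfolding bar_involution_def by auto

lemma br_0: "br 0 = 0"
  using br_simps(2)[of 0 0] by simp

lemma br_diff: "br (x - y) = br x - br y"
  using br_simps(2)[of "x - y" y] by simp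

lemma br_T_inv: "w \<in> WE \<Longrightarrow> br (T w) * T (inv w) = 1" "w \<in> WE \<Longrightarrow> T (inv w) * br (T w) = 1"
  using bar unfolding bar_involution_def by auto

lemma br_T_S: assumes "s \<in> S" shows "br (T s) = T s - scale \<xi> 1"
proof -
  have 1: "T s * br (T s) = 1" using br_T_inv(2)[OF S_aff_WE[OF assms]] S_inv[OF assms] by simp
  have 2: "(T s - scale \<xi> 1) * T s = 1"
    using T_quadratic[OF assms] by (simp add: left_diff_distrib scale_mult)
  have "br (T s) = ((T s - scale \<xi> 1) * T s) * br (T s)" unfolding 2 by simp
  also have "\<dots> = T s - scale \<xi> 1" unfolding mult.assoc 1 by simp
  finally show ?thesis .
qed

lemma br_T_len_0: assumes "g \<in> WE" "lgt g = 0" shows "br (T g) = T g"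
proof -
  have i: "inv g \<in> WE" using WE_inverse(2)[OF assms(1)] .
  have "T (inv g) * T g = 1" using T_mult[OF i assms(1)] assms len_inv[OF assms(1)] len_id T_id by simp
  then have "br (T g) = (br (T g) * T (inv g)) * T g" by (simp add: mult.assoc)
  then show ?thesis using br_T_inv(1)[OF assms(1)] by simp
qed

text \<open>Apart from its leading term, the image of \<open>T g\<close> involves only shorter
  elements. Splitting off a left descent proves this by induction, and comparison by length suffices
  for all uses below.\<close>

lemma br_T_triangular:
  assumes "g \<in> WE" "w \<in> WE" "lgt g \<le> lgt w" shows "coef (br (T g)) w = (if w = g then 1 else 0)"
proof -
  have "\<forall>g. g \<in> WE \<longrightarrow> lgt g = N \<longrightarrow> (\<forall>w\<in>WE. lgt g \<le> lgt w \<longrightarrow> coef (br (T g)) w = (if w = g then 1 else 0))" for N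
  proof (induction N)
    case 0
    then show ?case using br_T_len_0 coef_T by auto
  next
    case (Suc N)
    show ?case
    proof (intro allI impI ballI)
      fix g w assume g: "g \<in> WE" "lgt g = Suc N" and w: "w \<in> WE" "lgt g \<le> lgt w"
      obtain s where s: "s \<in> S" "lgt g = lgt (s \<odot> g) + 1" using left_descent[OF g(1)] g(2) by auto
      define g' where "g' = s \<odot> g"
      have sg: "g' \<in> WE" "lgt g' = N" using WE_fcomp S_aff_WE s g by (auto simp: g'_def)
      have sw: "s \<odot> w \<in> WE" using WE_fcomp S_aff_WE s w by blast
      have gs: "s \<odot> g' = g" unfolding g'_def by (rule S_involution(2)[OF s(1)])
      have "T g = T s * T g'"
        using T_mult[OF S_aff_WE[OF s(1)] sg(1)] len_S[OF s(1)] s(2) gs by (simp add: g'_def)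
      then have eq: "br (T g) = T s * br (T g') - scale \<xi> (br (T g'))"
        by (simp add: br_simps br_T_S[OF s(1)] left_diff_distrib scale_mult)
      have "lgt (s \<odot> w) \<ge> N" using len_S_left[OF s(1) w(1)] w(2) g(2) by auto
      then have 1: "coef (br (T g')) (s \<odot> w) = (if s \<odot> w = g' then 1 else 0)"
        using Suc sg sw by auto
      have "w \<noteq> g'" using sg w g by auto
      then have 2: "coef (br (T g')) w = 0" using Suc sg w g by auto
      have "s \<odot> w = g' \<longleftrightarrow> w = g" using S_involution(2)[OF s(1)] gs by metis
      then show "coef (br (T g)) w = (if w = g then 1 else 0)"
        unfolding eq coef_diff coef_scale coef_T_left[OF s(1) w(1)] 1 2 by simp
    qed
  qed
  then show ?thesis using assms by blast
qed

lemma coef_br_top: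
  assumes "\<And>w. w \<in> WE \<Longrightarrow> coef h w \<noteq> 0 \<Longrightarrow> lgt w \<le> k" "z \<in> WE" "k \<le> lgt z"
  shows "coef (br h) z = bar_laurent (coef h z)"
proof -
  have "coef (br h) z = (\<Sum>w\<in>supp h. bar_laurent (coef h w) * coef (br (T w)) z)"
    by (rule coef_linear) (auto simp: br_simps br_0)
  also have "\<dots> = (\<Sum>w\<in>supp h. if w = z then bar_laurent (coef h w) else 0)"
  proof (rule sum.cong[OF refl])
    fix w assume w: "w \<in> supp h"
    then have "w \<in> WE" "lgt w \<le> lgt z" using assms(1)[of w] assms(3) by (auto simp: supp_def)
    then have "coef (br (T w)) z = (if z = w then 1 else 0)" using br_T_triangular assms(2) by blast
    then show "bar_laurent (coef h w) * coef (br (T w)) z = (if w = z then bar_laurent (coef h w) else 0)" by auto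
  qed
  also have "\<dots> = bar_laurent (coef h z)" using finite_supp[of h] assms(2) by (auto simp: sum.delta supp_def)
  finally show ?thesis .
qed

text \<open>At an element of maximal length in the support the coefficient is itself bar fixed, so
  negative degree makes it vanish. The degree condition is imposed at such maximal elements only,
  because \<open>C_eigen\<close> can verify it only there.\<close>

lemma bar_invariant_0:
  assumes "br h = h"
    and "\<And>w. w \<in> WE \<Longrightarrow> coef h w \<noteq> 0 \<Longrightarrow> (\<And>u. u \<in> WE \<Longrightarrow> coef h u \<noteq> 0 \<Longrightarrow> lgt u \<le> lgt w) \<Longrightarrow> coef h w \<in> deg_le (-1)"
  shows "h = 0"
proof (rule ccontr)
  assume "h \<noteq> 0"
  then have ne: "supp h \<noteq> {}" using expand[of h] by auto
  have "Max (lgt ` supp h) \<in> lgt ` supp h" using finite_supp[of h] ne by (intro Max_in) auto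
  then obtain w where w: "w \<in> supp h" "lgt w = Max (lgt ` supp h)" by auto
  have max: "lgt u \<le> lgt w" if "u \<in> WE" "coef h u \<noteq> 0" for u
    unfolding w(2) using that finite_supp[of h] by (intro Max_ge) (auto simp: supp_def)
  have wW: "w \<in> WE" "coef h w \<noteq> 0" using w(1) by (auto simp: supp_def)
  have "bar_laurent (coef h w) = coef h w"
    using coef_br_top[of h "lgt w" w] max wW(1) assms(1) by simp
  moreover have "coef h w \<in> deg_le (-1)" using assms(2)[OF wW] max by blast
  ultimately show False using bar_fixed_neg wW(2) by blast
qed

section \<open>Congruences modulo negative degrees\<close>

definition lat :: "int \<Rightarrow> 'h set" where "lat d = {h. \<forall>w\<in>WE. coef h w \<in> deg_le d}"

lemma lat_add: "x \<in> lat d \<Longrightarrow> y \<in> lat d \<Longrightarrow> x + y \<in> lat d"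
  and lat_diff: "x \<in> lat d \<Longrightarrow> y \<in> lat d \<Longrightarrow> x - y \<in> lat d"
  by (auto simp: lat_def coef_add coef_diff deg_le_add deg_le_diff)

lemma lat_sum: "(\<And>i. i \<in> A \<Longrightarrow> f i \<in> lat d) \<Longrightarrow> (\<Sum>i\<in>A. f i) \<in> lat d"
  by (simp add: lat_def coef_sum deg_le_sum)

lemma lat_scale: "a \<in> deg_le d \<Longrightarrow> x \<in> lat e \<Longrightarrow> scale a x \<in> lat (d + e)"
  by (simp add: lat_def coef_scale deg_le_mult)

lemma lat_T: "g \<in> WE \<Longrightarrow> T g \<in> lat 0"
  by (simp add: lat_def coef_T deg_le_0 qpow_deg_le[of 0 0, unfolded qpow_0])

lemma bar_invariant_unique:
  assumes "br x = x" "br y = y" "x - y \<in> lat (-1)" shows "x = y"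
proof -
  have "x - y = 0" by (rule bar_invariant_0) (use assms in \<open>auto simp: br_diff lat_def\<close>)
  then show ?thesis by simp
qed

lemma C_bar: "w \<in> WE \<Longrightarrow> br (C w) = C w"
  using kl unfolding kl_basis_def by blast

lemma C_lat: assumes "w \<in> WE" shows "C w - T w \<in> lat (-1)"
proof -
  obtain h where h: "h \<in> neg_span n \<Phi> \<alpha> scale T" "C w = T w + h" using kl assms unfolding kl_basis_def by blast
  then obtain F a where F: "h = (\<Sum>y\<in>F. scale (a y) (T y))" "F \<subseteq> WE" "a ` F \<subseteq> laurent_neg"
    unfolding neg_span_def by blast
  have "h \<in> lat (-1)" unfolding F(1)
  proof (rule lat_sum)
    fix y assume "y \<in> F"
    then have "a y \<in> deg_le (-1)" "T y \<in> lat 0" using F laurent_neg_deg lat_T by blast+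
    then have "scale (a y) (T y) \<in> lat (-1 + 0)" by (rule lat_scale)
    then show "scale (a y) (T y) \<in> lat (-1)" by simp
  qed
  then show ?thesis using h(2) by simp
qed


text \<open>\<open>rel_elem\<close> is a sum over the support of the relative family, and a sum over
  an infinite set would be zero by convention.\<close>

lemma finite_bruhat: "finite {x'. bruhat_le n \<Phi> \<alpha> x' x}"
proof -
  let ?U = "word_prod ` {ss. set ss \<subseteq> S \<and> length ss \<le> lgt x}"
  have "finite S" using finite_roots aff_simple_root unfolding S_aff_eq
    by (meson finite_imageI finite_subset subsetI)
  then have U: "finite ?U" by (intro finite_imageI finite_lists_length_le)
  \<comment> \<open>The length zero part common to \<open>x\<close> and \<open>x'\<close> is
    recovered as \<open>x \<odot> inv u\<close>, so \<open>x'\<close> is determined by two elements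
    that have words of length at most \<open>lgt x\<close>.\<close>
  have "x' \<in> (\<lambda>(u, u'). x \<odot> inv u \<odot> u') ` (?U \<times> ?U)" if le: "bruhat_le n \<Phi> \<alpha> x' x" for x'
  proof -
    obtain \<pi> u u' where *: "\<pi> \<in> Pi_stab n \<Phi> \<alpha>" "u \<in> W_aff n \<Phi> \<alpha>" "u' \<in> W_aff n \<Phi> \<alpha>"
      "x' = \<pi> \<odot> u'" "x = \<pi> \<odot> u" "(bruhat_step n \<Phi> \<alpha>)\<^sup>*\<^sup>* u' u"
      using le unfolding bruhat_le_def by blast
    have \<pi>: "\<pi> \<in> WE" "crossings \<pi> = 0" using *(1) Pi_iff by auto
    have uW: "u \<in> WE" using *(2) W_aff_WE by blast
    have "len_aff n \<Phi> \<alpha> u' \<le> len_aff n \<Phi> \<alpha> u" using *(6)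
      by (induction rule: rtranclp_induct) (auto simp: bruhat_step_def)
    moreover have "crossings u = crossings x" unfolding *(5) using crossings_Pi_fcomp(1)[OF \<pi> uW] by simp
    then have "lgt x = len_aff n \<Phi> \<alpha> u"
      using len_aff_crossings[OF *(2)] len_crossings[OF WE_fcomp[OF \<pi>(1) uW]] *(5) by simp
    ultimately have le': "len_aff n \<Phi> \<alpha> u' \<le> lgt x" "len_aff n \<Phi> \<alpha> u \<le> lgt x" by auto
    have mem: "z \<in> ?U" if z: "z \<in> W_aff n \<Phi> \<alpha>" "len_aff n \<Phi> \<alpha> z \<le> lgt x" for z
    proof -
      obtain ss where ss: "set ss \<subseteq> S" "z = word_prod ss" "crossings z = 2 * int (length ss)"
        using W_aff_word[OF z(1)] by blast
      then have "length ss \<le> lgt x" using len_aff_crossings[OF z(1)] z(2) by linarith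
      then show ?thesis using ss by blast
    qed
    have "x' = x \<odot> inv u \<odot> u'" unfolding *(4,5) using WE_inv_simps(1)[OF uW] by (simp add: fcomp_assoc)
    moreover have "(u, u') \<in> ?U \<times> ?U" using mem[OF *(2) le'(2)] mem[OF *(3) le'(1)] by blast
    ultimately show ?thesis by (intro image_eqI[of _ _ "(u, u')"]) (simp_all only: prod.case)
  qed
  then have "{x'. bruhat_le n \<Phi> \<alpha> x' x} \<subseteq> (\<lambda>(u, u'). x \<odot> inv u \<odot> u') ` (?U \<times> ?U)" by blast
  then show ?thesis by (rule finite_subset[OF _ finite_imageI[OF finite_cartesian_product[OF U U]]])
qed

section \<open>Further facts on cosets, orbits and the longest element\<close>

lemma id_min_reps: "id \<in> min_reps"
  using transl_min_reps[of 0] weights_0 by (simp add: antidominant_def transl_0)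

lemma WE_decomp: "z \<in> WE \<Longrightarrow> \<exists>w\<in>W0. \<exists>y\<in>min_reps. z = w \<odot> y"
  using coset_decomp[of z] min_rep_min_reps[OF WE_E(2), of z] by blast

lemma simple_longest_descent:
  assumes "i \<in> {1..n}" shows "lgt w0 = lgt (refl_in (\<alpha> i) 0 \<odot> w0) + 1"
  using simple_left_descent[OF longest_props(1) assms] longest_props(2)[OF simple_in[OF assms]] pr_rho[OF assms] by simp

lemma orbit_image: "weight_orbit n \<alpha> \<mu> = (\<lambda>w. w \<mu>) ` W0"
  unfolding weight_orbit_def by blast

lemma finite_orbit: "finite (weight_orbit n \<alpha> \<mu>)"
  unfolding orbit_image using finite_W0 by simp

lemma antidominant_longest:
  assumes "dominant \<omega>" "\<omega> \<in> P" shows "antidominant (w0 \<omega>)"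
proof -
  have "pr (w0 \<omega>) b \<le> 0" if b: "b \<in> \<Phi>" "pr \<rho> b > 0" for b
  proof -
    have wb: "w0 b \<in> \<Phi>" using W0_root[OF longest_props(1) b(1)] .
    have "pr \<rho> (- w0 b) > 0" using longest_props(2)[OF b] by simp
    then have "pr \<omega> (- w0 b) \<ge> 0" by (rule dominant_pr[OF assms(1) minus_root[OF wb]])
    moreover have "pr (w0 \<omega>) b = pr \<omega> (w0 b)" using W0_pr_inv[OF longest_props(1)] inv_longest by simp
    ultimately show ?thesis by simp
  qed
  then show ?thesis using weights_W0[OF assms(2) longest_props(1)] by (simp add: antidominant_def)
qed

lemma longest_transl: "w0 \<odot> transl (w0 \<omega>) = transl \<omega> \<odot> w0"
  using W0_linear_simps(1)[OF longest_props(1)] by (simp add: fun_eq_iff fcomp_apply)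

text \<open>The loss estimates for the trivial translation, where the finite factor is the
  identity.\<close>

lemma len_min_rep_le:
  assumes "minuscule \<mu>" shows "lgt (min_rep \<mu>) \<le> lgt (transl \<mu>)"
    "lgt (min_rep \<mu>) = lgt (transl \<mu>) \<longleftrightarrow> antidominant \<mu>"
proof -
  have \<mu>: "\<mu> \<in> P" using assms minuscule_weight by blast
  have ad0: "antidominant 0" using weights_0 by (simp add: antidominant_def)
  have eq: "min_rep \<mu> \<odot> transl 0 = id \<odot> min_rep \<mu>" by (simp add: transl_0)
  show "lgt (min_rep \<mu>) \<le> lgt (transl \<mu>)"
    using len_loss_le[OF assms transl_min_reps[OF ad0] W0_id eq \<mu>] by simp
  show "lgt (min_rep \<mu>) = lgt (transl \<mu>) \<longleftrightarrow> antidominant \<mu>"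
    using len_loss_eq_iff[OF assms ad0 W0_id eq \<mu>] len_id by simp
qed

end

context hecke_setting begin

section \<open>The Kazhdan--Lusztig basis and the finite Weyl group\<close>

lemma C_coef_neg: "w \<in> WE \<Longrightarrow> u \<in> WE \<Longrightarrow> u \<noteq> w \<Longrightarrow> coef (C w) u \<in> deg_le (-1)"
  and C_coef_self: "w \<in> WE \<Longrightarrow> coef (C w) w - 1 \<in> deg_le (-1)"
proof -
  have *: "coef (C w) u - coef (T w) u \<in> deg_le (-1)" if "w \<in> WE" "u \<in> WE" for w u
  proof -
    have "coef (C w - T w) u \<in> deg_le (-1)" using C_lat[OF that(1)] that(2) unfolding lat_def by blast
    then show ?thesis by (simp add: coef_diff)
  qed
  show "w \<in> WE \<Longrightarrow> u \<in> WE \<Longrightarrow> u \<noteq> w \<Longrightarrow> coef (C w) u \<in> deg_le (-1)"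
    using *[of w u] by (simp add: coef_T)
  show "w \<in> WE \<Longrightarrow> coef (C w) w - 1 \<in> deg_le (-1)"
    using *[of w w] by (simp add: coef_T)
qed

lemma one_deg_0: "1 \<in> deg_le 0"
  using qpow_deg_le[of 0 0] by (simp add: qpow_0)

lemma C_coef_le: assumes "w \<in> WE" "u \<in> WE" shows "coef (C w) u \<in> deg_le 0"
proof (cases "u = w")
  case True
  have "coef (C w) w - 1 + 1 \<in> deg_le 0"
    by (rule deg_le_add[OF deg_le_mono[OF C_coef_self[OF assms(1)]] one_deg_0]) simp
  then show ?thesis using True by simp
next
  case False
  then show ?thesis using deg_le_mono[OF C_coef_neg[OF assms False], of 0] by simp
qed

lemma xi_v: "\<xi> - v 1 = - v (-1)" by (simp add: \<xi>_def)

text \<open>The difference \<open>D\<close> of the two sides is bar invariant, by the form of the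
  bar involution on \<open>T s\<close>. It remains to see that its coefficients at maximal elements
  have negative degree.\<close>

lemma C_eigen:
  assumes s: "s \<in> S" and w: "w \<in> WE" and desc: "lgt w = lgt (s \<odot> w) + 1"
  shows "T s * C w = scale (v 1) (C w)"
proof -
  define D where "D = T s * C w - scale (v 1) (C w)"
  have "br D = (T s - scale \<xi> 1) * C w - scale (v (-1)) (C w)"
    by (simp add: D_def br_diff br_simps br_T_S[OF s] C_bar[OF w])
  also have "\<dots> = T s * C w - scale (\<xi> + v (-1)) (C w)"
    by (simp add: left_diff_distrib scale_mult M.scale_left_distrib)
  also have "\<dots> = D" by (simp add: D_def \<xi>_def)
  finally have brD: "br D = D" .
  have coefD: "coef D z = coef (C w) (s \<odot> z) + (if lgt z = lgt (s \<odot> z) + 1 then \<xi> * coef (C w) z else 0) - v 1 * coef (C w) z"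
    if "z \<in> WE" for z
    by (simp add: D_def coef_diff coef_scale coef_T_left[OF s that])
  have down: "coef D z = coef (C w) (s \<odot> z) - v (-1) * coef (C w) z"
    if "z \<in> WE" "lgt z = lgt (s \<odot> z) + 1" for z
  proof -
    have "coef D z = coef (C w) (s \<odot> z) + (\<xi> - v 1) * coef (C w) z"
      using coefD[OF that(1)] that(2) by (simp add: left_diff_distrib)
    then show ?thesis unfolding xi_v by simp
  qed
  \<comment> \<open>On each pair of elements \<open>z\<close> and \<open>s \<odot> z\<close> the
    coefficients of \<open>D\<close> are proportional. Hence a maximal element of the support is
    always the longer one of its pair.\<close>
  have up: "coef D z = - v 1 * coef D (s \<odot> z)" if z: "z \<in> WE" "lgt (s \<odot> z) = lgt z + 1" for z
  proof -
    have sz: "s \<odot> z \<in> WE" using WE_fcomp S_aff_WE s z by blast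
    have ssz: "s \<odot> (s \<odot> z) = z" by (rule S_involution(2)[OF s])
    have "coef D (s \<odot> z) = coef (C w) z - v (-1) * coef (C w) (s \<odot> z)"
      using down[OF sz] z(2) unfolding ssz by simp
    moreover have "coef D z = coef (C w) (s \<odot> z) - v 1 * coef (C w) z" using coefD[OF z(1)] z(2) by simp
    ultimately show ?thesis using v_cancel(2)[of 1] by (simp add: right_diff_distrib mult.assoc[symmetric])
  qed
  have "D = 0"
  proof (rule bar_invariant_0[OF brD])
    fix z assume z: "z \<in> WE" "coef D z \<noteq> 0" and max: "\<And>u. u \<in> WE \<Longrightarrow> coef D u \<noteq> 0 \<Longrightarrow> lgt u \<le> lgt z"
    have sz: "s \<odot> z \<in> WE" using WE_fcomp S_aff_WE s z by blast
    have desc_z: "lgt z = lgt (s \<odot> z) + 1"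
    proof (rule ccontr)
      assume "\<not> ?thesis"
      then have *: "lgt (s \<odot> z) = lgt z + 1" using len_S_left[OF s z(1)] by simp
      then have "coef D (s \<odot> z) \<noteq> 0" using up[OF z(1)] z(2) by auto
      then show False using max[OF sz] * by simp
    qed
    \<comment> \<open>The leading coefficient of \<open>C w\<close> must not enter. It does not,
      since \<open>s\<close> is a descent of both \<open>z\<close> and \<open>w\<close>.\<close>
    have "s \<odot> z \<noteq> w"
    proof
      assume sz: "s \<odot> z = w"
      have "s \<odot> w = z" unfolding sz[symmetric] by (rule S_involution(2)[OF s])
      then show False using desc_z desc unfolding sz by simp
    qed
    then have "coef (C w) (s \<odot> z) \<in> deg_le (-1)" using C_coef_neg[OF w sz] by blast
    moreover have "v (-1) * coef (C w) z \<in> deg_le (-1 + 0)"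
      by (rule deg_le_mult[OF v_deg_neg C_coef_le[OF w z(1)]]) simp
    ultimately show "coef D z \<in> deg_le (-1)" unfolding down[OF z(1) desc_z] by (simp add: deg_le_diff)
  qed
  then show ?thesis by (simp add: D_def)
qed

definition left_eigen :: "'h \<Rightarrow> bool" where
  "left_eigen h \<longleftrightarrow> (\<forall>i\<in>{1..n}. T (refl_in (\<alpha> i) 0) * h = scale (v 1) h)"

text \<open>Comparing coefficients in the eigenvalue equation at \<open>w' \<odot> y\<close>, with
  \<open>w'\<close> one step shorter than \<open>w\<close>, gains one power of \<open>v\<close>. So
  an eigenvector is determined by its values on minimal representatives.\<close>

lemma eigen_coef:
  assumes h: "left_eigen h" and w: "w \<in> W0" and y: "y \<in> min_reps"
  shows "coef h (w \<odot> y) = v (int (lgt w)) * coef h y"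
proof -
  have "\<forall>w. w \<in> W0 \<longrightarrow> lgt w = N \<longrightarrow> coef h (w \<odot> y) = v (int (lgt w)) * coef h y" for N
  proof (induction N)
    case 0
    show ?case
    proof (intro allI impI)
      fix w assume w: "w \<in> W0" "lgt w = 0"
      then have "w = id" using W0_left_descent[OF w(1)] by auto
      then show "coef h (w \<odot> y) = v (int (lgt w)) * coef h y" using w(2) by simp
    qed
  next
    case (Suc N)
    show ?case
    proof (intro allI impI)
      fix w assume w: "w \<in> W0" "lgt w = Suc N"
      then have "w \<noteq> id" using len_id by auto
      then obtain i where i: "i \<in> {1..n}" "lgt w = lgt (refl_in (\<alpha> i) 0 \<odot> w) + 1"
        using W0_left_descent[OF w(1)] by blast
      let ?s = "refl_in (\<alpha> i) 0"
      define w' where "w' = ?s \<odot> w"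
      have s: "?s \<in> S" using simple_S[OF i(1)] .
      have w': "w' \<in> W0" "lgt w' = N" using W0_fcomp[OF W0_refl[OF i(1)] w(1)] i(2) w(2) by (auto simp: w'_def)
      have sw: "?s \<odot> w' = w" unfolding w'_def by (rule S_involution(2)[OF s])
      have z: "w' \<odot> y \<in> WE" using WE_fcomp W0_WE[OF w'(1)] min_reps_WE[OF y] by blast
      have "coef (T ?s * h) (w' \<odot> y) = coef h (w \<odot> y)"
        unfolding coef_T_left[OF s z] using len_min_reps[OF w(1) y] len_min_reps[OF w'(1) y] w(2) w'(2) sw
        by (simp add: fcomp_assoc[symmetric])
      moreover have "coef (T ?s * h) (w' \<odot> y) = v 1 * coef h (w' \<odot> y)"
        using h i(1) by (simp add: left_eigen_def coef_scale)
      ultimately have "coef h (w \<odot> y) = v 1 * (v (int N) * coef h y)" using Suc w' by auto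
      also have "\<dots> = v (int (lgt w)) * coef h y" using v_add[of 1 "int N"] w(2) by (simp add: mult.assoc add.commute)
      finally show "coef h (w \<odot> y) = v (int (lgt w)) * coef h y" .
    qed
  qed
  then show ?thesis using w by blast
qed

text \<open>An explicit formula on which the eigenvector property can be checked from both sides;
  \<open>C_longest\<close> identifies it with the Kazhdan--Lusztig element.\<close>

definition e :: 'h where "e = (\<Sum>w\<in>W0. scale (v (int (lgt w) - int (lgt w0))) (T w))"

lemma coef_e: "z \<in> WE \<Longrightarrow> coef e z = (if z \<in> W0 then v (int (lgt z) - int (lgt w0)) else 0)"
proof -
  assume z: "z \<in> WE"
  have "coef e z = (\<Sum>w\<in>W0. if w = z then v (int (lgt w) - int (lgt w0)) else 0)"
    unfolding e_def coef_sum coef_scale by (rule sum.cong[OF refl]) (use coef_T[OF W0_WE z] in auto)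
  then show ?thesis using finite_W0 by (simp add: sum.delta)
qed

lemma W0_simple_iff:
  assumes "i \<in> {1..n}" shows "refl_in (\<alpha> i) 0 \<odot> z \<in> W0 \<longleftrightarrow> z \<in> W0" "z \<odot> refl_in (\<alpha> i) 0 \<in> W0 \<longleftrightarrow> z \<in> W0"
  using W0_fcomp[OF W0_refl[OF assms]] W0_fcomp[OF _ W0_refl[OF assms]]
    S_involution(2)[OF simple_S[OF assms], of z] S_involution(3)[OF simple_S[OF assms], of z] by metis+

lemma v_step:
  "v (k - 1) + \<xi> * v k = v 1 * v k" "v (k + 1) = v 1 * v k"
  using v_add[of k "-1"] v_add[of 1 k] by (simp_all add: \<xi>_def algebra_simps)

lemma e_left: "left_eigen e"
  unfolding left_eigen_def
proof
  fix i assume i: "i \<in> {1..n}"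
  let ?s = "refl_in (\<alpha> i) 0"
  have s: "?s \<in> S" using simple_S[OF i] .
  show "T ?s * e = scale (v 1) e"
  proof (rule coef_eqI)
    fix z assume z: "z \<in> WE"
    have sz: "?s \<odot> z \<in> WE" using WE_fcomp S_aff_WE s z by blast
    show "coef (T ?s * e) z = coef (scale (v 1) e) z"
    proof (cases "z \<in> W0")
      case True
      consider "lgt z = lgt (?s \<odot> z) + 1" | "lgt (?s \<odot> z) = lgt z + 1" using len_S_left[OF s z] by blast
      then show ?thesis
      proof cases
        case 1
        define k where "k = int (lgt z) - int (lgt w0)"
        have eq: "int (lgt (?s \<odot> z)) - int (lgt w0) = k - 1" using 1 by (simp add: k_def)
        have "coef e (?s \<odot> z) = v (k - 1)" unfolding coef_e[OF sz] eq using True W0_simple_iff(1)[OF i] by simp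
        moreover have "coef e z = v k" using True by (simp add: coef_e[OF z] k_def)
        ultimately show ?thesis using 1 v_step[of k] by (simp add: coef_T_left[OF s z] coef_scale)
      next
        case 2
        define k where "k = int (lgt z) - int (lgt w0)"
        have eq: "int (lgt (?s \<odot> z)) - int (lgt w0) = k + 1" using 2 by (simp add: k_def)
        have "coef e (?s \<odot> z) = v (k + 1)" unfolding coef_e[OF sz] eq using True W0_simple_iff(1)[OF i] by simp
        moreover have "coef e z = v k" using True by (simp add: coef_e[OF z] k_def)
        ultimately show ?thesis using 2 v_step[of k] by (simp add: coef_T_left[OF s z] coef_scale)
      qed
    next
      case False
      then show ?thesis using W0_simple_iff(1)[OF i]
        by (simp add: coef_T_left[OF s z] coef_scale coef_e[OF z] coef_e[OF sz])
    qed
  qed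
qed

lemma e_right: assumes i: "i \<in> {1..n}" shows "e * T (refl_in (\<alpha> i) 0) = scale (v 1) e"
proof (rule coef_eqI)
  let ?s = "refl_in (\<alpha> i) 0"
  have s: "?s \<in> S" using simple_S[OF i] .
  fix z assume z: "z \<in> WE"
  have sz: "z \<odot> ?s \<in> WE" using WE_fcomp S_aff_WE s z by blast
  show "coef (e * T ?s) z = coef (scale (v 1) e) z"
  proof (cases "z \<in> W0")
    case True
    consider "lgt z = lgt (z \<odot> ?s) + 1" | "lgt (z \<odot> ?s) = lgt z + 1" using len_S_right[OF s z] by blast
    then show ?thesis
    proof cases
      case 1
      define k where "k = int (lgt z) - int (lgt w0)"
      have eq: "int (lgt (z \<odot> ?s)) - int (lgt w0) = k - 1" using 1 by (simp add: k_def)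
      have "coef e (z \<odot> ?s) = v (k - 1)" unfolding coef_e[OF sz] eq using True W0_simple_iff(2)[OF i] by simp
      moreover have "coef e z = v k" using True by (simp add: coef_e[OF z] k_def)
      ultimately show ?thesis using 1 v_step[of k] by (simp add: coef_T_right[OF s z] coef_scale)
    next
      case 2
      define k where "k = int (lgt z) - int (lgt w0)"
      have eq: "int (lgt (z \<odot> ?s)) - int (lgt w0) = k + 1" using 2 by (simp add: k_def)
      have "coef e (z \<odot> ?s) = v (k + 1)" unfolding coef_e[OF sz] eq using True W0_simple_iff(2)[OF i] by simp
      moreover have "coef e z = v k" using True by (simp add: coef_e[OF z] k_def)
      ultimately show ?thesis using 2 v_step[of k] by (simp add: coef_T_right[OF s z] coef_scale)
    qed
  next
    case False
    then show ?thesis using W0_simple_iff(2)[OF i]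
      by (simp add: coef_T_right[OF s z] coef_scale coef_e[OF z] coef_e[OF sz])
  qed
qed

lemma br_left_eigen: assumes "left_eigen h" shows "left_eigen (br h)"
  unfolding left_eigen_def
proof
  fix i assume i: "i \<in> {1..n}"
  let ?s = "refl_in (\<alpha> i) 0"
  have "br (T ?s * h) = br (scale (v 1) h)" using assms i by (simp add: left_eigen_def)
  then have "T ?s * br h - scale \<xi> (br h) = scale (v (-1)) (br h)"
    by (simp add: br_simps br_T_S[OF simple_S[OF i]] left_diff_distrib scale_mult)
  then have "T ?s * br h = scale (\<xi> + v (-1)) (br h)" by (simp add: M.scale_left_distrib algebra_simps)
  then show "T ?s * br h = scale (v 1) (br h)" by (simp add: \<xi>_def)
qed

lemma br_T_W0:
  assumes "w \<in> W0" "z \<in> WE" "z \<notin> W0" shows "coef (br (T w)) z = 0"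
proof -
  have "\<forall>w. w \<in> W0 \<longrightarrow> lgt w = N \<longrightarrow> (\<forall>z\<in>WE. z \<notin> W0 \<longrightarrow> coef (br (T w)) z = 0)" for N
  proof (induction N)
    case 0
    then show ?case using br_T_len_0[OF W0_WE] coef_T[OF W0_WE] by auto
  next
    case (Suc N)
    show ?case
    proof (intro allI impI ballI)
      fix w z assume w: "w \<in> W0" "lgt w = Suc N" and z: "z \<in> WE" "z \<notin> W0"
      then have "w \<noteq> id" using len_id by auto
      then obtain i where i: "i \<in> {1..n}" "lgt w = lgt (refl_in (\<alpha> i) 0 \<odot> w) + 1"
        using W0_left_descent[OF w(1)] by blast
      let ?s = "refl_in (\<alpha> i) 0"
      define w' where "w' = ?s \<odot> w"
      have s: "?s \<in> S" using simple_S[OF i(1)] .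
      have w': "w' \<in> W0" "lgt w' = N" using W0_fcomp[OF W0_refl[OF i(1)] w(1)] i(2) w(2) by (auto simp: w'_def)
      have "?s \<odot> w' = w" unfolding w'_def by (rule S_involution(2)[OF s])
      then have "T w = T ?s * T w'"
        using T_mult[OF S_aff_WE[OF s] W0_WE[OF w'(1)]] len_S[OF s] w' w by simp
      then have eq: "br (T w) = T ?s * br (T w') - scale \<xi> (br (T w'))"
        by (simp add: br_simps br_T_S[OF s] left_diff_distrib scale_mult)
      have sz: "?s \<odot> z \<in> WE" "?s \<odot> z \<notin> W0" using WE_fcomp S_aff_WE[OF s] z W0_simple_iff(1)[OF i(1)] by auto
      have "coef (br (T w')) z = 0" "coef (br (T w')) (?s \<odot> z) = 0" using Suc w' z sz by auto
      then show "coef (br (T w)) z = 0" unfolding eq coef_diff coef_scale coef_T_left[OF s z(1)] by simp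
    qed
  qed
  then show ?thesis using assms by blast
qed

text \<open>\<open>br e\<close> is again a left eigenvector supported on the finite group, so
  \<open>eigen_coef\<close> leaves one scalar to determine. The coefficient at \<open>w0\<close>,
  which triangularity shows to be 1, fixes it.\<close>

lemma br_e: "br e = e"
proof (rule coef_eqI)
  fix z assume z: "z \<in> WE"
  show "coef (br e) z = coef e z"
  proof (cases "z \<in> W0")
    case True
    have w0: "w0 \<in> W0" "w0 \<in> WE" using longest_props(1) W0_WE by auto
    have e0: "coef e w0 = 1" using coef_e[OF w0(2)] w0(1) by simp
    have "lgt u \<le> lgt w0" if "u \<in> WE" "coef e u \<noteq> 0" for u
      using that coef_e[of u] longest_props(3) by (auto split: if_splits)
    then have "coef (br e) w0 = bar_laurent (coef e w0)" by (intro coef_br_top[of e "lgt w0"]) (auto simp: w0)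
    then have top: "coef (br e) w0 = 1" using e0 by simp
    have eig: "coef (br e) w = v (int (lgt w)) * coef (br e) id" if "w \<in> W0" for w
      using eigen_coef[OF br_left_eigen[OF e_left] that id_min_reps] by simp
    have "v (- int (lgt w0)) * coef (br e) w0 = v (- int (lgt w0)) * v (int (lgt w0)) * coef (br e) id"
      using eig[OF w0(1)] by (simp add: mult.assoc)
    then have "coef (br e) id = v (- int (lgt w0))" unfolding top v_cancel by simp
    then show ?thesis using eig[OF True] coef_e[OF z] True v_add[of "int (lgt z)" "- int (lgt w0)"] by simp
  next
    case False
    have "coef (br e) z = (\<Sum>w\<in>supp e. bar_laurent (coef e w) * coef (br (T w)) z)"
      by (rule coef_linear) (auto simp: br_simps br_0)
    also have "\<dots> = 0"
    proof (rule sum.neutral, rule ballI)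
      fix w assume "w \<in> supp e"
      then have "w \<in> W0" using coef_e[of w] by (auto simp: supp_def split: if_splits)
      then show "bar_laurent (coef e w) * coef (br (T w)) z = 0" using br_T_W0 z False by simp
    qed
    finally show ?thesis using coef_e[OF z] False by simp
  qed
qed

lemma v_longest: assumes "w \<in> W0" shows "v (int (lgt w) - int (lgt w0)) \<in> deg_le 0"
    "w \<noteq> w0 \<Longrightarrow> v (int (lgt w) - int (lgt w0)) \<in> deg_le (-1)"
proof -
  show "v (int (lgt w) - int (lgt w0)) \<in> deg_le 0" using longest_props(3)[OF assms] by (intro v_deg_0) simp
  show "w \<noteq> w0 \<Longrightarrow> v (int (lgt w) - int (lgt w0)) \<in> deg_le (-1)"
    using longest_props(3)[OF assms] longest_props(4)[OF assms] by (intro v_deg_neg) linarith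
qed

lemma e_sum_lat:
  assumes "\<And>w. w \<in> W0 \<Longrightarrow> f w \<in> WE" "h = (\<Sum>w\<in>W0. scale (v (int (lgt w) - int (lgt w0))) (T (f w)))"
  shows "h \<in> lat 0" "h - T (f w0) \<in> lat (-1)"
proof -
  have sc: "scale a (T (f w)) \<in> lat d" if "a \<in> deg_le d" "w \<in> W0" for a w d
    using lat_scale[OF that(1) lat_T[OF assms(1)[OF that(2)]]] by simp
  show "h \<in> lat 0" unfolding assms(2) by (rule lat_sum) (use sc v_longest in blast)
  have w0: "w0 \<in> W0" using longest_props(1) .
  have "h = T (f w0) + (\<Sum>w\<in>W0 - {w0}. scale (v (int (lgt w) - int (lgt w0))) (T (f w)))"
    unfolding assms(2) using finite_W0 w0 by (subst sum.remove[of _ w0]) auto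
  moreover have "(\<Sum>w\<in>W0 - {w0}. scale (v (int (lgt w) - int (lgt w0))) (T (f w))) \<in> lat (-1)"
    by (rule lat_sum) (use sc v_longest in blast)
  ultimately show "h - T (f w0) \<in> lat (-1)" by simp
qed

lemma C_longest: "C w0 = e"
proof (rule bar_invariant_unique)
  have w0: "w0 \<in> WE" using W0_WE[OF longest_props(1)] .
  show "br (C w0) = C w0" by (rule C_bar[OF w0])
  show "br e = e" by (rule br_e)
  have "e - T w0 \<in> lat (-1)" by (rule e_sum_lat(2)[of "\<lambda>w. w"]) (auto simp: e_def W0_WE)
  then have "(C w0 - T w0) - (e - T w0) \<in> lat (-1)" using lat_diff C_lat[OF w0] by blast
  then show "C w0 - e \<in> lat (-1)" by simp
qed

lemma e_T_W0: assumes "w \<in> W0" shows "e * T w = scale (v (int (lgt w))) e"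
proof -
  have "\<forall>w. w \<in> W0 \<longrightarrow> lgt w = N \<longrightarrow> e * T w = scale (v (int (lgt w))) e" for N
  proof (induction N)
    case 0
    show ?case
    proof (intro allI impI)
      fix w assume w: "w \<in> W0" "lgt w = 0"
      then have "w = id" using W0_left_descent[OF w(1)] by auto
      then show "e * T w = scale (v (int (lgt w))) e" using w(2) T_id by simp
    qed
  next
    case (Suc N)
    show ?case
    proof (intro allI impI)
      fix w assume w: "w \<in> W0" "lgt w = Suc N"
      then have "w \<noteq> id" using len_id by auto
      then obtain i where i: "i \<in> {1..n}" "lgt w = lgt (refl_in (\<alpha> i) 0 \<odot> w) + 1"
        using W0_left_descent[OF w(1)] by blast
      let ?s = "refl_in (\<alpha> i) 0"
      define w' where "w' = ?s \<odot> w"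
      have s: "?s \<in> S" using simple_S[OF i(1)] .
      have w': "w' \<in> W0" "lgt w' = N" using W0_fcomp[OF W0_refl[OF i(1)] w(1)] i(2) w(2) by (auto simp: w'_def)
      have "?s \<odot> w' = w" unfolding w'_def by (rule S_involution(2)[OF s])
      then have Tw: "T w = T ?s * T w'"
        using T_mult[OF S_aff_WE[OF s] W0_WE[OF w'(1)]] len_S[OF s] w' w by simp
      have "e * T w = scale (v 1) (e * T w')" unfolding Tw mult.assoc[symmetric] e_right[OF i(1)] by (rule scale_mult(1))
      also have "\<dots> = scale (v 1) (scale (v (int N)) e)" using Suc w' by simp
      also have "\<dots> = scale (v (int (lgt w))) e" using v_add[of 1 "int N"] w(2) by (simp add: add.commute)
      finally show "e * T w = scale (v (int (lgt w))) e" .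
    qed
  qed
  then show ?thesis using assms by blast
qed

lemma e_T_min_reps: "y \<in> min_reps \<Longrightarrow> e * T y = (\<Sum>w\<in>W0. scale (v (int (lgt w) - int (lgt w0))) (T (w \<odot> y)))"
  unfolding e_def sum_distrib_right
  by (rule sum.cong[OF refl]) (simp add: scale_mult T_mult[OF W0_WE min_reps_WE] len_min_reps)

lemma e_T_lat:
  assumes "y \<in> min_reps" shows "e * T y \<in> lat 0" "e * T y - T (w0 \<odot> y) \<in> lat (-1)"
  using e_sum_lat[of "\<lambda>w. w \<odot> y", OF _ e_T_min_reps[OF assms]] WE_fcomp W0_WE min_reps_WE[OF assms] by auto

lemma e_T_coset:
  assumes "w \<in> W0" "y \<in> min_reps" shows "e * T (w \<odot> y) = scale (v (int (lgt w))) (e * T y)"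
proof -
  have "T (w \<odot> y) = T w * T y" using T_mult[OF W0_WE[OF assms(1)] min_reps_WE[OF assms(2)]] len_min_reps[OF assms] by simp
  then show ?thesis using e_T_W0[OF assms(1)] by (simp add: mult.assoc[symmetric] scale_mult)
qed

lemma coef_e_T:
  assumes "w \<in> W0" "y \<in> min_reps" "y' \<in> min_reps"
  shows "coef (e * T y) (w \<odot> y') = (if y = y' then v (int (lgt w) - int (lgt w0)) else 0)"
proof -
  have W: "u \<odot> y \<in> WE" "w \<odot> y' \<in> WE" if "u \<in> W0" for u
    using WE_fcomp[OF W0_WE min_reps_WE] that assms by auto
  have "coef (e * T y) (w \<odot> y') = (\<Sum>u\<in>W0. v (int (lgt u) - int (lgt w0)) * (if w \<odot> y' = u \<odot> y then 1 else 0))"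
    unfolding e_T_min_reps[OF assms(2)] coef_sum coef_scale using coef_T[OF W(1) W(2)[OF assms(1)]] by simp
  also have "\<dots> = (\<Sum>u\<in>W0. if u = w then (if y = y' then v (int (lgt u) - int (lgt w0)) else 0) else 0)"
  proof (rule sum.cong[OF refl])
    fix u assume u: "u \<in> W0"
    have "w \<odot> y' = u \<odot> y \<longleftrightarrow> u = w \<and> y = y'" using coset_unique[OF assms(1) u assms(3,2)] by auto
    then show "v (int (lgt u) - int (lgt w0)) * (if w \<odot> y' = u \<odot> y then 1 else 0) =
      (if u = w then (if y = y' then v (int (lgt u) - int (lgt w0)) else 0) else 0)" by simp
  qed
  also have "\<dots> = (if y = y' then v (int (lgt w) - int (lgt w0)) else 0)" using finite_W0 assms(1) by simp
  finally show ?thesis .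
qed

text \<open>The coefficients are read off at \<open>w0 \<odot> y\<close>, where
  \<open>e * T y\<close> has coefficient 1; elsewhere on the coset both sides follow the same powers
  of \<open>v\<close>.\<close>

lemma left_eigen_expand:
  assumes "left_eigen h"
  shows "finite {y \<in> min_reps. coef h (w0 \<odot> y) \<noteq> 0}"
    "h = (\<Sum>y\<in>{y \<in> min_reps. coef h (w0 \<odot> y) \<noteq> 0}. scale (coef h (w0 \<odot> y)) (e * T y))"
proof -
  let ?Y = "{y \<in> min_reps. coef h (w0 \<odot> y) \<noteq> 0}"
  have w0: "w0 \<in> W0" using longest_props(1) .
  have "(\<lambda>y. w0 \<odot> y) ` ?Y \<subseteq> supp h" using WE_fcomp[OF W0_WE[OF w0] min_reps_WE] by (auto simp: supp_def)
  moreover have "inj_on (\<lambda>y. w0 \<odot> y) ?Y" using coset_unique(2)[OF w0 w0] by (auto intro: inj_onI)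
  ultimately show fin: "finite ?Y" by (blast intro: finite_imageD[OF finite_subset[OF _ finite_supp]])
  show "h = (\<Sum>y\<in>?Y. scale (coef h (w0 \<odot> y)) (e * T y))"
  proof (rule coef_eqI)
    fix z assume "z \<in> WE"
    then obtain w y where wy: "w \<in> W0" "y \<in> min_reps" "z = w \<odot> y" using WE_decomp by blast
    have "coef (\<Sum>y\<in>?Y. scale (coef h (w0 \<odot> y)) (e * T y)) z
      = (\<Sum>y'\<in>?Y. if y' = y then coef h (w0 \<odot> y') * v (int (lgt w) - int (lgt w0)) else 0)"
      unfolding coef_sum coef_scale wy(3) by (rule sum.cong[OF refl]) (use coef_e_T[OF wy(1) _ wy(2)] in auto)
    also have "\<dots> = coef h (w0 \<odot> y) * v (int (lgt w) - int (lgt w0))" using fin wy(2) by (auto simp: sum.delta)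
    also have "\<dots> = v (int (lgt w0)) * v (int (lgt w) - int (lgt w0)) * coef h y"
      using eigen_coef[OF assms w0 wy(2)] by (simp add: mult_ac)
    also have "\<dots> = v (int (lgt w)) * coef h y" by (simp add: v_add[symmetric])
    also have "\<dots> = coef h z" using eigen_coef[OF assms wy(1,2)] wy(3) by simp
    finally show "coef h z = coef (\<Sum>y\<in>?Y. scale (coef h (w0 \<odot> y)) (e * T y)) z" by simp
  qed
qed

text \<open>Every simple reflection shortens \<open>w0\<close>, hence also
  \<open>w0 \<odot> y\<close>.\<close>

lemma C_left_eigen: assumes "y \<in> min_reps" shows "left_eigen (C (w0 \<odot> y))"
  unfolding left_eigen_def
proof
  fix i assume i: "i \<in> {1..n}"
  let ?s = "refl_in (\<alpha> i) 0"
  have w0: "w0 \<in> W0" "?s \<odot> w0 \<in> W0" using longest_props(1) W0_fcomp[OF W0_refl[OF i]] by auto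
  have "lgt (w0 \<odot> y) = lgt (?s \<odot> (w0 \<odot> y)) + 1"
    using len_min_reps[OF w0(1) assms] len_min_reps[OF w0(2) assms] simple_longest_descent[OF i]
    by (simp add: fcomp_assoc)
  then show "T ?s * C (w0 \<odot> y) = scale (v 1) (C (w0 \<odot> y))"
    by (rule C_eigen[OF simple_S[OF i] WE_fcomp[OF W0_WE[OF w0(1)] min_reps_WE[OF assms]]])
qed


section \<open>Orbits of minuscule weights\<close>

lemma orbit_minuscule: "minuscule \<omega> \<Longrightarrow> \<mu> \<in> weight_orbit n \<alpha> \<omega> \<Longrightarrow> minuscule \<mu>"
  unfolding orbit_image using minuscule_W0 by blast

lemma len_transl_orbit: "\<omega> \<in> P \<Longrightarrow> \<mu> \<in> weight_orbit n \<alpha> \<omega> \<Longrightarrow> lgt (transl \<mu>) = lgt (transl \<omega>)"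
  unfolding orbit_image using len_transl_W0 by blast

lemma antidominant_orbit:
  assumes "dominant \<omega>" "\<omega> \<in> P" "\<mu> \<in> weight_orbit n \<alpha> \<omega>" "antidominant \<mu>" shows "\<mu> = w0 \<omega>"
proof -
  obtain w where w: "w \<in> W0" "\<mu> = w \<omega>" using assms(3) unfolding orbit_image by blast
  let ?u = "inv w0 \<odot> w"
  have u: "?u \<in> W0" using W0_fcomp W0_inv longest_props(1) w(1) by blast
  have eq: "?u (w0 \<omega>) = \<mu>" using w longest_props(1) by (simp add: fcomp_apply)
  have "?u (w0 \<omega>) = w0 \<omega>"
    by (rule antidominant_unique[OF antidominant_longest[OF assms(1,2)] u]) (use eq assms(4) in simp)
  then show ?thesis using eq by simp
qed

text \<open>Undoing the direction of the nearest alcove makes \<open>\<mu>\<close> antidominant, and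
  the only antidominant weight in the orbit is \<open>w0 \<omega>\<close>.\<close>

lemma rep_dir_orbit:
  assumes "minuscule \<omega>" "dominant \<omega>" "\<mu> \<in> weight_orbit n \<alpha> \<omega>" shows "rep_dir \<mu> (w0 \<omega>) = \<mu>"
proof -
  have \<omega>: "\<omega> \<in> P" and m: "minuscule \<mu>" using assms minuscule_weight orbit_minuscule by auto
  have d: "rep_dir \<mu> \<in> W0" using rep_dir(1) m minuscule_weight by blast
  obtain w where w: "w \<in> W0" "\<mu> = w \<omega>" using assms(3) unfolding orbit_image by blast
  have "inv (rep_dir \<mu>) \<mu> = (w \<odot> inv (rep_dir \<mu>)) \<omega>" using w by (simp add: fcomp_apply)
  then have "inv (rep_dir \<mu>) \<mu> \<in> weight_orbit n \<alpha> \<omega>"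
    unfolding orbit_image using W0_fcomp[OF w(1) W0_inv[OF d]] by blast
  then have "inv (rep_dir \<mu>) \<mu> = w0 \<omega>"
    using antidominant_orbit[OF assms(2) \<omega>] rep_dir_antidominant[OF m] by blast
  then show ?thesis using W0_inv_simps(1)[OF d, of \<mu>] by simp
qed

text \<open>Sending \<open>w\<close> to the finite part of \<open>min_rep \<omega> \<odot> w\<close> identifies each fibre of \<open>w \<mapsto> w \<omega>\<close> with one and
  the same stabilizer.\<close>

lemma min_rep_fcomp_W0:
  assumes \<omega>: "minuscule \<omega>" "dominant \<omega>" and w: "w \<in> W0"
  defines "w' \<equiv> rep_dir \<omega> \<odot> w \<odot> inv (rep_dir (w \<omega>))"
  shows "w' \<in> W0" "min_rep \<omega> \<odot> w = w' \<odot> min_rep (w \<omega>)" "lgt w = lgt w' + lgt (min_rep (w \<omega>))"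
proof -
  have P: "\<omega> \<in> P" "w \<omega> \<in> P" using \<omega> minuscule_weight weights_W0 w by auto
  have d: "rep_dir \<omega> \<in> W0" "rep_dir (w \<omega>) \<in> W0" using rep_dir(1) P by auto
  show w': "w' \<in> W0" unfolding w'_def using W0_fcomp W0_inv d w by blast
  show eq: "min_rep \<omega> \<odot> w = w' \<odot> min_rep (w \<omega>)"
  proof
    fix x
    have "(w' \<odot> min_rep (w \<omega>)) x = w (rep_dir \<omega> x) + w \<omega>"
      using d by (simp add: w'_def min_rep_def fcomp_apply)
    also have "\<dots> = (min_rep \<omega> \<odot> w) x" using W0_linear_simps(1)[OF w] by (simp add: min_rep_def fcomp_apply)
    finally show "(min_rep \<omega> \<odot> w) x = (w' \<odot> min_rep (w \<omega>)) x" by simp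
  qed
  have "lgt (min_rep \<omega> \<odot> w) = lgt w"
    using len_0_fcomp(1)[OF min_rep_WE[OF P(1)] W0_WE[OF w] len_min_rep_dominant[OF \<omega>]] .
  then show "lgt w = lgt w' + lgt (min_rep (w \<omega>))"
    using len_min_reps[OF w' min_rep_min_reps[OF P(2)]] eq by simp
qed

lemma fibre_stabilizer:
  assumes \<omega>: "minuscule \<omega>" "dominant \<omega>" and \<mu>: "\<mu> \<in> weight_orbit n \<alpha> \<omega>"
  shows "bij_betw (\<lambda>w. rep_dir \<omega> \<odot> w \<odot> inv (rep_dir \<mu>)) {w \<in> W0. w \<omega> = \<mu>} {k \<in> W0. k (w0 \<omega>) = w0 \<omega>}"
proof (rule bij_betw_byWitness[where f' = "\<lambda>k. inv (rep_dir \<omega>) \<odot> k \<odot> rep_dir \<mu>"])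
  have P: "\<omega> \<in> P" "\<mu> \<in> P" using \<omega>(1) orbit_minuscule[OF \<omega>(1) \<mu>] minuscule_weight by auto
  have d: "rep_dir \<omega> \<in> W0" "rep_dir \<mu> \<in> W0" using rep_dir(1) P by auto
  have "id \<omega> \<in> weight_orbit n \<alpha> \<omega>" unfolding orbit_image using W0_id by blast
  then have wo: "rep_dir \<omega> (w0 \<omega>) = \<omega>" using rep_dir_orbit[OF \<omega>] by (simp add: id_apply)
  have wm: "rep_dir \<mu> (w0 \<omega>) = \<mu>" using rep_dir_orbit[OF \<omega> \<mu>] .
  have io: "inv (rep_dir \<omega>) \<omega> = w0 \<omega>" using W0_inv_simps(2)[OF d(1), of "w0 \<omega>"] wo by simp
  have im: "inv (rep_dir \<mu>) \<mu> = w0 \<omega>" using W0_inv_simps(2)[OF d(2), of "w0 \<omega>"] wm by simp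
  show "\<forall>w\<in>{w \<in> W0. w \<omega> = \<mu>}. inv (rep_dir \<omega>) \<odot> (rep_dir \<omega> \<odot> w \<odot> inv (rep_dir \<mu>)) \<odot> rep_dir \<mu> = w"
    using d by (auto simp: fun_eq_iff fcomp_apply)
  show "\<forall>k\<in>{k \<in> W0. k (w0 \<omega>) = w0 \<omega>}. rep_dir \<omega> \<odot> (inv (rep_dir \<omega>) \<odot> k \<odot> rep_dir \<mu>) \<odot> inv (rep_dir \<mu>) = k"
    using d by (auto simp: fun_eq_iff fcomp_apply)
  show "(\<lambda>w. rep_dir \<omega> \<odot> w \<odot> inv (rep_dir \<mu>)) ` {w \<in> W0. w \<omega> = \<mu>} \<subseteq> {k \<in> W0. k (w0 \<omega>) = w0 \<omega>}"
    using W0_fcomp[OF W0_fcomp[OF d(1)] W0_inv[OF d(2)]] wo im by (auto simp: fcomp_apply)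
  show "(\<lambda>k. inv (rep_dir \<omega>) \<odot> k \<odot> rep_dir \<mu>) ` {k \<in> W0. k (w0 \<omega>) = w0 \<omega>} \<subseteq> {w \<in> W0. w \<omega> = \<mu>}"
    using W0_fcomp[OF W0_fcomp[OF W0_inv[OF d(1)]] d(2)] io wm by (auto simp: fcomp_apply)
qed

end

context hecke_setting begin

section \<open>Multiplication by the minuscule elements\<close>

definition minuscule_elem :: "'v \<Rightarrow> 'h" where
  "minuscule_elem \<omega> = (\<Sum>\<mu>\<in>weight_orbit n \<alpha> \<omega>.
     scale (v (int (lgt (min_rep \<mu>)) - int (lgt (transl \<omega>)))) (e * T (min_rep \<mu>)))"

text \<open>Expand the right factor \<open>e\<close>. As \<open>min_rep \<omega>\<close> has length
  zero, its product with \<open>w\<close> again gives a single basis element, whose finite part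
  \<open>w'\<close> is absorbed by the left factor \<open>e\<close>. The coefficient of
  \<open>T w\<close> and the absorption each contribute \<open>lgt w'\<close> to the exponent,
  whence the 2. Summing over a fibre gives the Poincare polynomial of the stabilizer.\<close>

lemma stabilizer_sum:
  assumes \<omega>: "minuscule \<omega>" "dominant \<omega>"
  shows "e * T (min_rep \<omega>) * e = scale (v (int (lgt (transl \<omega>)) - int (lgt w0)) *
    (\<Sum>k\<in>{k \<in> W0. k (w0 \<omega>) = w0 \<omega>}. v (2 * int (lgt k)))) (minuscule_elem \<omega>)"
proof -
  let ?M = "int (lgt (transl \<omega>))" and ?l = "int (lgt w0)"
  let ?\<phi> = "\<lambda>\<mu> w. rep_dir \<omega> \<odot> w \<odot> inv (rep_dir \<mu>)"
  let ?b = "\<lambda>\<mu>. scale (v (int (lgt (min_rep \<mu>)) - ?M)) (e * T (min_rep \<mu>))"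
  let ?K = "{k \<in> W0. k (w0 \<omega>) = w0 \<omega>}"
  have P: "\<omega> \<in> P" using \<omega> minuscule_weight by blast
  have trm: "e * T (min_rep \<omega>) * scale (v (int (lgt w) - ?l)) (T w) =
      scale (v (?M - ?l) * v (2 * int (lgt (?\<phi> (w \<omega>) w)))) (?b (w \<omega>))" if w: "w \<in> W0" for w
  proof -
    let ?w' = "?\<phi> (w \<omega>) w"
    note d = min_rep_fcomp_W0[OF \<omega> w]
    have "T (min_rep \<omega>) * T w = T (?w' \<odot> min_rep (w \<omega>))"
      using T_mult[OF min_rep_WE[OF P] W0_WE[OF w]] len_min_rep_dominant[OF \<omega>]
        len_0_fcomp(1)[OF min_rep_WE[OF P] W0_WE[OF w] len_min_rep_dominant[OF \<omega>]] d(2) by simp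
    then have "e * T (min_rep \<omega>) * scale (v (int (lgt w) - ?l)) (T w) =
        scale (v (int (lgt w) - ?l)) (e * T (?w' \<odot> min_rep (w \<omega>)))"
      by (simp add: mult.assoc scale_mult)
    also have "\<dots> = scale (v (int (lgt w) - ?l) * v (int (lgt ?w'))) (e * T (min_rep (w \<omega>)))"
      using e_T_coset[OF d(1) min_rep_min_reps[OF weights_W0[OF P w]]] by simp
    also have "v (int (lgt w) - ?l) * v (int (lgt ?w')) =
        (v (?M - ?l) * v (2 * int (lgt ?w'))) * v (int (lgt (min_rep (w \<omega>))) - ?M)"
      unfolding v_add[symmetric] using d(3) by (simp add: algebra_simps)
    finally show ?thesis by simp
  qed
  have "e * T (min_rep \<omega>) * e = (\<Sum>w\<in>W0. scale (v (?M - ?l) * v (2 * int (lgt (?\<phi> (w \<omega>) w)))) (?b (w \<omega>)))"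
    by (subst (2) e_def) (simp add: sum_distrib_left trm)
  also have "\<dots> = (\<Sum>\<mu>\<in>(\<lambda>w. w \<omega>) ` W0. \<Sum>w\<in>{w \<in> W0. w \<omega> = \<mu>}. scale (v (?M - ?l) * v (2 * int (lgt (?\<phi> (w \<omega>) w)))) (?b (w \<omega>)))"
    by (rule sum.image_gen[OF finite_W0])
  also have "\<dots> = (\<Sum>\<mu>\<in>weight_orbit n \<alpha> \<omega>. scale (v (?M - ?l) * (\<Sum>k\<in>?K. v (2 * int (lgt k)))) (?b \<mu>))"
    unfolding orbit_image[symmetric]
  proof (rule sum.cong[OF refl])
    fix \<mu> assume \<mu>: "\<mu> \<in> weight_orbit n \<alpha> \<omega>"
    have "(\<Sum>w\<in>{w \<in> W0. w \<omega> = \<mu>}. scale (v (?M - ?l) * v (2 * int (lgt (?\<phi> (w \<omega>) w)))) (?b (w \<omega>)))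
      = (\<Sum>w\<in>{w \<in> W0. w \<omega> = \<mu>}. scale (v (?M - ?l) * v (2 * int (lgt (?\<phi> \<mu> w)))) (?b \<mu>))"
      by (rule sum.cong) auto
    also have "\<dots> = scale (v (?M - ?l) * (\<Sum>w\<in>{w \<in> W0. w \<omega> = \<mu>}. v (2 * int (lgt (?\<phi> \<mu> w))))) (?b \<mu>)"
      unfolding sum_distrib_left M.scale_sum_left by (rule refl)
    also have "(\<Sum>w\<in>{w \<in> W0. w \<omega> = \<mu>}. v (2 * int (lgt (?\<phi> \<mu> w)))) = (\<Sum>k\<in>?K. v (2 * int (lgt k)))"
      by (rule sum.reindex_bij_betw[OF fibre_stabilizer[OF \<omega> \<mu>]])
    finally show "(\<Sum>w\<in>{w \<in> W0. w \<omega> = \<mu>}. scale (v (?M - ?l) * v (2 * int (lgt (?\<phi> (w \<omega>) w)))) (?b (w \<omega>)))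
      = scale (v (?M - ?l) * (\<Sum>k\<in>?K. v (2 * int (lgt k)))) (?b \<mu>)" .
  qed
  also have "\<dots> = scale (v (?M - ?l) * (\<Sum>k\<in>?K. v (2 * int (lgt k)))) (minuscule_elem \<omega>)"
    unfolding minuscule_elem_def M.scale_sum_right by (rule refl)
  finally show ?thesis .
qed

text \<open>The constant coefficient counts the elements of length zero in the stabilizer, and the
  identity is one of them.\<close>

lemma stabilizer_sum_nonzero: "(\<Sum>k\<in>{k \<in> W0. k x = x}. v (2 * int (lgt k))) \<noteq> 0"
proof -
  let ?K = "{k \<in> W0. k x = x}"
  have fin: "finite ?K" using finite_W0 by simp
  have "lookup (\<Sum>k\<in>?K. v (2 * int (lgt k))) 0 = (\<Sum>k\<in>?K. if lgt k = 0 then 1 else 0)"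
    unfolding lookup_sum v_def lookup_qpow using c_pos by (intro sum.cong) auto
  also have "\<dots> = of_nat (card {k \<in> ?K. lgt k = 0})"
    using fin by (simp add: sum.If_cases Int_def)
  also have "\<dots> \<noteq> 0"
  proof -
    have "id \<in> {k \<in> ?K. lgt k = 0}" using W0_id len_id by (simp add: id_apply)
    moreover have "finite {k \<in> ?K. lgt k = 0}" by (rule finite_subset[OF _ fin]) blast
    ultimately have "card {k \<in> ?K. lgt k = 0} \<noteq> 0" using card_0_eq by blast
    then show ?thesis by (simp only: of_nat_eq_0_iff not_False_eq_True)
  qed
  finally show ?thesis by auto
qed

text \<open>Only for the antidominant weight \<open>w0 \<omega>\<close> of the orbit is the minimal
  representative as long as the translation. That term has exponent 0, the others have negative
  exponents.\<close>

lemma minuscule_elem_top: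
  assumes \<omega>: "minuscule \<omega>" "dominant \<omega>"
  shows "minuscule_elem \<omega> - T (transl \<omega> \<odot> w0) \<in> lat (-1)"
    "coef (minuscule_elem \<omega>) (transl \<omega> \<odot> w0) = 1"
    "z \<in> WE \<Longrightarrow> coef (minuscule_elem \<omega>) z \<noteq> 0 \<Longrightarrow> lgt z \<le> lgt (transl \<omega> \<odot> w0)"
proof -
  have P: "\<omega> \<in> P" using \<omega> minuscule_weight by blast
  let ?\<kappa> = "w0 \<omega>" and ?O = "weight_orbit n \<alpha> \<omega>" and ?M = "int (lgt (transl \<omega>))"
  have w0: "w0 \<in> W0" using longest_props(1) .
  have \<kappa>: "antidominant ?\<kappa>" "?\<kappa> \<in> ?O" using antidominant_longest[OF \<omega>(2) P] w0 unfolding orbit_image by auto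
  have \<kappa>P: "?\<kappa> \<in> P" using weights_W0[OF P w0] .
  have top: "transl \<omega> \<odot> w0 = w0 \<odot> transl ?\<kappa>" using longest_transl by simp
  have min_\<kappa>: "min_rep ?\<kappa> = transl ?\<kappa>" using min_rep_antidominant[OF \<kappa>(1)] .
  have len_\<kappa>: "lgt (transl ?\<kappa>) = lgt (transl \<omega>)" using len_transl_W0[OF w0 P] .
  have le: "lgt (min_rep \<mu>) \<le> lgt (transl \<omega>)" "\<mu> \<noteq> ?\<kappa> \<Longrightarrow> lgt (min_rep \<mu>) < lgt (transl \<omega>)" if \<mu>: "\<mu> \<in> ?O" for \<mu>
  proof -
    have m: "minuscule \<mu>" using orbit_minuscule[OF \<omega>(1) \<mu>] .
    note len = len_min_rep_le[OF m] len_transl_orbit[OF P \<mu>]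
    show "lgt (min_rep \<mu>) \<le> lgt (transl \<omega>)" using len by simp
    show "lgt (min_rep \<mu>) < lgt (transl \<omega>)" if "\<mu> \<noteq> ?\<kappa>"
    proof -
      have "\<not> antidominant \<mu>" using antidominant_orbit[OF \<omega>(2) P \<mu>] that by blast
      then show ?thesis using len by linarith
    qed
  qed
  have mr: "min_rep \<mu> \<in> min_reps" if "\<mu> \<in> ?O" for \<mu>
    using min_rep_min_reps minuscule_weight orbit_minuscule[OF \<omega>(1) that] by blast
  let ?t = "\<lambda>\<mu>. scale (v (int (lgt (min_rep \<mu>)) - ?M)) (e * T (min_rep \<mu>))"
  have "minuscule_elem \<omega> = ?t ?\<kappa> + (\<Sum>\<mu>\<in>?O - {?\<kappa>}. ?t \<mu>)"
    unfolding minuscule_elem_def using \<kappa>(2) finite_orbit by (rule sum.remove[rotated])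
  also have "?t ?\<kappa> = e * T (transl ?\<kappa>)" unfolding min_\<kappa> len_\<kappa> by simp
  finally have split: "minuscule_elem \<omega> = e * T (transl ?\<kappa>) + (\<Sum>\<mu>\<in>?O - {?\<kappa>}. ?t \<mu>)" .
  have rest: "(\<Sum>\<mu>\<in>?O - {?\<kappa>}. ?t \<mu>) \<in> lat (-1)"
  proof (rule lat_sum)
    fix \<mu> assume \<mu>: "\<mu> \<in> ?O - {?\<kappa>}"
    have "?t \<mu> \<in> lat (-1 + 0)"
      by (rule lat_scale[OF v_deg_neg e_T_lat(1)]) (use le(2)[of \<mu>] mr[of \<mu>] \<mu> in auto)
    then show "?t \<mu> \<in> lat (-1)" by simp
  qed
  have "e * T (transl ?\<kappa>) - T (w0 \<odot> transl ?\<kappa>) \<in> lat (-1)"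
    using e_T_lat(2)[OF transl_min_reps[OF \<kappa>(1)]] .
  then have "(e * T (transl ?\<kappa>) - T (w0 \<odot> transl ?\<kappa>)) + (\<Sum>\<mu>\<in>?O - {?\<kappa>}. ?t \<mu>) \<in> lat (-1)" using rest by (rule lat_add)
  then show "minuscule_elem \<omega> - T (transl \<omega> \<odot> w0) \<in> lat (-1)" unfolding split top by (simp add: algebra_simps)
  have cf: "coef (minuscule_elem \<omega>) (w \<odot> y) =
      (\<Sum>\<mu>\<in>?O. v (int (lgt (min_rep \<mu>)) - ?M) * (if min_rep \<mu> = y then v (int (lgt w) - int (lgt w0)) else 0))"
    if "w \<in> W0" "y \<in> min_reps" for w y
    unfolding minuscule_elem_def coef_sum coef_scale by (rule sum.cong[OF refl]) (use coef_e_T[OF that(1) mr that(2)] in simp)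
  have inj: "min_rep \<mu> = transl ?\<kappa> \<longleftrightarrow> \<mu> = ?\<kappa>" if "\<mu> \<in> ?O" for \<mu>
  proof
    assume "min_rep \<mu> = transl ?\<kappa>"
    then have "min_rep \<mu> 0 = ?\<kappa>" by simp
    then show "\<mu> = ?\<kappa>" using min_rep_0 minuscule_weight orbit_minuscule[OF \<omega>(1) that] by simp
  qed (simp add: min_\<kappa>)
  have "coef (minuscule_elem \<omega>) (w0 \<odot> transl ?\<kappa>) = (\<Sum>\<mu>\<in>?O. if \<mu> = ?\<kappa> then 1 else 0)"
    unfolding cf[OF w0 transl_min_reps[OF \<kappa>(1)]]
    by (rule sum.cong[OF refl]) (use inj min_\<kappa> len_\<kappa> in auto)
  then show "coef (minuscule_elem \<omega>) (transl \<omega> \<odot> w0) = 1" unfolding top using finite_orbit \<kappa>(2) by simp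
  show "lgt z \<le> lgt (transl \<omega> \<odot> w0)" if z: "z \<in> WE" and nz: "coef (minuscule_elem \<omega>) z \<noteq> 0"
  proof -
    obtain w y where wy: "w \<in> W0" "y \<in> min_reps" "z = w \<odot> y" using WE_decomp[OF z] by blast
    have "\<exists>\<mu>\<in>?O. min_rep \<mu> = y"
    proof (rule ccontr)
      assume "\<not> ?thesis"
      then have "coef (minuscule_elem \<omega>) (w \<odot> y) = 0" unfolding cf[OF wy(1,2)] by (intro sum.neutral) auto
      then show False using nz wy(3) by simp
    qed
    then obtain \<mu> where \<mu>: "\<mu> \<in> ?O" "min_rep \<mu> = y" by blast
    have "lgt z = lgt w + lgt y" using len_min_reps[OF wy(1,2)] wy(3) by simp
    also have "\<dots> \<le> lgt w0 + lgt (transl \<omega>)" using longest_props(3)[OF wy(1)] le(1)[OF \<mu>(1)] \<mu>(2) by simp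
    also have "\<dots> = lgt (transl \<omega> \<odot> w0)"
      unfolding top using len_min_reps[OF w0 transl_min_reps[OF \<kappa>(1)]] len_\<kappa> by simp
    finally show ?thesis .
  qed
qed

text \<open>\<open>minuscule_elem\<close> is a multiple of a bar invariant element, and its leading coefficient shows that
  the factor is bar invariant too.\<close>

lemma br_minuscule_elem:
  assumes \<omega>: "minuscule \<omega>" "dominant \<omega>" shows "br (minuscule_elem \<omega>) = minuscule_elem \<omega>"
proof -
  let ?F = "minuscule_elem \<omega>" and ?t = "transl \<omega> \<odot> w0"
  define a where "a = v (int (lgt (transl \<omega>)) - int (lgt w0)) * (\<Sum>k\<in>{k \<in> W0. k (w0 \<omega>) = w0 \<omega>}. v (2 * int (lgt k)))"
  have P: "\<omega> \<in> P" using \<omega> minuscule_weight by blast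
  have t: "?t \<in> WE" using WE_fcomp[OF transl_WE[OF P] W0_WE[OF longest_props(1)]] .
  have eq: "e * T (min_rep \<omega>) * e = scale a ?F" unfolding a_def by (rule stabilizer_sum[OF \<omega>])
  have a0: "a \<noteq> 0"
  proof
    assume "a = 0"
    moreover have "v (int (lgt (transl \<omega>)) - int (lgt w0)) \<noteq> 0"
      using v_cancel(2)[of "int (lgt (transl \<omega>)) - int (lgt w0)"] by (metis mult_zero_left zero_neq_one)
    ultimately show False using stabilizer_sum_nonzero[of "w0 \<omega>"] unfolding a_def by simp
  qed
  have "br (e * T (min_rep \<omega>) * e) = e * T (min_rep \<omega>) * e"
    using br_T_len_0[OF min_rep_WE[OF P] len_min_rep_dominant[OF \<omega>]] by (simp add: br_simps br_e)
  then have br_eq: "scale (bar_laurent a) (br ?F) = scale a ?F" unfolding eq by (simp add: br_simps)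
  have "coef (br ?F) ?t = bar_laurent (coef ?F ?t)"
    by (rule coef_br_top[of _ "lgt ?t"]) (use minuscule_elem_top(3)[OF \<omega>] t in auto)
  then have "coef (br ?F) ?t = 1" using minuscule_elem_top(2)[OF \<omega>] by simp
  then have "bar_laurent a = a"
    using arg_cong[OF br_eq, of "\<lambda>h. coef h ?t"] minuscule_elem_top(2)[OF \<omega>] by (simp add: coef_scale)
  then have "scale a (br ?F) = scale a ?F" using br_eq by simp
  then have "a * coef (br ?F) w = a * coef ?F w" for w by (metis coef_scale)
  \<comment> \<open>Laurent polynomials form a domain, so the nonzero factor cancels.\<close>
  then have "coef (br ?F) w = coef ?F w" for w using a0 by (metis mult_left_cancel)
  then show ?thesis by (intro coef_eqI)
qed

section \<open>The relative Kazhdan--Lusztig elements\<close>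

abbreviation "Pw i \<equiv> P_fund n \<Phi> \<alpha> scale T p i"

lemma T_X0_e: "x \<in> X0 n \<Phi> \<alpha> \<Longrightarrow> T x * e = (\<Sum>w\<in>W0. scale (v (int (lgt w) - int (lgt w0))) (T (x \<odot> w)))"
  unfolding e_def sum_distrib_left
  by (rule sum.cong[OF refl]) (simp add: scale_mult T_mult[OF X0_WE W0_WE] len_X0)

text \<open>Lengths add for products of \<open>X0\<close> with the finite group, so each
  \<open>T x' * e\<close> is free of positive degrees, and every coefficient but the one at
  \<open>x\<close> has negative degree.\<close>

lemma rel_elem_e:
  assumes x: "x \<in> X0 n \<Phi> \<alpha>" shows "rel_elem n \<Phi> \<alpha> scale T p x * e - T (x \<odot> w0) \<in> lat (-1)"
proof -
  let ?R = "{x' \<in> X0 n \<Phi> \<alpha>. p x' x \<noteq> 0}"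
  have pxx: "p x x = 1" and pneg: "\<And>x'. x' \<in> X0 n \<Phi> \<alpha> \<Longrightarrow> bruhat_le n \<Phi> \<alpha> x' x \<Longrightarrow> x' \<noteq> x \<Longrightarrow> p x' x \<in> laurent_neg"
    and p0: "\<And>x'. x' \<in> X0 n \<Phi> \<alpha> \<Longrightarrow> \<not> bruhat_le n \<Phi> \<alpha> x' x \<Longrightarrow> p x' x = 0"
    using rel_kl x unfolding relative_kl_family_def by blast+
  have "?R \<subseteq> {x'. bruhat_le n \<Phi> \<alpha> x' x}" using p0 by blast
  then have fin: "finite ?R" using finite_bruhat by (rule finite_subset)
  have lat: "T x' * e \<in> lat 0" "T x' * e - T (x' \<odot> w0) \<in> lat (-1)" if x': "x' \<in> X0 n \<Phi> \<alpha>" for x'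
    using e_sum_lat[of "\<lambda>w. x' \<odot> w", OF WE_fcomp[OF X0_WE[OF x'] W0_WE] T_X0_e[OF x']] by auto
  have xR: "x \<in> ?R" using x pxx by simp
  have "rel_elem n \<Phi> \<alpha> scale T p x * e = (\<Sum>x'\<in>?R. scale (p x' x) (T x' * e))"
    unfolding rel_elem_def sum_distrib_right scale_mult by (rule refl)
  also have "\<dots> = T x * e + (\<Sum>x'\<in>?R - {x}. scale (p x' x) (T x' * e))"
    using sum.remove[OF fin xR, of "\<lambda>x'. scale (p x' x) (T x' * e)"] pxx by simp
  finally have eq: "rel_elem n \<Phi> \<alpha> scale T p x * e = T x * e + (\<Sum>x'\<in>?R - {x}. scale (p x' x) (T x' * e))" .
  have "(\<Sum>x'\<in>?R - {x}. scale (p x' x) (T x' * e)) \<in> lat (-1)"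
  proof (rule lat_sum)
    fix x' assume x': "x' \<in> ?R - {x}"
    then have "x' \<in> X0 n \<Phi> \<alpha>" "x' \<noteq> x" "bruhat_le n \<Phi> \<alpha> x' x" using p0 by auto
    then have "p x' x \<in> deg_le (-1)" using pneg unfolding laurent_neg_deg by simp
    then have "scale (p x' x) (T x' * e) \<in> lat (-1 + 0)" by (rule lat_scale) (use lat x' in blast)
    then show "scale (p x' x) (T x' * e) \<in> lat (-1)" by simp
  qed
  then have "(T x * e - T (x \<odot> w0)) + (\<Sum>x'\<in>?R - {x}. scale (p x' x) (T x' * e)) \<in> lat (-1)"
    using lat(2)[OF x] by (intro lat_add)
  then show ?thesis unfolding eq by (simp add: algebra_simps)
qed

lemma br_rel_elem: "x \<in> X0 n \<Phi> \<alpha> \<Longrightarrow> y \<in> min_reps \<Longrightarrow>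
    br (rel_elem n \<Phi> \<alpha> scale T p x * C (w0 \<odot> y)) = rel_elem n \<Phi> \<alpha> scale T p x * C (w0 \<odot> y)"
  using rel_kl unfolding relative_kl_family_def inv_X0 by simp

text \<open>Both elements are bar invariant with the same leading term. For the left one this is the
  defining property of the relative family at the trivial coset.\<close>

lemma P_fund_e: assumes i: "i \<in> {1..n}" shows "Pw i * e = minuscule_elem (fund_weight n \<alpha> i)"
proof (rule bar_invariant_unique)
  let ?\<omega> = "fund_weight n \<alpha> i"
  have \<omega>: "minuscule ?\<omega>" "dominant ?\<omega>" using fund_weight_minuscule[OF i] fund_weight_dominant[OF i] by auto
  have X: "transl ?\<omega> \<in> X0 n \<Phi> \<alpha>" using transl_X0[OF \<omega>(2)] .
  show "br (Pw i * e) = Pw i * e"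
    using br_rel_elem[OF X id_min_reps] C_longest by (simp add: P_fund_def)
  show "br (minuscule_elem ?\<omega>) = minuscule_elem ?\<omega>" by (rule br_minuscule_elem[OF \<omega>])
  have "(Pw i * e - T (transl ?\<omega> \<odot> w0)) - (minuscule_elem ?\<omega> - T (transl ?\<omega> \<odot> w0)) \<in> lat (-1)"
    using rel_elem_e[OF X] minuscule_elem_top(1)[OF \<omega>] unfolding P_fund_def by (rule lat_diff)
  then show "Pw i * e - minuscule_elem ?\<omega> \<in> lat (-1)" by simp
qed

text \<open>Since lengths add, \<open>T (min_rep \<mu>) * T y\<close> is one basis element. Its
  finite part turns into a power of \<open>v\<close> when absorbed by \<open>e\<close>, and the loss
  estimate keeps the total exponent from being positive.\<close>

lemma minuscule_elem_T:
  assumes \<omega>: "minuscule \<omega>" and y: "y \<in> min_reps" and \<mu>: "\<mu> \<in> weight_orbit n \<alpha> \<omega>"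
  obtains w \<kappa> where "w \<in> W0" "\<kappa> \<in> P" "min_rep \<mu> \<odot> y = w \<odot> min_rep \<kappa>" "\<kappa> = lin y \<mu> + y 0"
    "lgt w + lgt (min_rep \<mu>) \<le> lgt (transl \<omega>)"
    "scale (v (int (lgt (min_rep \<mu>)) - int (lgt (transl \<omega>)))) (e * T (min_rep \<mu>)) * T y =
      scale (v (int (lgt (min_rep \<mu>)) + int (lgt w) - int (lgt (transl \<omega>)))) (e * T (min_rep \<kappa>))"
proof -
  have m: "minuscule \<mu>" "\<mu> \<in> P" using orbit_minuscule[OF \<omega> \<mu>] minuscule_weight by auto
  have W: "min_rep \<mu> \<in> WE" "y \<in> WE" "min_rep \<mu> \<odot> y \<in> WE"
    using min_rep_WE[OF m(2)] min_reps_WE[OF y] WE_fcomp by auto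
  define \<kappa> where "\<kappa> = (min_rep \<mu> \<odot> y) 0"
  have \<kappa>: "\<kappa> \<in> P" using WE_E(2)[OF W(3)] by (simp add: \<kappa>_def)
  obtain w where w: "w \<in> W0" "min_rep \<mu> \<odot> y = w \<odot> min_rep \<kappa>" using coset_decomp[OF W(3)] \<kappa>_def by auto
  have "lgt (transl \<mu>) = lgt (transl \<omega>)" using len_transl_orbit[OF minuscule_weight[OF \<omega>] \<mu>] .
  then have le: "lgt w + lgt (min_rep \<mu>) \<le> lgt (transl \<omega>)" using len_loss_le[OF m(1) y w \<kappa>] by simp
  have "T (min_rep \<mu>) * T y = T (w \<odot> min_rep \<kappa>)"
    using T_mult[OF W(1,2) len_min_rep_fcomp[OF m(1) y]] w(2) by simp
  then have "scale a (e * T (min_rep \<mu>)) * T y = scale a (e * T (w \<odot> min_rep \<kappa>))" for a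
    by (simp add: scale_mult mult.assoc)
  then have "scale (v (int (lgt (min_rep \<mu>)) - int (lgt (transl \<omega>)))) (e * T (min_rep \<mu>)) * T y =
      scale (v (int (lgt (min_rep \<mu>)) - int (lgt (transl \<omega>))) * v (int (lgt w))) (e * T (min_rep \<kappa>))"
    using e_T_coset[OF w(1) min_rep_min_reps[OF \<kappa>]] by simp
  also have "v (int (lgt (min_rep \<mu>)) - int (lgt (transl \<omega>))) * v (int (lgt w)) =
      v (int (lgt (min_rep \<mu>)) + int (lgt w) - int (lgt (transl \<omega>)))"
    unfolding v_add[symmetric] by (simp add: algebra_simps)
  finally show ?thesis using that[OF w(1) \<kappa> w(2) _ le] crossings_loss(1)[OF m(2) y w \<kappa>] by blast
qed

lemma minuscule_elem_T_lat:
  assumes "minuscule \<omega>" "y \<in> min_reps" shows "minuscule_elem \<omega> * T y \<in> lat 0"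
  unfolding minuscule_elem_def sum_distrib_right
proof (rule lat_sum)
  fix \<mu> assume "\<mu> \<in> weight_orbit n \<alpha> \<omega>"
  then obtain w \<kappa> where *: "\<kappa> \<in> P" "lgt w + lgt (min_rep \<mu>) \<le> lgt (transl \<omega>)"
    "scale (v (int (lgt (min_rep \<mu>)) - int (lgt (transl \<omega>)))) (e * T (min_rep \<mu>)) * T y =
      scale (v (int (lgt (min_rep \<mu>)) + int (lgt w) - int (lgt (transl \<omega>)))) (e * T (min_rep \<kappa>))"
    using minuscule_elem_T[OF assms] by metis
  have "scale (v (int (lgt (min_rep \<mu>)) + int (lgt w) - int (lgt (transl \<omega>)))) (e * T (min_rep \<kappa>)) \<in> lat (0 + 0)"
    by (rule lat_scale[OF v_deg_0 e_T_lat(1)[OF min_rep_min_reps[OF *(1)]]]) (use *(2) in simp)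
  then show "scale (v (int (lgt (min_rep \<mu>)) - int (lgt (transl \<omega>)))) (e * T (min_rep \<mu>)) * T y \<in> lat 0"
    unfolding *(3) by simp
qed

text \<open>By the equality case of the loss estimate the exponent is 0 exactly when
  \<open>\<nu> + \<mu>\<close> is antidominant, and then the minimal representative is the
  translation itself.\<close>

lemma minuscule_elem_T_transl:
  assumes \<omega>: "minuscule \<omega>" and \<nu>: "antidominant \<nu>"
  shows "minuscule_elem \<omega> * T (transl \<nu>) -
    (\<Sum>\<mu>\<in>{\<mu> \<in> weight_orbit n \<alpha> \<omega>. antidominant (\<nu> + \<mu>)}. T (w0 \<odot> transl (\<nu> + \<mu>))) \<in> lat (-1)"
proof -
  let ?O = "weight_orbit n \<alpha> \<omega>"
  let ?t = "\<lambda>\<mu>. scale (v (int (lgt (min_rep \<mu>)) - int (lgt (transl \<omega>)))) (e * T (min_rep \<mu>)) * T (transl \<nu>)"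
  have "?t \<mu> - (if antidominant (\<nu> + \<mu>) then T (w0 \<odot> transl (\<nu> + \<mu>)) else 0) \<in> lat (-1)" if \<mu>: "\<mu> \<in> ?O" for \<mu>
  proof -
    have m: "minuscule \<mu>" using orbit_minuscule[OF \<omega> \<mu>] .
    obtain w \<kappa> where *: "w \<in> W0" "\<kappa> \<in> P" "min_rep \<mu> \<odot> transl \<nu> = w \<odot> min_rep \<kappa>" "\<kappa> = lin (transl \<nu>) \<mu> + transl \<nu> 0"
      "lgt w + lgt (min_rep \<mu>) \<le> lgt (transl \<omega>)"
      "?t \<mu> = scale (v (int (lgt (min_rep \<mu>)) + int (lgt w) - int (lgt (transl \<omega>)))) (e * T (min_rep \<kappa>))"
      by (rule minuscule_elem_T[OF \<omega> transl_min_reps[OF \<nu>] \<mu>])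
    have \<kappa>: "\<kappa> = \<nu> + \<mu>" using *(4) by (simp add: id_apply add.commute)
    have "lgt (transl \<mu>) = lgt (transl \<omega>)" using len_transl_orbit[OF minuscule_weight[OF \<omega>] \<mu>] .
    then have iff: "lgt w + lgt (min_rep \<mu>) = lgt (transl \<omega>) \<longleftrightarrow> antidominant (\<nu> + \<mu>)"
      using len_loss_eq_iff[OF m \<nu> *(1,3,2)] by simp
    show ?thesis
    proof (cases "antidominant (\<nu> + \<mu>)")
      case True
      have "int (lgt (min_rep \<mu>)) + int (lgt w) - int (lgt (transl \<omega>)) = 0" using iff True by linarith
      then have "?t \<mu> = e * T (transl (\<nu> + \<mu>))"
        unfolding *(6) \<kappa> min_rep_antidominant[OF True] by simp
      then show ?thesis using True e_T_lat(2)[OF transl_min_reps[OF True]] by simp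
    next
      case False
      then have "lgt w + lgt (min_rep \<mu>) < lgt (transl \<omega>)" using iff *(5) by linarith
      then have "scale (v (int (lgt (min_rep \<mu>)) + int (lgt w) - int (lgt (transl \<omega>)))) (e * T (min_rep \<kappa>)) \<in> lat (-1 + 0)"
        by (intro lat_scale[OF v_deg_neg e_T_lat(1)[OF min_rep_min_reps[OF *(2)]]]) simp
      then show ?thesis using False unfolding *(6) by simp
    qed
  qed
  then have "(\<Sum>\<mu>\<in>?O. ?t \<mu> - (if antidominant (\<nu> + \<mu>) then T (w0 \<odot> transl (\<nu> + \<mu>)) else 0)) \<in> lat (-1)"
    by (rule lat_sum)
  moreover have "(\<Sum>\<mu>\<in>?O. if antidominant (\<nu> + \<mu>) then T (w0 \<odot> transl (\<nu> + \<mu>)) else 0)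
      = (\<Sum>\<mu>\<in>{\<mu> \<in> ?O. antidominant (\<nu> + \<mu>)}. T (w0 \<odot> transl (\<nu> + \<mu>)))"
    by (rule sum.inter_filter[OF finite_orbit, symmetric])
  ultimately show ?thesis unfolding minuscule_elem_def sum_distrib_right by (simp add: sum_subtractf)
qed

text \<open>The relative family makes the left side bar invariant for every coset, so a congruence
  modulo negative degrees is enough. In the expansion along \<open>e * T y\<close> only the leading
  term survives, because \<open>minuscule_elem\<close> creates no positive degrees.\<close>

theorem P_fund_C:
  assumes i: "i \<in> {1..n}" and \<nu>: "antidominant \<nu>"
  shows "Pw i * C (w0 \<odot> transl \<nu>) =
    (\<Sum>\<mu>\<in>{\<mu> \<in> weight_orbit n \<alpha> (fund_weight n \<alpha> i). antidominant (\<nu> + \<mu>)}. C (w0 \<odot> transl (\<nu> + \<mu>)))"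
proof (rule bar_invariant_unique)
  let ?\<omega> = "fund_weight n \<alpha> i"
  let ?A = "{\<mu> \<in> weight_orbit n \<alpha> ?\<omega>. antidominant (\<nu> + \<mu>)}"
  have \<omega>: "minuscule ?\<omega>" "dominant ?\<omega>" using fund_weight_minuscule[OF i] fund_weight_dominant[OF i] by auto
  have y: "transl \<nu> \<in> min_reps" using transl_min_reps[OF \<nu>] .
  have W: "w0 \<odot> y \<in> WE" if "y \<in> min_reps" for y using WE_fcomp[OF W0_WE[OF longest_props(1)] min_reps_WE[OF that]] .
  have WA: "w0 \<odot> transl (\<nu> + \<mu>) \<in> WE" if "\<mu> \<in> ?A" for \<mu> using W transl_min_reps that by blast
  show "br (Pw i * C (w0 \<odot> transl \<nu>)) = Pw i * C (w0 \<odot> transl \<nu>)"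
    using br_rel_elem[OF transl_X0[OF \<omega>(2)] y] by (simp add: P_fund_def)
  have "br (\<Sum>\<mu>\<in>A. C (w0 \<odot> transl (\<nu> + \<mu>))) = (\<Sum>\<mu>\<in>A. C (w0 \<odot> transl (\<nu> + \<mu>)))" if "A \<subseteq> ?A" for A
    using that WA by (induction A rule: infinite_finite_induct) (auto simp: br_0 br_simps C_bar)
  then show "br (\<Sum>\<mu>\<in>?A. C (w0 \<odot> transl (\<nu> + \<mu>))) = (\<Sum>\<mu>\<in>?A. C (w0 \<odot> transl (\<nu> + \<mu>)))" by blast
  let ?h = "C (w0 \<odot> transl \<nu>)"
  let ?Y = "{y \<in> min_reps. coef ?h (w0 \<odot> y) \<noteq> 0}"
  note ex = left_eigen_expand[OF C_left_eigen[OF y]]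
  have "Pw i * ?h = (\<Sum>y\<in>?Y. scale (coef ?h (w0 \<odot> y)) (minuscule_elem ?\<omega> * T y))"
    by (subst ex(2)) (simp add: sum_distrib_left scale_mult mult.assoc[symmetric] P_fund_e[OF i])
  moreover have "(\<Sum>y\<in>?Y. scale (coef ?h (w0 \<odot> y)) (minuscule_elem ?\<omega> * T y)) - minuscule_elem ?\<omega> * T (transl \<nu>) \<in> lat (-1)"
  proof -
    let ?g = "\<lambda>y. scale (coef ?h (w0 \<odot> y)) (minuscule_elem ?\<omega> * T y)"
    have other: "?g y \<in> lat (-1)" if y': "y \<in> min_reps" "y \<noteq> transl \<nu>" for y
    proof -
      have "w0 \<odot> y \<noteq> w0 \<odot> transl \<nu>" using coset_unique(2)[OF longest_props(1) longest_props(1) y'(1) y] y'(2) by blast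
      then have "coef ?h (w0 \<odot> y) \<in> deg_le (-1)" using C_coef_neg[OF W[OF y] W[OF y'(1)]] by blast
      then have "?g y \<in> lat (-1 + 0)" by (rule lat_scale[OF _ minuscule_elem_T_lat[OF \<omega>(1) y'(1)]])
      then show ?thesis by simp
    qed
    have self: "?g (transl \<nu>) - minuscule_elem ?\<omega> * T (transl \<nu>) \<in> lat (-1)"
    proof -
      have "scale (coef ?h (w0 \<odot> transl \<nu>) - 1) (minuscule_elem ?\<omega> * T (transl \<nu>)) \<in> lat (-1 + 0)"
        by (rule lat_scale[OF C_coef_self[OF W[OF y]] minuscule_elem_T_lat[OF \<omega>(1) y]])
      then show ?thesis by (simp add: M.scale_left_diff_distrib)
    qed
    \<comment> \<open>Inserting the translation is harmless: were it missing from \<open>?Y\<close>,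
      its coefficient would be 0.\<close>
    have "(\<Sum>y\<in>?Y. ?g y) = (\<Sum>y\<in>insert (transl \<nu>) ?Y. ?g y)"
      using ex(1) y by (intro sum.mono_neutral_left) auto
    also have "\<dots> = ?g (transl \<nu>) + (\<Sum>y\<in>?Y - {transl \<nu>}. ?g y)"
      using ex(1) by (simp add: sum.insert_remove)
    finally have eq: "(\<Sum>y\<in>?Y. ?g y) = ?g (transl \<nu>) + (\<Sum>y\<in>?Y - {transl \<nu>}. ?g y)" .
    have "(\<Sum>y\<in>?Y - {transl \<nu>}. ?g y) \<in> lat (-1)" by (rule lat_sum) (use other in blast)
    then have "(?g (transl \<nu>) - minuscule_elem ?\<omega> * T (transl \<nu>)) + (\<Sum>y\<in>?Y - {transl \<nu>}. ?g y) \<in> lat (-1)"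
      by (rule lat_add[OF self])
    then show ?thesis unfolding eq by (simp add: algebra_simps)
  qed
  ultimately have 1: "Pw i * ?h - minuscule_elem ?\<omega> * T (transl \<nu>) \<in> lat (-1)" by simp
  have 2: "minuscule_elem ?\<omega> * T (transl \<nu>) - (\<Sum>\<mu>\<in>?A. T (w0 \<odot> transl (\<nu> + \<mu>))) \<in> lat (-1)"
    by (rule minuscule_elem_T_transl[OF \<omega>(1) \<nu>])
  have 3: "(\<Sum>\<mu>\<in>?A. C (w0 \<odot> transl (\<nu> + \<mu>)) - T (w0 \<odot> transl (\<nu> + \<mu>))) \<in> lat (-1)"
    by (rule lat_sum[OF C_lat[OF WA]])
  have "(Pw i * ?h - minuscule_elem ?\<omega> * T (transl \<nu>)) + (minuscule_elem ?\<omega> * T (transl \<nu>) - (\<Sum>\<mu>\<in>?A. T (w0 \<odot> transl (\<nu> + \<mu>))))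
      - (\<Sum>\<mu>\<in>?A. C (w0 \<odot> transl (\<nu> + \<mu>)) - T (w0 \<odot> transl (\<nu> + \<mu>))) \<in> lat (-1)"
    by (rule lat_diff[OF lat_add[OF 1 2] 3])
  then show "Pw i * ?h - (\<Sum>\<mu>\<in>?A. C (w0 \<odot> transl (\<nu> + \<mu>))) \<in> lat (-1)" by (simp add: sum_subtractf)
qed


section \<open>Counting paths\<close>

abbreviation "orb i \<equiv> weight_orbit n \<alpha> (fund_weight n \<alpha> i)"

text \<open>The head of the list is the type of the last step.\<close>

primrec count_paths :: "nat list \<Rightarrow> 'v \<Rightarrow> nat" where
  "count_paths [] \<nu> = (if \<nu> = 0 then 1 else 0)"
| "count_paths (i # r) \<nu> = (if antidominant \<nu> then (\<Sum>\<mu>\<in>orb i. count_paths r (\<nu> - \<mu>)) else 0)"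

lemma antidominant_0: "antidominant 0"
  using weights_0 by (simp add: antidominant_def)

lemma count_paths_antidominant: "count_paths r \<nu> \<noteq> 0 \<Longrightarrow> antidominant \<nu>"
  using antidominant_0 by (cases r) (auto split: if_splits)

lemma finite_count_paths: "finite {\<nu>. count_paths r \<nu> \<noteq> 0}"
proof (induction r)
  case (Cons i r)
  have "{\<nu>. count_paths (i # r) \<nu> \<noteq> 0} \<subseteq> (\<lambda>(\<kappa>, \<mu>). \<kappa> + \<mu>) ` ({\<nu>. count_paths r \<nu> \<noteq> 0} \<times> orb i)"
  proof
    fix \<nu> assume "\<nu> \<in> {\<nu>. count_paths (i # r) \<nu> \<noteq> 0}"
    then have "(\<Sum>\<mu>\<in>orb i. count_paths r (\<nu> - \<mu>)) \<noteq> 0" by (simp split: if_splits)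
    then obtain \<mu> where "\<mu> \<in> orb i" "count_paths r (\<nu> - \<mu>) \<noteq> 0" by (meson sum.neutral)
    then show "\<nu> \<in> (\<lambda>(\<kappa>, \<mu>). \<kappa> + \<mu>) ` ({\<nu>. count_paths r \<nu> \<noteq> 0} \<times> orb i)"
      by (intro image_eqI[of _ _ "(\<nu> - \<mu>, \<mu>)"]) auto
  qed
  then show ?case by (rule finite_subset) (intro finite_imageI finite_cartesian_product Cons finite_orbit)
qed simp

lemma weight_paths_Nil: "weight_paths n \<Phi> \<alpha> [] 0 \<nu> = (if \<nu> = 0 then {[0]} else {})"
  using antidominant_0 by (auto simp: weight_paths_def length_Suc_conv antidominant_iff)

lemma weight_paths_snoc:
  "weight_paths n \<Phi> \<alpha> (m @ [i]) 0 \<nu> =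
    (if antidominant \<nu> then (\<Union>\<mu>\<in>orb i. (\<lambda>ys. ys @ [\<nu>]) ` weight_paths n \<Phi> \<alpha> m 0 (\<nu> - \<mu>)) else {})"
proof (cases "antidominant \<nu>")
  case True
  have "xs \<in> weight_paths n \<Phi> \<alpha> (m @ [i]) 0 \<nu> \<longleftrightarrow>
    (\<exists>\<mu>\<in>orb i. \<exists>ys\<in>weight_paths n \<Phi> \<alpha> m 0 (\<nu> - \<mu>). xs = ys @ [\<nu>])" for xs
  proof
    assume xs: "xs \<in> weight_paths n \<Phi> \<alpha> (m @ [i]) 0 \<nu>"
    then have len: "length xs = Suc (Suc (length m))" and x0: "xs ! 0 = 0" and xN: "xs ! Suc (length m) = \<nu>"
      and sub: "set xs \<subseteq> antidominant_weights n \<Phi> \<alpha>"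
      and step: "\<And>l. l < Suc (length m) \<Longrightarrow> xs ! Suc l - xs ! l \<in> weight_orbit n \<alpha> (fund_weight n \<alpha> ((m @ [i]) ! l))"
      by (auto simp: weight_paths_def)
    define ys where "ys = butlast xs"
    have "xs \<noteq> []" using len by auto
    then have xs_eq: "xs = ys @ [\<nu>]"
      using len xN append_butlast_last_id[of xs] by (simp add: ys_def last_conv_nth)
    have leny: "length ys = Suc (length m)" using len by (simp add: ys_def)
    have nth: "xs ! l = ys ! l" if "l \<le> length m" for l using that leny by (simp add: xs_eq nth_append)
    have "\<nu> - ys ! length m \<in> orb i" using step[of "length m"] xN nth[of "length m"] by simp
    moreover have "ys ! Suc l - ys ! l \<in> orb (m ! l)" if "l < length m" for l
      using step[of l] nth[of l] nth[of "Suc l"] that by (simp add: nth_append)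
    then have "ys \<in> weight_paths n \<Phi> \<alpha> m 0 (\<nu> - (\<nu> - ys ! length m))"
      using leny x0 nth[of 0] sub by (simp add: weight_paths_def xs_eq)
    ultimately show "\<exists>\<mu>\<in>orb i. \<exists>ys\<in>weight_paths n \<Phi> \<alpha> m 0 (\<nu> - \<mu>). xs = ys @ [\<nu>]" using xs_eq by blast
  next
    assume "\<exists>\<mu>\<in>orb i. \<exists>ys\<in>weight_paths n \<Phi> \<alpha> m 0 (\<nu> - \<mu>). xs = ys @ [\<nu>]"
    then obtain \<mu> ys where *: "\<mu> \<in> orb i" "ys \<in> weight_paths n \<Phi> \<alpha> m 0 (\<nu> - \<mu>)" "xs = ys @ [\<nu>]" by blast
    then have ys: "length ys = Suc (length m)" "ys ! 0 = 0" "ys ! length m = \<nu> - \<mu>" "set ys \<subseteq> antidominant_weights n \<Phi> \<alpha>"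
      "\<And>l. l < length m \<Longrightarrow> ys ! Suc l - ys ! l \<in> weight_orbit n \<alpha> (fund_weight n \<alpha> (m ! l))"
      by (auto simp: weight_paths_def)
    have "xs ! Suc l - xs ! l \<in> weight_orbit n \<alpha> (fund_weight n \<alpha> ((m @ [i]) ! l))" if l: "l < Suc (length m)" for l
    proof (cases "l < length m")
      case True
      then show ?thesis using ys(1,5) by (simp add: *(3) nth_append)
    next
      case False
      then have "l = length m" using l by simp
      then show ?thesis using ys(1,3) *(1) by (simp add: *(3) nth_append)
    qed
    then show "xs \<in> weight_paths n \<Phi> \<alpha> (m @ [i]) 0 \<nu>"
      using ys True antidominant_iff by (simp add: weight_paths_def *(3) nth_append)
  qed
  then have "weight_paths n \<Phi> \<alpha> (m @ [i]) 0 \<nu> = (\<Union>\<mu>\<in>orb i. (\<lambda>ys. ys @ [\<nu>]) ` weight_paths n \<Phi> \<alpha> m 0 (\<nu> - \<mu>))"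
    by blast
  then show ?thesis using True by simp
next
  case False
  have "\<nu> \<in> antidominant_weights n \<Phi> \<alpha>" if "xs \<in> weight_paths n \<Phi> \<alpha> (m @ [i]) 0 \<nu>" for xs
    using that nth_mem[of "Suc (length m)" xs] by (auto simp: weight_paths_def)
  then show ?thesis using False antidominant_iff by auto
qed

lemma card_weight_paths:
  "finite (weight_paths n \<Phi> \<alpha> m 0 \<nu>) \<and> card (weight_paths n \<Phi> \<alpha> m 0 \<nu>) = count_paths (rev m) \<nu>"
proof (induction m arbitrary: \<nu> rule: rev_induct)
  case (snoc i m)
  show ?case
  proof (cases "antidominant \<nu>")
    case True
    let ?A = "\<lambda>\<mu>. (\<lambda>ys. ys @ [\<nu>]) ` weight_paths n \<Phi> \<alpha> m 0 (\<nu> - \<mu>)"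
    have disj: "?A \<mu> \<inter> ?A \<mu>' = {}" if "\<mu> \<noteq> \<mu>'" for \<mu> \<mu>'
      using that by (auto simp: weight_paths_def)
    have cardA: "card (?A \<mu>) = count_paths (rev m) (\<nu> - \<mu>)" for \<mu>
      using snoc by (simp add: card_image inj_on_def)
    have "card (\<Union>\<mu>\<in>orb i. ?A \<mu>) = (\<Sum>\<mu>\<in>orb i. card (?A \<mu>))"
      by (rule card_UN_disjoint) (use finite_orbit snoc disj in auto)
    moreover have "finite (\<Union>\<mu>\<in>orb i. ?A \<mu>)" using finite_orbit snoc by auto
    ultimately show ?thesis using True cardA by (simp add: weight_paths_snoc)
  qed (simp add: weight_paths_snoc)
qed (simp add: weight_paths_Nil)

lemma path_count_eq: "path_count n \<Phi> \<alpha> m \<nu> = count_paths (rev m) \<nu>"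
  using card_weight_paths by (simp add: path_count_def)

text \<open>Reflection principle: on antidominant weights the count agrees with a function that is alternating for
  the Weyl group action fixing \<open>\<rho>\<close>, and for such functions the recursion has no boundary condition.\<close>

definition alt_start :: "'v \<Rightarrow> int" where
  "alt_start \<nu> = (\<Sum>w\<in>W0. if w (- \<rho>) + \<rho> = \<nu> then (-1) ^ lgt w else 0)"

definition alt_step :: "nat \<Rightarrow> ('v \<Rightarrow> int) \<Rightarrow> 'v \<Rightarrow> int" where
  "alt_step i f \<nu> = (\<Sum>\<mu>\<in>orb i. f (\<nu> - \<mu>))"

lemma alt_step_commute: "alt_step i \<circ> alt_step j = alt_step j \<circ> alt_step i"
proof (intro ext)
  fix f :: "'v \<Rightarrow> int" and \<nu>
  have "(\<Sum>\<mu>\<in>orb i. \<Sum>\<kappa>\<in>orb j. f (\<nu> - \<mu> - \<kappa>)) = (\<Sum>\<kappa>\<in>orb j. \<Sum>\<mu>\<in>orb i. f (\<nu> - \<mu> - \<kappa>))" by (rule sum.swap)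
  also have "\<dots> = (\<Sum>\<kappa>\<in>orb j. \<Sum>\<mu>\<in>orb i. f (\<nu> - \<kappa> - \<mu>))"
    by (intro sum.cong refl arg_cong[where f = f]) (simp add: algebra_simps)
  finally show "(alt_step i \<circ> alt_step j) f \<nu> = (alt_step j \<circ> alt_step i) f \<nu>" by (simp add: alt_step_def)
qed

definition alternating :: "('v \<Rightarrow> int) \<Rightarrow> bool" where
  "alternating f \<longleftrightarrow> (\<forall>j\<in>{1..n}. \<forall>\<nu>. f (refl_in (\<alpha> j) 0 (\<nu> - \<rho>) + \<rho>) = - f \<nu>)"

lemma alternating_start: "alternating alt_start"
  unfolding alternating_def
proof (intro ballI allI)
  fix j \<nu> assume j: "j \<in> {1..n}"
  let ?s = "refl_in (\<alpha> j) 0"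
  have s: "?s \<in> S" "?s \<in> W0" using simple_S W0_refl j by auto
  have ss: "?s (?s x) = x" for x by (rule refl_refl[OF simple_in[OF j]])
  have sign: "(-1) ^ lgt (w \<odot> ?s) = - ((-1) ^ lgt w :: int)" if "w \<in> W0" for w
    using len_S_right[OF s(1) W0_WE[OF that]] by auto
  have bij: "bij_betw (\<lambda>w. w \<odot> ?s) W0 W0"
    by (rule bij_betw_byWitness[where f' = "\<lambda>w. w \<odot> ?s"])
      (use S_involution(3)[OF s(1)] W0_fcomp[OF _ s(2)] in auto)
  have "alt_start (?s (\<nu> - \<rho>) + \<rho>) = (\<Sum>w\<in>W0. if (w \<odot> ?s) (- \<rho>) + \<rho> = ?s (\<nu> - \<rho>) + \<rho> then (-1) ^ lgt (w \<odot> ?s) else 0)"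
    unfolding alt_start_def by (rule sum.reindex_bij_betw[OF bij, symmetric])
  also have "\<dots> = (\<Sum>w\<in>W0. - (if w (- \<rho>) + \<rho> = \<nu> then (-1) ^ lgt w else 0))"
  proof (rule sum.cong[OF refl])
    fix w assume w: "w \<in> W0"
    have "(w \<odot> ?s) (- \<rho>) + \<rho> = ?s (\<nu> - \<rho>) + \<rho> \<longleftrightarrow> ?s (w (- \<rho>)) = ?s (\<nu> - \<rho>)" by (simp add: fcomp_apply)
    also have "\<dots> \<longleftrightarrow> w (- \<rho>) = \<nu> - \<rho>" using ss by metis
    also have "\<dots> \<longleftrightarrow> w (- \<rho>) + \<rho> = \<nu>" by (simp add: eq_diff_eq)
    finally show "(if (w \<odot> ?s) (- \<rho>) + \<rho> = ?s (\<nu> - \<rho>) + \<rho> then (-1) ^ lgt (w \<odot> ?s) else 0) =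
      - (if w (- \<rho>) + \<rho> = \<nu> then (-1) ^ lgt w else (0::int))" using sign[OF w] by simp
  qed
  finally show "alt_start (?s (\<nu> - \<rho>) + \<rho>) = - alt_start \<nu>" by (simp add: alt_start_def sum_negf)
qed

lemma alternating_step: assumes "alternating f" shows "alternating (alt_step i f)"
  unfolding alternating_def
proof (intro ballI allI)
  fix j \<nu> assume j: "j \<in> {1..n}"
  let ?s = "refl_in (\<alpha> j) 0"
  have s: "?s \<in> W0" using W0_refl j by auto
  have ss: "?s (?s x) = x" for x by (rule refl_refl[OF simple_in[OF j]])
  have orb: "?s \<mu> \<in> orb i" if \<mu>: "\<mu> \<in> orb i" for \<mu>
  proof -
    obtain w where "w \<in> W0" "\<mu> = w (fund_weight n \<alpha> i)" using \<mu> unfolding orbit_image by blast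
    then show ?thesis unfolding orbit_image
      by (intro image_eqI[of _ _ "w \<odot> ?s"]) (auto simp: fcomp_apply W0_fcomp[OF _ s])
  qed
  have bij: "bij_betw ?s (orb i) (orb i)"
    by (rule bij_betw_byWitness[where f' = ?s]) (use ss orb in auto)
  have "alt_step i f (?s (\<nu> - \<rho>) + \<rho>) = (\<Sum>\<mu>\<in>orb i. f (?s (\<nu> - \<rho>) + \<rho> - ?s \<mu>))"
    unfolding alt_step_def by (rule sum.reindex_bij_betw[OF bij, symmetric])
  also have "\<dots> = (\<Sum>\<mu>\<in>orb i. - f (\<nu> - \<mu>))"
  proof (rule sum.cong[OF refl])
    fix \<mu>
    have "?s (\<nu> - \<mu> - \<rho>) = ?s (\<nu> - \<rho> - \<mu>)" by (rule arg_cong[where f = ?s]) (simp add: algebra_simps)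
    also have "\<dots> = ?s (\<nu> - \<rho>) - ?s \<mu>" by (rule W0_linear_simps(2)[OF s])
    finally have eq: "?s (\<nu> - \<rho>) + \<rho> - ?s \<mu> = ?s (\<nu> - \<mu> - \<rho>) + \<rho>" by simp
    show "f (?s (\<nu> - \<rho>) + \<rho> - ?s \<mu>) = - f (\<nu> - \<mu>)"
      unfolding eq using assms j unfolding alternating_def by blast
  qed
  finally show "alt_step i f (?s (\<nu> - \<rho>) + \<rho>) = - alt_step i f \<nu>" by (simp add: alt_step_def sum_negf)
qed

text \<open>The shifted reflection fixes the hyperplane of pairing 1 with \<open>\<alpha> j\<close>,
  which is the first level outside the antidominant cone.\<close>

lemma alternating_wall:
  assumes "alternating f" "j \<in> {1..n}" "pr \<nu> (\<alpha> j) = 1" shows "f \<nu> = 0"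
proof -
  have "refl_in (\<alpha> j) 0 (\<nu> - \<rho>) + \<rho> = \<nu>" using assms(2,3) by (simp add: refl_simple pr_rho)
  then show ?thesis using assms(1,2) unfolding alternating_def by (metis equal_neg_zero)
qed

text \<open>\<open>- \<rho>\<close> is strictly antidominant, so a nontrivial \<open>w\<close> sends
  it to a vector with pairing 1 at some positive root. Adding \<open>\<rho>\<close> then leaves the
  antidominant cone, and only the identity contributes.\<close>

lemma alt_start_antidominant:
  assumes "antidominant \<nu>" shows "alt_start \<nu> = (if \<nu> = 0 then 1 else 0)"
proof -
  have only_id: "w = id" if w: "w \<in> W0" "w (- \<rho>) + \<rho> = \<nu>" for w
  proof (rule ccontr)
    assume "w \<noteq> id"
    then obtain i where i: "i \<in> {1..n}" "pr \<rho> (w (\<alpha> i)) < 0" using W0_left_descent[OF w(1)] by blast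
    have w\<rho>: "w (- \<rho>) = \<nu> - \<rho>" using w(2) by (simp add: eq_diff_eq)
    have wa: "- w (\<alpha> i) \<in> \<Phi>" using minus_root W0_root[OF w(1) simple_in[OF i(1)]] by blast
    have "pr \<nu> (- w (\<alpha> i)) \<le> 0" using assms wa i(2) unfolding antidominant_def by auto
    moreover have "pr (w (- \<rho>)) (- w (\<alpha> i)) = 1"
      using W0_pr[OF w(1), of "- \<rho>" "\<alpha> i"] pr_rho[OF i(1)] by simp
    ultimately show False using i(2) unfolding w\<rho> by simp
  qed
  have "alt_start \<nu> = (\<Sum>w\<in>W0. if w = id then (if \<nu> = 0 then 1 else 0) else 0)"
    unfolding alt_start_def
  proof (rule sum.cong[OF refl])
    fix w assume w: "w \<in> W0"
    show "(if w (- \<rho>) + \<rho> = \<nu> then (-1) ^ lgt w else 0) = (if w = id then (if \<nu> = 0 then 1 else 0) else (0::int))"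
      using only_id[OF w] len_id by (auto simp: id_apply[of "- \<rho>"])
  qed
  then show ?thesis using finite_W0 W0_id by simp
qed

lemma alternating_foldr: "alternating (foldr alt_step r alt_start)"
  by (induction r) (auto simp: alternating_start alternating_step id_apply[of alt_start])

text \<open>Dropping the boundary condition changes nothing: a minuscule step into the cone from
  outside starts on a wall, where an alternating function vanishes.\<close>

lemma count_paths_alternating:
  "set r \<subseteq> {1..n} \<Longrightarrow> antidominant \<nu> \<Longrightarrow> foldr alt_step r alt_start \<nu> = int (count_paths r \<nu>)"
proof (induction r arbitrary: \<nu>)
  case (Cons i r)
  have i: "i \<in> {1..n}" using Cons.prems by simp
  have "foldr alt_step r alt_start (\<nu> - \<mu>) = int (count_paths r (\<nu> - \<mu>))" if \<mu>: "\<mu> \<in> orb i" for \<mu>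
  proof (cases "antidominant (\<nu> - \<mu>)")
    case False
    have m: "minuscule \<mu>" using orbit_minuscule[OF fund_weight_minuscule[OF i] \<mu>] .
    have P: "\<nu> - \<mu> \<in> P" using weights_diff antidominant_weight[OF Cons.prems(2)] minuscule_weight[OF m] by blast
    then obtain j where j: "j \<in> {1..n}" "pr (\<nu> - \<mu>) (\<alpha> j) > 0"
      using False antidominant_simple by (meson not_le)
    obtain k l where k: "pr (\<nu> - \<mu>) (\<alpha> j) = of_int k" "pr \<mu> (\<alpha> j) = of_int l" "\<lfloor>pr \<mu> (\<alpha> j)\<rfloor> = l"
      using weight_int[OF P simple_in[OF j(1)]] weight_int[OF minuscule_weight[OF m] simple_in[OF j(1)]] by metis
    have "\<bar>l\<bar> \<le> 1" using m simple_in[OF j(1)] k(3) unfolding minuscule_def by blast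
    moreover have "pr \<nu> (\<alpha> j) \<le> 0" using Cons.prems(2) j(1) antidominant_simple by blast
    then have "of_int (k + l) \<le> (0::real)" using k(1,2) by simp
    then have "k + l \<le> 0" by (simp only: of_int_le_0_iff)
    moreover have "k > 0" using j(2) k(1) by simp
    \<comment> \<open>At \<open>\<alpha> j\<close> the pairing is positive before the step and at
      most 0 after it, while the step changes it by at most 1.\<close>
    ultimately have "k = 1" by linarith
    then have "foldr alt_step r alt_start (\<nu> - \<mu>) = 0"
      using alternating_wall[OF alternating_foldr j(1)] k(1) by simp
    then show ?thesis using count_paths_antidominant False by auto
  qed (use Cons in auto)
  then show ?case using Cons.prems(2) by (simp add: alt_step_def[of i])
qed (simp add: alt_start_antidominant id_apply[of alt_start])

text \<open>The unrestricted steps commute as operators, so their composition depends only on the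
  multiset of types. Off the antidominant weights both counts vanish.\<close>

lemma count_paths_mset:
  assumes "set r \<subseteq> {1..n}" "mset r = mset r'" shows "count_paths r = count_paths r'"
proof
  fix \<nu>
  have "foldr alt_step r = foldr alt_step r'"
    unfolding foldr_conv_fold
    by (rule fold_multiset_equiv) (use alt_step_commute assms(2) in auto)
  moreover have "set r' \<subseteq> {1..n}" using assms by (metis mset_eq_setD)
  ultimately have "antidominant \<nu> \<Longrightarrow> count_paths r \<nu> = count_paths r' \<nu>"
    using count_paths_alternating[of r \<nu>] count_paths_alternating[of r' \<nu>] assms(1) by simp
  then show "count_paths r \<nu> = count_paths r' \<nu>" using count_paths_antidominant by metis
qed

end

section \<open>Iterated products and the path formula\<close>

context hecke_setting begin

text \<open>The leftmost factor acts last, which matches the convention that the head of the list is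
  the type of the last step.\<close>

lemma P_word_C:
  assumes "set r \<subseteq> {1..n}"
  shows "P_word n \<Phi> \<alpha> scale T p r * C w0 =
    (\<Sum>\<nu>\<in>{\<nu>. count_paths r \<nu> \<noteq> 0}. of_nat (count_paths r \<nu>) * C (w0 \<odot> transl \<nu>))"
  using assms
proof (induction r)
  case Nil
  have "w0 \<odot> transl 0 = w0" unfolding transl_0 by (rule fcomp_id)
  then show ?case by (simp add: P_word_def del: transl_apply)
next
  case (Cons i r)
  let ?C = "\<lambda>\<nu>. C (w0 \<odot> transl \<nu>)"
  let ?K = "{\<nu>. count_paths r \<nu> \<noteq> 0}" and ?N = "{\<nu>. count_paths (i # r) \<nu> \<noteq> 0}"
  \<comment> \<open>A finite set containing every endpoint reached by one more step. It serves as a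
    common index set, independent of \<open>\<mu>\<close>, so that the two sums can be
    exchanged.\<close>
  define U where "U = (\<lambda>(\<kappa>, \<mu>). \<kappa> + \<mu>) ` (?K \<times> orb i)"
  have i: "i \<in> {1..n}" using Cons.prems by simp
  have finK: "finite ?K" and finU: "finite U" using finite_count_paths finite_orbit by (auto simp: U_def)
  let ?g = "\<lambda>\<kappa> \<nu>. if antidominant \<nu> then of_nat (count_paths r \<kappa>) * ?C \<nu> else 0"
  have "P_word n \<Phi> \<alpha> scale T p (i # r) * C w0 = Pw i * (P_word n \<Phi> \<alpha> scale T p r * C w0)"
    by (simp add: P_word_def mult.assoc)
  also have "\<dots> = (\<Sum>\<kappa>\<in>?K. of_nat (count_paths r \<kappa>) * (Pw i * ?C \<kappa>))"
  proof -
    have "Pw i * (of_nat k * x) = of_nat k * (Pw i * x)" for k x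
      by (metis mult.assoc mult_of_nat_commute)
    then show ?thesis using Cons by (simp add: sum_distrib_left del: transl_apply)
  qed
  also have "\<dots> = (\<Sum>\<kappa>\<in>?K. \<Sum>\<mu>\<in>orb i. ?g \<kappa> (\<kappa> + \<mu>))"
  proof (rule sum.cong[OF refl])
    fix \<kappa> assume "\<kappa> \<in> ?K"
    then have \<kappa>: "antidominant \<kappa>" using count_paths_antidominant by simp
    have "(\<Sum>\<mu>\<in>{\<mu> \<in> orb i. antidominant (\<kappa> + \<mu>)}. of_nat (count_paths r \<kappa>) * ?C (\<kappa> + \<mu>)) = (\<Sum>\<mu>\<in>orb i. ?g \<kappa> (\<kappa> + \<mu>))"
      by (rule sum.inter_filter[OF finite_orbit])
    then show "of_nat (count_paths r \<kappa>) * (Pw i * ?C \<kappa>) = (\<Sum>\<mu>\<in>orb i. ?g \<kappa> (\<kappa> + \<mu>))"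
      unfolding P_fund_C[OF i \<kappa>] sum_distrib_left .
  qed
  also have "\<dots> = (\<Sum>\<mu>\<in>orb i. \<Sum>\<kappa>\<in>?K. ?g \<kappa> (\<kappa> + \<mu>))" by (rule sum.swap)
  also have "\<dots> = (\<Sum>\<mu>\<in>orb i. \<Sum>\<nu>\<in>U. ?g (\<nu> - \<mu>) \<nu>)"
  proof (rule sum.cong[OF refl])
    fix \<mu> assume \<mu>: "\<mu> \<in> orb i"
    have sub: "(\<lambda>\<kappa>. \<kappa> + \<mu>) ` ?K \<subseteq> U"
    proof
      fix x assume "x \<in> (\<lambda>\<kappa>. \<kappa> + \<mu>) ` ?K"
      then obtain \<kappa> where "\<kappa> \<in> ?K" "x = \<kappa> + \<mu>" by blast
      then show "x \<in> U" unfolding U_def using \<mu> by (intro image_eqI[of _ _ "(\<kappa>, \<mu>)"]) auto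
    qed
    have "(\<Sum>\<kappa>\<in>?K. ?g \<kappa> (\<kappa> + \<mu>)) = (\<Sum>\<nu>\<in>(\<lambda>\<kappa>. \<kappa> + \<mu>) ` ?K. ?g (\<nu> - \<mu>) \<nu>)"
      by (subst sum.reindex) (simp_all add: inj_on_def cong: if_cong)
    also have "\<dots> = (\<Sum>\<nu>\<in>U. ?g (\<nu> - \<mu>) \<nu>)"
    proof (rule sum.mono_neutral_left[OF finU sub], rule ballI)
      fix \<nu> assume \<nu>: "\<nu> \<in> U - (\<lambda>\<kappa>. \<kappa> + \<mu>) ` ?K"
      have "\<nu> - \<mu> \<notin> ?K"
      proof
        assume "\<nu> - \<mu> \<in> ?K"
        then have "\<nu> - \<mu> + \<mu> \<in> (\<lambda>\<kappa>. \<kappa> + \<mu>) ` ?K" by (rule imageI)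
        then show False using \<nu> by simp
      qed
      then show "?g (\<nu> - \<mu>) \<nu> = 0" by simp
    qed
    finally show "(\<Sum>\<kappa>\<in>?K. ?g \<kappa> (\<kappa> + \<mu>)) = (\<Sum>\<nu>\<in>U. ?g (\<nu> - \<mu>) \<nu>)" .
  qed
  also have "\<dots> = (\<Sum>\<nu>\<in>U. \<Sum>\<mu>\<in>orb i. ?g (\<nu> - \<mu>) \<nu>)" by (rule sum.swap)
  also have "\<dots> = (\<Sum>\<nu>\<in>U. of_nat (count_paths (i # r) \<nu>) * ?C \<nu>)"
    by (rule sum.cong[OF refl]) (simp add: sum_distrib_right)
  also have "\<dots> = (\<Sum>\<nu>\<in>?N. of_nat (count_paths (i # r) \<nu>) * ?C \<nu>)"
  proof (rule sum.mono_neutral_right[OF finU])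
    show "?N \<subseteq> U"
    proof
      fix \<nu> assume "\<nu> \<in> ?N"
      then have "(\<Sum>\<mu>\<in>orb i. count_paths r (\<nu> - \<mu>)) \<noteq> 0" by (simp split: if_splits)
      then obtain \<mu> where "\<mu> \<in> orb i" "count_paths r (\<nu> - \<mu>) \<noteq> 0" by (meson sum.neutral)
      then show "\<nu> \<in> U" unfolding U_def by (intro image_eqI[of _ _ "(\<nu> - \<mu>, \<mu>)"]) auto
    qed
  qed simp
  finally show ?case .
qed

text \<open>Paths read \<open>m\<close> from the first step and the recursion from the last, so
  \<open>rev m\<close> appears; it has the same multiset as \<open>r\<close>, and the order is
  immaterial.\<close>

lemma P_word_C_paths:
  assumes "set r \<subseteq> {1..n}" "mset r = mset m"
  shows "P_word n \<Phi> \<alpha> scale T p r * C w0 =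
    (\<Sum>\<nu>\<in>{\<nu> \<in> antidominant_weights n \<Phi> \<alpha>. path_count n \<Phi> \<alpha> m \<nu> \<noteq> 0}.
       of_nat (path_count n \<Phi> \<alpha> m \<nu>) * C (w0 \<odot> transl \<nu>))"
proof -
  have eq: "count_paths r = count_paths (rev m)" by (rule count_paths_mset[OF assms(1)]) (simp add: assms(2))
  have "{\<nu> \<in> antidominant_weights n \<Phi> \<alpha>. path_count n \<Phi> \<alpha> m \<nu> \<noteq> 0} = {\<nu>. count_paths r \<nu> \<noteq> 0}"
    using count_paths_antidominant antidominant_iff unfolding path_count_eq eq by blast
  then show ?thesis using P_word_C[OF assms(1)] by (simp add: path_count_eq eq)
qed

end

theorem corollary6p5:
  fixes n :: nat and \<Phi> :: "'v::euclidean_space set" and \<alpha> :: "nat \<Rightarrow> 'v"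
    and L :: "('v \<Rightarrow> 'v) \<Rightarrow> nat"
    and scale :: "laurent \<Rightarrow> 'h::ring_1 \<Rightarrow> 'h" and T :: "('v \<Rightarrow> 'v) \<Rightarrow> 'h"
    and br :: "'h \<Rightarrow> 'h" and C :: "('v \<Rightarrow> 'v) \<Rightarrow> 'h"
    and p :: "('v \<Rightarrow> 'v) \<Rightarrow> ('v \<Rightarrow> 'v) \<Rightarrow> laurent"
    and a :: "nat \<Rightarrow> nat" and \<tau> :: 'v and r m :: "nat list"
  assumes "type_A_roots n \<Phi> \<alpha>"
    and "positive_weight_function n \<Phi> \<alpha> L"
    and "hecke_algebra n \<Phi> \<alpha> L scale T"
    and "bar_involution n \<Phi> \<alpha> scale T br"
    and "kl_basis n \<Phi> \<alpha> scale T br C"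
    and "relative_kl_family n \<Phi> \<alpha> scale T br C p"
    and "\<tau> = (\<Sum>i = 1..n. real (a i) *\<^sub>R fund_weight n \<alpha> i)"
    and "factor_order n \<alpha> \<tau> r"
    and "length m = (\<Sum>i = 1..n. a i)"
    and "set m \<subseteq> {1..n}"
    and "\<And>i. i \<in> {1..n} \<Longrightarrow> count_list m i = a i"
  shows "P_word n \<Phi> \<alpha> scale T p r * C (longest n \<Phi> \<alpha>) =
    (\<Sum>\<nu> \<in> {\<nu> \<in> antidominant_weights n \<Phi> \<alpha>. path_count n \<Phi> \<alpha> m \<nu> \<noteq> 0}.
       of_nat (path_count n \<Phi> \<alpha> m \<nu>) * C (longest n \<Phi> \<alpha> \<odot> transl \<nu>))"
proof -
  interpret hecke_setting n \<Phi> \<alpha> L scale T br C p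
    using assms(1-6) by unfold_locales
  have r: "set r \<subseteq> {1..n}" and \<tau>: "\<tau> = (\<Sum>i = 1..n. real (count_list r i) *\<^sub>R fund_weight n \<alpha> i)"
    using assms(8) by (auto simp: factor_order_def)
  \<comment> \<open>Pairing with the simple roots recovers the multiplicities from
    \<open>\<tau>\<close>, so \<open>r\<close> and \<open>m\<close> are rearrangements of each
    other.\<close>
  have coeff: "pr (\<Sum>i = 1..n. real (b i) *\<^sub>R fund_weight n \<alpha> i) (\<alpha> j) = real (b j)" if "j \<in> {1..n}" for b j
    using that by (simp add: pr_sum pr_fund_weight if_distrib cong: if_cong)
  have count: "count_list r j = count_list m j" if j: "j \<in> {1..n}" for j
    using coeff[OF j, of "count_list r"] coeff[OF j, of a] assms(7,11) \<tau> j by simp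
  have "mset r = mset m"
  proof (rule multiset_eqI)
    fix j
    show "count (mset r) j = count (mset m) j"
    proof (cases "j \<in> {1..n}")
      case True
      then show ?thesis using count by (simp add: count_mset)
    next
      case False
      then have "j \<notin> set r" "j \<notin> set m" using r assms(10) by auto
      then show ?thesis by (metis count_mset_0_iff)
    qed
  qed
  then show ?thesis by (rule P_word_C_paths[OF r])
qed

end
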